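(* Fix $\alpha\in\mathbb{Z}_+$ and $f_0,\dots,f_{\alpha-1}>0$. If $\nu$ is a compactly supported probability measure on $\mathbb{R}$ with $\#(\operatorname{supp}\nu)\ge35\alpha$, then the Lyapunov exponent satisfies $L(E)>0$ for all $E\in\mathbb{R}$.
   Context: Lyapunov exponent of the generalized Anderson model (with $V_0\equiv0$): for $E,\lambda\in\mathbb{R}$ let $T_i(\lambda,E)=\begin{pmatrix}E-f_i\lambda&-1\\1&0\end{pmatrix}$ and let the $\alpha$-step transfer matrix be $M_\lambda(E)=T_{\alpha-1}(\lambda,E)\cdots T_0(\lambda,E)\in SL(2,\mathbb{R})$. Let $\lambda_1,\lambda_2,\dots$ be i.i.d. with law $\nu$. Then $L(E)=\lim_{n\to\infty}\frac1n\log\|M_{\lambda_n}(E)\cdots M_{\lambda_1}(E)\|$, which exists and is almost surely constant. *)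

theory Defs
  imports "HOL-Probability.Probability"
begin

definition transfer :: "(nat \<Rightarrow> real) \<Rightarrow> nat \<Rightarrow> real \<Rightarrow> real \<Rightarrow> real^2^2" where
  "transfer f i l E = vector [vector [E - f i * l, -1], vector [1, 0]]"

fun transfer_prod :: "(nat \<Rightarrow> real) \<Rightarrow> real \<Rightarrow> real \<Rightarrow> nat \<Rightarrow> real^2^2" where
  "transfer_prod f l E 0 = mat 1"
| "transfer_prod f l E (Suc k) = transfer f k l E ** transfer_prod f l E k"

definition block_transfer :: "nat \<Rightarrow> (nat \<Rightarrow> real) \<Rightarrow> real \<Rightarrow> real \<Rightarrow> real^2^2" where
  "block_transfer \<alpha> f l E = transfer_prod f l E \<alpha>"

text \<open>Random product M_{omega(n-1)}(E) ... M_{omega 0}(E)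
  (omega 0, omega 1, ... play the role of lambda_1, lambda_2, ...).\<close>
fun cocycle :: "nat \<Rightarrow> (nat \<Rightarrow> real) \<Rightarrow> real \<Rightarrow> (nat \<Rightarrow> real) \<Rightarrow> nat \<Rightarrow> real^2^2" where
  "cocycle \<alpha> f E \<omega> 0 = mat 1"
| "cocycle \<alpha> f E \<omega> (Suc n) = block_transfer \<alpha> f (\<omega> n) E ** cocycle \<alpha> f E \<omega> n"

definition msupp :: "real measure \<Rightarrow> real set" where
  "msupp \<nu> = {x. \<forall>U. open U \<and> x \<in> U \<longrightarrow> emeasure \<nu> U > 0}"

end

theory Submission
  imports Defs "HOL-Computational_Algebra.Polynomial"
begin

text \<open>
  Linear maps of determinant one act unitarily on \<open>L\<^sup>2(\<real>\<^sup>2)\<close>, and positivity of the exponent follows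
  once the average \<open>P F (v) = E F(M v)\<close> of these unitaries satisfies \<open>\<parallel>P\<^sup>2 F\<parallel> \<le> c \<parallel>F\<parallel>\<close> with
  \<open>c < 1\<close>: applied to the indicator of the unit ball, this forces \<open>\<parallel>S\<^sub>n\<parallel>\<close> to be exponentially large
  with probability tending to one.

  If there were no such contraction, there would be unit vectors \<open>F\<^sub>n\<close> such that for almost every
  parameter \<open>F\<^sub>n \<circ> M\<close> is asymptotic to \<open>G\<^sub>n = P F\<^sub>n\<close> and \<open>G\<^sub>n \<circ> M\<close> to \<open>P G\<^sub>n\<close>. Then \<open>G\<^sub>n\<close> is
  asymptotically invariant under all \<open>M' M\<^sup>-\<^sup>1\<close> and \<open>M\<^sup>-\<^sup>1 M'\<close>. The group generated by these contains
  a hyperbolic element, because the commutator of a non-hyperbolic \<open>A\<close> with \<open>B\<close> has trace larger than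
  two unless \<open>B\<close> fixes a fixed point of \<open>A\<close>. So the mass of \<open>|G\<^sub>n|\<^sup>2\<close> concentrates in thin cones
  around the two eigenlines of the hyperbolic element, one of which carries more than a third of
  the mass. But each line has three different images under the matrices \<open>M\<close> (or under the \<open>M\<^sup>-\<^sup>1\<close>),
  since coincidences are roots of nonzero polynomials of degree at most \<open>\<alpha>\<close> in the coupling
  parameter; this is where the number of points of the support enters.

  The limit exists by subadditivity: exponential moments of blocks of independent factors give the
  upper bound, and covering \<open>{0..<n}\<close> greedily by blocks of small growth gives the lower bound.
\<close>

text \<open>Two averages are taken because one ties \<open>F\<close> only to \<open>G\<close> and
  yields the quotients \<open>inv2 g ** g'\<close>; the second ties \<open>G\<close> to
  \<open>H\<close> and yields \<open>g ** inv2 g'\<close>. Both kinds are needed: for \<alpha> = 1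
  every \<open>M\<close> sends the line of (0, 1) to the line of (1, 0), whatever the coupling, so
  only the inverses can separate the images of that line. Hence \<open>nondegenerate\<close> is an
  alternative between a family and the family of its inverses. Directions are complex because the
  fixed directions of an elliptic matrix are not real. No limit vector is taken, since a weak limit
  of unit vectors may vanish. Defects below \<open>(1/2) ^ n\<close> are summable, so the asymptotic
  relations hold for almost every parameter along the whole sequence, and only masses of fixed sets
  are compared in the limit. The region off the two cones has four disjoint preimages of
  asymptotically equal mass, so it carries about 1/4 at most and one cone keeps about 3/8; three
  disjoint preimages limit each cone to about 1/3. The threshold 7/20 lies strictly in
  between.\<close>

section \<open>Two by two matrices\<close>

text \<open>The adjugate. It inverts matrices of determinant one, has entries polynomial in those of
  \<open>A\<close>, and keeps the norm, which \<open>matrix_inv\<close> would not give by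
  computation.\<close>

definition inv2 :: "real^2^2 \<Rightarrow> real^2^2" where
  "inv2 A = vector [vector [A$2$2, - (A$1$2)], vector [- (A$2$1), A$1$1]]"

lemma inv2_nth [simp]: "inv2 A$1$1 = A$2$2" "inv2 A$1$2 = - (A$1$2)"
  "inv2 A$2$1 = - (A$2$1)" "inv2 A$2$2 = A$1$1"
  by (simp_all add: inv2_def)

lemma matrix2_eq_iff: "A = B \<longleftrightarrow> A$1$1 = B$1$1 \<and> A$1$2 = B$1$2 \<and> A$2$1 = B$2$1 \<and> A$2$2 = B$2$2"
  for A B :: "'a^2^2"
  by (auto simp: vec_eq_iff forall_2)

lemma matrix2_mult_nth: "(A ** B)$i$j = A$i$1 * B$1$j + A$i$2 * B$2$j"
  for A B :: "real^2^2"
  by (simp add: matrix_matrix_mult_def sum_2)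

lemma matrix2_vec_nth: "(A *v v)$i = A$i$1 * v$1 + A$i$2 * v$2"
  for A :: "real^2^2"
  by (simp add: matrix_vector_mult_def sum_2)

lemma mat2_1_nth: "(mat 1 :: real^2^2)$1$1 = 1" "(mat 1 :: real^2^2)$1$2 = 0"
  "(mat 1 :: real^2^2)$2$1 = 0" "(mat 1 :: real^2^2)$2$2 = 1"
  by (simp_all add: mat_def)

lemma inv2_mult: "det A = 1 \<Longrightarrow> inv2 A ** A = mat 1" "det A = 1 \<Longrightarrow> A ** inv2 A = mat 1"
  by (auto simp: matrix2_eq_iff matrix2_mult_nth mat2_1_nth det_2 algebra_simps)

lemma det_inv2 [simp]: "det (inv2 A) = det A"
  by (simp add: det_2 algebra_simps)

lemma inv2_cancel: "det A = 1 \<Longrightarrow> inv2 A *v (A *v v) = v" "det A = 1 \<Longrightarrow> A *v (inv2 A *v v) = v"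
  by (simp_all add: matrix_vector_mul_assoc inv2_mult)

text \<open>The norm of this type is the Frobenius norm. It is submultiplicative, but the identity
  has norm \<open>sqrt 2\<close>, which is felt later at time zero.\<close>

lemma norm_matrix2: "norm A = sqrt ((A$1$1)\<^sup>2 + (A$1$2)\<^sup>2 + (A$2$1)\<^sup>2 + (A$2$2)\<^sup>2)"
  for A :: "real^2^2"
  by (simp add: norm_vec_def L2_set_def sum_2 add.assoc)

lemma norm_vec2: "norm v = sqrt ((v$1)\<^sup>2 + (v$2)\<^sup>2)"
  for v :: "real^2"
  by (simp add: norm_vec_def L2_set_def sum_2)

lemma norm_matrix2_mult_le: "norm (A ** B) \<le> norm A * norm B"
  for A B :: "real^2^2"
proof -
  have *: "(a*p+b*q)\<^sup>2 \<le> (a\<^sup>2+b\<^sup>2)*(p\<^sup>2+q\<^sup>2)" for a b p q :: real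
    using zero_le_power2[of "a*q-b*p"] by (simp add: power2_eq_square algebra_simps)
  show ?thesis
    unfolding norm_matrix2 real_sqrt_mult[symmetric]
    apply (rule real_sqrt_le_mono)
    using *[of "A$1$1" "B$1$1" "A$1$2" "B$2$1"] *[of "A$1$1" "B$1$2" "A$1$2" "B$2$2"]
       *[of "A$2$1" "B$1$1" "A$2$2" "B$2$1"] *[of "A$2$1" "B$1$2" "A$2$2" "B$2$2"]
    by (simp add: matrix2_mult_nth algebra_simps)
qed

lemma norm_matrix2_vec_le: "norm (A *v v) \<le> norm A * norm v"
  for A :: "real^2^2"
proof -
  have *: "(a*p+b*q)\<^sup>2 \<le> (a\<^sup>2+b\<^sup>2)*(p\<^sup>2+q\<^sup>2)" for a b p q :: real
    using zero_le_power2[of "a*q-b*p"] by (simp add: power2_eq_square algebra_simps)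
  show ?thesis
    unfolding norm_matrix2 norm_vec2 real_sqrt_mult[symmetric]
    apply (rule real_sqrt_le_mono)
    using *[of "A$1$1" "v$1" "A$1$2" "v$2"] *[of "A$2$1" "v$1" "A$2$2" "v$2"]
    by (simp add: matrix2_vec_nth algebra_simps)
qed

lemma norm_matrix2_ge_1: "det A = 1 \<Longrightarrow> norm A \<ge> 1"
  for A :: "real^2^2"
proof -
  assume "det A = 1"
  moreover have "(A$1$1 - A$2$2)\<^sup>2 + (A$1$2 + A$2$1)\<^sup>2 \<ge> 0" by simp
  ultimately have "(A$1$1)\<^sup>2 + (A$1$2)\<^sup>2 + (A$2$1)\<^sup>2 + (A$2$2)\<^sup>2 \<ge> 2"
    by (simp add: det_2 power2_eq_square algebra_simps)
  then show ?thesis unfolding norm_matrix2 by simp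
qed

lemma norm_inv2 [simp]: "norm (inv2 A) = norm A"
  by (simp add: norm_matrix2 algebra_simps)

text \<open>The preimage of a box is its image under the inverse, a linear map of determinant one,
  and boxes determine \<open>lborel\<close>. This makes composition with such a matrix an isometry
  of the square integrable functions.\<close>

lemma distr_lborel_unimodular:
  fixes A :: "real^2^2"
  assumes "det A = 1"
  shows "distr lborel borel ((*v) A) = lborel"
proof (rule lborel_eqI[symmetric])
  show "sets (distr lborel borel ((*v) A)) = sets borel" by simp
  have [measurable]: "(*v) A \<in> borel \<rightarrow>\<^sub>M borel"
    by (intro borel_measurable_continuous_onI matrix_vector_mult_linear_continuous_on)
  fix l u :: "real^2" assume le: "\<And>b. b \<in> Basis \<Longrightarrow> l \<bullet> b \<le> u \<bullet> b"
  have eq: "(*v) A -` box l u = (*v) (inv2 A) ` box l u"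
    using assms by (force simp: inv2_cancel image_iff)
  have lin: "linear ((*v) (inv2 A))" by (rule matrix_vector_mul_linear)
  have m: "(*v) (inv2 A) ` box l u \<in> lmeasurable"
    by (rule measurable_linear_image[OF lin]) simp
  have "emeasure (distr lborel borel ((*v) A)) (box l u) = emeasure lborel ((*v) A -` box l u)"
    by (subst emeasure_distr) auto
  also have "\<dots> = emeasure lebesgue ((*v) (inv2 A) ` box l u)"
    unfolding eq[symmetric]
    using measurable_sets[OF \<open>(*v) A \<in> borel \<rightarrow>\<^sub>M borel\<close>, of "box l u"] by simp
  also have "\<dots> = measure lebesgue ((*v) (inv2 A) ` box l u)"
    using m by (simp add: emeasure_eq_measure2)
  also have "measure lebesgue ((*v) (inv2 A) ` box l u) = measure lebesgue (box l u)"
    by (subst measure_linear_image[OF lin]) (use assms in auto)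
  also have "ennreal (measure lebesgue (box l u)) = (\<Prod>b\<in>Basis. (u - l) \<bullet> b)"
    using le by (subst emeasure_eq_measure2[symmetric]) (simp_all add: emeasure_lborel_box)
  finally show "emeasure (distr lborel borel ((*v) A)) (box l u) = ennreal (\<Prod>b\<in>Basis. (u - l) \<bullet> b)" .
qed

text \<open>The left-hand side is the resultant of the quadratic forms \<open>v \<mapsto> det (v, A v)\<close> and
  \<open>v \<mapsto> det (v, B v)\<close>.\<close>
lemma trace_commutator2:
  fixes A B :: "real^2^2"
  assumes "det A = 1" "det B = 1"
  shows "(A$1$2 * B$2$1 - A$2$1 * B$1$2)\<^sup>2 - (A$2$1 * (B$2$2 - B$1$1) - B$2$1 * (A$2$2 - A$1$1)) *
     (B$1$2 * (A$1$1 - A$2$2) - A$1$2 * (B$1$1 - B$2$2)) = trace (A ** B ** inv2 A ** inv2 B) - 2"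
proof -
  have d: "A$1$1 * A$2$2 = 1 + A$1$2 * A$2$1" "B$1$1 * B$2$2 = 1 + B$1$2 * B$2$1"
    using assms by (simp_all add: det_2)
  show ?thesis
    unfolding trace_def sum_2 matrix2_mult_nth inv2_nth
    using d by algebra
qed

text \<open>For \<open>|trace A| <= 2\<close> the quadratic form of \<open>A\<close> has nonpositive
  discriminant, so its zeros are a conjugate pair or one double zero. The resultant with the form of
  \<open>B\<close> is then a nonnegative multiple of the squared modulus of the latter at such a
  zero. A commutator trace of at most 2 makes the resultant nonpositive, hence zero.\<close>

lemma eigenvector2_of_trace_commutator_le:
  fixes A B :: "real^2^2" and x y :: complex
  assumes "det A = 1" "det B = 1" "\<bar>trace A\<bar> \<le> 2" "A \<noteq> mat 1" "A \<noteq> - mat 1"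
    and "trace (A ** B ** inv2 A ** inv2 B) \<le> 2"
    and "A$2$1 * x * x + (A$2$2 - A$1$1) * x * y - A$1$2 * y * y = 0" "(x, y) \<noteq> (0, 0)"
  shows "B$2$1 * x * x + (B$2$2 - B$1$1) * x * y - B$1$2 * y * y = 0"
proof -
  have tr: "trace A = A$1$1 + A$2$2" by (simp add: trace_def sum_2)
  have "(trace A)\<^sup>2 \<le> 2\<^sup>2" using assms(3) by (simp only: abs_le_square_iff[symmetric])
  then have disc: "(A$2$2 - A$1$1)\<^sup>2 + 4 * A$1$2 * A$2$1 \<le> 0"
    using assms(1) by (simp add: tr det_2 power2_eq_square algebra_simps)
  have res: "(A$1$2 * B$2$1 - A$2$1 * B$1$2)\<^sup>2 - (A$2$1 * (B$2$2 - B$1$1) - B$2$1 * (A$2$2 - A$1$1)) *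
     (B$1$2 * (A$1$1 - A$2$2) - A$1$2 * (B$1$1 - B$2$2)) \<le> 0"
    using trace_commutator2[OF assms(1,2)] assms(6) by simp
  show ?thesis
  \<comment> \<open>In this case the double zero is at infinity, the direction \<open>y = 0\<close>;
    otherwise the affine coordinate \<open>z = x / y\<close> is available.\<close>
  proof (cases "A$2$1 = 0")
    case True
    then have ad: "A$2$2 = A$1$1" using disc by simp
    then have "A$1$1 * A$1$1 = 1" using assms(1) True by (simp add: det_2)
    then have "A$1$1 = 1 \<or> A$1$1 = -1" by (simp add: square_eq_1_iff)
    then have "A$1$2 \<noteq> 0" using assms(4,5) ad True by (auto simp: matrix2_eq_iff mat2_1_nth)
    moreover have "(A$1$2 * B$2$1)\<^sup>2 \<le> 0" using res by (simp add: True ad)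
    ultimately have "B$2$1 = 0" "y = 0" using assms(7) by (auto simp: True ad)
    then show ?thesis by simp
  next
    case c: False
    then have y: "y \<noteq> 0" using assms(7,8) by auto
    define z where "z = x / y"
    have x: "x = z * y" using y by (simp add: z_def)
    have "y * y * (A$2$1 * z * z + (A$2$2 - A$1$1) * z - A$1$2) = 0"
      using assms(7) by (simp add: x algebra_simps)
    then have q: "A$2$1 * z * z + (A$2$2 - A$1$1) * z - A$1$2 = 0" using y by simp
    have re: "A$2$1 * ((Re z)\<^sup>2 - (Im z)\<^sup>2) + (A$2$2 - A$1$1) * Re z - A$1$2 = 0"
      using arg_cong[OF q, of Re] by (simp add: power2_eq_square algebra_simps)
    have "Im z * (2 * A$2$1 * Re z + (A$2$2 - A$1$1)) = 0"
      using arg_cong[OF q, of Im] by (simp add: algebra_simps)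
    moreover have "2 * A$2$1 * Re z + (A$2$2 - A$1$1) = 0" if "Im z = 0"
    proof -
      have "(2 * A$2$1 * Re z + (A$2$2 - A$1$1))\<^sup>2 = (A$2$2 - A$1$1)\<^sup>2 + 4 * A$1$2 * A$2$1"
        using re that by algebra
      then have "(2 * A$2$1 * Re z + (A$2$2 - A$1$1))\<^sup>2 \<le> 0" using disc by simp
      then show ?thesis by (simp only: power2_less_eq_zero_iff)
    qed
    ultimately have b: "A$2$2 - A$1$1 = - 2 * A$2$1 * Re z" by auto
    then have g: "A$1$2 = - A$2$1 * ((Re z)\<^sup>2 + (Im z)\<^sup>2)" using re by algebra
    \<comment> \<open>\<open>u\<close> and \<open>w\<close> are the real and imaginary parts of the
      form of \<open>B\<close> at \<open>z\<close>; the resultant turns out to be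
      \<open>(A$2$1)\<^sup>2 * (u\<^sup>2 + w\<^sup>2)\<close>.\<close>
    define u where "u = B$2$1 * ((Re z)\<^sup>2 - (Im z)\<^sup>2) + (B$2$2 - B$1$1) * Re z - B$1$2"
    define w where "w = 2 * B$2$1 * Re z * Im z + (B$2$2 - B$1$1) * Im z"
    have "(A$2$1)\<^sup>2 * (u\<^sup>2 + w\<^sup>2) = (A$1$2 * B$2$1 - A$2$1 * B$1$2)\<^sup>2 - (A$2$1 * (B$2$2 - B$1$1) - B$2$1 * (A$2$2 - A$1$1)) *
     (B$1$2 * (A$1$1 - A$2$2) - A$1$2 * (B$1$1 - B$2$2))"
      unfolding u_def w_def using b g by algebra
    then have "(A$2$1)\<^sup>2 * (u\<^sup>2 + w\<^sup>2) \<le> 0" using res by linarith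
    then have "u\<^sup>2 + w\<^sup>2 \<le> 0" using c by (auto simp: mult_le_0_iff)
    then have "u = 0" "w = 0" by (simp_all add: sum_power2_le_zero_iff)
    then have "B$2$1 * z * z + (B$2$2 - B$1$1) * z - B$1$2 = 0"
      by (simp add: complex_eq_iff u_def w_def power2_eq_square algebra_simps)
    moreover have "B$2$1 * x * x + (B$2$2 - B$1$1) * x * y - B$1$2 * y * y =
        y * y * (B$2$1 * z * z + (B$2$2 - B$1$1) * z - B$1$2)"
      by (simp add: x algebra_simps)
    ultimately show ?thesis by simp
  qed
qed

lemma fixed_direction2_exists:
  fixes A :: "real^2^2"
  obtains x y :: complex where "(x, y) \<noteq> (0, 0)"
    "A$2$1 * x * x + (A$2$2 - A$1$1) * x * y - A$1$2 * y * y = 0"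
proof (cases "A$2$1 = 0")
  case True
  then show ?thesis using that[of 1 0] by simp
next
  case False
  define D where "D = csqrt (of_real ((A$2$2 - A$1$1)\<^sup>2 + 4 * A$1$2 * A$2$1))"
  have "D\<^sup>2 = (A$2$2 - A$1$1)\<^sup>2 + 4 * A$1$2 * A$2$1"
    unfolding D_def power2_csqrt by simp
  then have "A$2$1 * (D - (A$2$2 - A$1$1)) * (D - (A$2$2 - A$1$1))
     + (A$2$2 - A$1$1) * (D - (A$2$2 - A$1$1)) * (2 * A$2$1) - A$1$2 * (2 * A$2$1) * (2 * A$2$1) = 0"
    by (simp add: power2_eq_square) algebra
  then show ?thesis using that[of "D - (A$2$2 - A$1$1)" "2 * A$2$1"] False by simp
qed

lemma hyperbolic2_eigenvectors:
  fixes A :: "real^2^2"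
  assumes "det A = 1" "\<bar>trace A\<bar> > 2"
  obtains t p q where "\<bar>t\<bar> > 1" "A *v p = t *\<^sub>R p" "A *v q = (1 / t) *\<^sub>R q" "p$1 * q$2 - p$2 * q$1 \<noteq> 0"
proof -
  define \<tau> where "\<tau> = trace A"
  \<comment> \<open>The sign selects the root of larger modulus, so that both signs of the trace are
    covered at once.\<close>
  define t where "t = (\<tau> + sgn \<tau> * sqrt (\<tau>\<^sup>2 - 4)) / 2"
  have tr: "A$1$1 + A$2$2 = \<tau>" by (simp add: \<tau>_def trace_def sum_2)
  have dt: "A$1$1 * A$2$2 - A$1$2 * A$2$1 = 1" using assms(1) by (simp add: det_2)
  have \<tau>2: "\<tau>\<^sup>2 > 4"
    using assms(2) abs_le_square_iff[of \<tau> 2] by (simp add: \<tau>_def)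
  then have s2: "(sqrt (\<tau>\<^sup>2 - 4))\<^sup>2 = \<tau>\<^sup>2 - 4" by simp
  have sg: "(sgn \<tau>)\<^sup>2 = 1" using assms(2) by (auto simp: \<tau>_def sgn_if)
  have "2 * t = \<tau> + sgn \<tau> * sqrt (\<tau>\<^sup>2 - 4)" by (simp add: t_def)
  then have "4 * (t * t - \<tau> * t + 1) = 0"
    using s2 sg by algebra
  then have t1: "t * t - \<tau> * t + 1 = 0" by simp
  have "\<bar>t\<bar> \<ge> \<bar>\<tau>\<bar> / 2"
  proof (cases "\<tau> > 0")
    case True then show ?thesis using \<tau>2 by (simp add: t_def)
  next
    case False
    then have "\<tau> < 0" using \<tau>2 by (cases "\<tau> = 0") auto
    moreover have "sqrt (\<tau>\<^sup>2 - 4) \<ge> 0" using \<tau>2 by simp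
    moreover have "t = (\<tau> - sqrt (\<tau>\<^sup>2 - 4)) / 2" using \<open>\<tau> < 0\<close> by (simp add: t_def)
    ultimately have "t \<le> \<tau> / 2" by simp
    then show ?thesis using \<open>\<tau> < 0\<close> by simp
  qed
  then have tgt: "\<bar>t\<bar> > 1" using assms(2) by (simp add: \<tau>_def)
  then have t0: "t \<noteq> 0" by auto
  define t' where "t' = 1 / t"
  have t't: "t' * t = 1" using t0 by (simp add: t'_def)
  have "t * (t + t' - \<tau>) = 0"
    using t1 t't by (simp add: algebra_simps)
  then have sum: "t + t' = \<tau>" using t0 by simp
  have t1': "t' * t' - \<tau> * t' + 1 = 0"
    using t't by (simp add: sum[symmetric] algebra_simps)
  \<comment> \<open>The characteristic equation makes \<open>(A$1$2, s - A$1$1)\<close> and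
    \<open>(s - A$2$2, A$2$1)\<close> eigenvectors for a root \<open>s\<close>. Each may vanish,
    hence the case distinction below.\<close>
  have bc: "A$2$1 * A$1$2 + A$2$2 * (s - A$1$1) = s * (s - A$1$1)"
     "A$1$1 * (s - A$2$2) + A$1$2 * A$2$1 = s * (s - A$2$2)" if "s * s - \<tau> * s + 1 = 0" for s
    using that dt tr by algebra+
  have ne: "t - t' \<noteq> 0"
  proof
    assume "t - t' = 0"
    then have "t * t = 1" using t't by simp
    then show False using tgt by (auto simp: square_eq_1_iff)
  qed
  show ?thesis
  proof (cases "A$2$1 = 0 \<and> A$1$2 = 0")
    case True
    have "(A$1$1 - t) * (A$1$1 - t') = A$1$1 * (A$1$1 - (t + t')) + t' * t" by (simp add: algebra_simps)
    also have "\<dots> = 0" unfolding sum t't tr[symmetric] using dt True by simp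
    finally have "(A$1$1 - t) * (A$1$1 - t') = 0" .
    then consider "A$1$1 = t" "A$2$2 = t'" | "A$1$1 = t'" "A$2$2 = t" using tr sum by auto
    then show ?thesis
    proof cases
      case 1
      show ?thesis by (rule that[of t "vector [1, 0]" "vector [0, 1]"])
        (use tgt True 1 in \<open>auto simp: vec_eq_iff forall_2 matrix2_vec_nth t'_def\<close>)
    next
      case 2
      show ?thesis by (rule that[of t "vector [0, 1]" "vector [1, 0]"])
        (use tgt True 2 in \<open>auto simp: vec_eq_iff forall_2 matrix2_vec_nth t'_def\<close>)
    qed
  next
    case F: False
    show ?thesis
    proof (cases "A$2$1 = 0")
      case True
      then have b: "A$1$2 \<noteq> 0" using F by simp
      have "A *v vector [A$1$2, t - A$1$1] = t *\<^sub>R vector [A$1$2, t - A$1$1]"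
        unfolding vec_eq_iff forall_2 matrix2_vec_nth using bc[OF t1] by (simp add: algebra_simps)
      moreover have "A *v vector [A$1$2, t' - A$1$1] = (1/t) *\<^sub>R vector [A$1$2, t' - A$1$1]"
        unfolding t'_def[symmetric] vec_eq_iff forall_2 matrix2_vec_nth using bc[OF t1'] by (simp add: algebra_simps)
      moreover have "A$1$2 * (t' - A$1$1) - (t - A$1$1) * A$1$2 \<noteq> 0"
        using b ne by (simp add: algebra_simps)
      ultimately show ?thesis using that[of t "vector [A$1$2, t - A$1$1]" "vector [A$1$2, t' - A$1$1]"] tgt by simp
    next
      case c: False
      have "A *v vector [t - A$2$2, A$2$1] = t *\<^sub>R vector [t - A$2$2, A$2$1]"
        unfolding vec_eq_iff forall_2 matrix2_vec_nth using bc[OF t1] by (simp add: algebra_simps)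
      moreover have "A *v vector [t' - A$2$2, A$2$1] = (1/t) *\<^sub>R vector [t' - A$2$2, A$2$1]"
        unfolding t'_def[symmetric] vec_eq_iff forall_2 matrix2_vec_nth using bc[OF t1'] by (simp add: algebra_simps)
      moreover have "(t - A$2$2) * A$2$1 - A$2$1 * (t' - A$2$2) \<noteq> 0"
        using c ne by (simp add: algebra_simps)
      ultimately show ?thesis using that[of t "vector [t - A$2$2, A$2$1]" "vector [t' - A$2$2, A$2$1]"] tgt by simp
    qed
  qed
qed

section \<open>Square integrable functions on the plane\<close>

definition L2 :: "(real^2 \<Rightarrow> real) set" where
  "L2 = {F \<in> borel_measurable borel. integrable lborel (\<lambda>v. (F v)\<^sup>2)}"

definition sqn :: "(real^2 \<Rightarrow> real) \<Rightarrow> real" where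
  "sqn F = (\<integral>v. (F v)\<^sup>2 \<partial>lborel)"

definition mass :: "(real^2 \<Rightarrow> real) \<Rightarrow> (real^2) set \<Rightarrow> real" where
  "mass F B = (\<integral>v. indicator B v * (F v)\<^sup>2 \<partial>lborel)"

lemma L2_D: "F \<in> L2 \<Longrightarrow> F \<in> borel_measurable borel" "F \<in> L2 \<Longrightarrow> integrable lborel (\<lambda>v. (F v)\<^sup>2)"
  by (auto simp: L2_def)

lemma sqn_nonneg: "sqn F \<ge> 0"
  by (simp add: sqn_def)

lemma measurable_matrix_vector_mult [measurable]: "(*v) (A :: real^2^2) \<in> borel \<rightarrow>\<^sub>M borel"
  by (intro borel_measurable_continuous_onI matrix_vector_mult_linear_continuous_on)

lemma integral_unimodular:
  fixes f :: "real^2 \<Rightarrow> real"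
  assumes "det A = 1" and [measurable]: "f \<in> borel_measurable borel"
  shows "(\<integral>v. f (A *v v) \<partial>lborel) = (\<integral>v. f v \<partial>lborel)"
proof -
  have "(\<integral>v. f v \<partial>lborel) = (\<integral>v. f v \<partial>distr lborel borel ((*v) A))"
    using distr_lborel_unimodular[OF assms(1)] by simp
  also have "\<dots> = (\<integral>v. f (A *v v) \<partial>lborel)"
    by (rule integral_distr) simp_all
  finally show ?thesis by simp
qed

lemma nn_integral_unimodular:
  fixes f :: "real^2 \<Rightarrow> ennreal"
  assumes "det A = 1" and [measurable]: "f \<in> borel_measurable borel"
  shows "(\<integral>\<^sup>+v. f (A *v v) \<partial>lborel) = (\<integral>\<^sup>+v. f v \<partial>lborel)"
proof -
  have "(\<integral>\<^sup>+v. f v \<partial>lborel) = (\<integral>\<^sup>+v. f v \<partial>distr lborel borel ((*v) A))"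
    using distr_lborel_unimodular[OF assms(1)] by simp
  also have "\<dots> = (\<integral>\<^sup>+v. f (A *v v) \<partial>lborel)"
    by (rule nn_integral_distr) simp_all
  finally show ?thesis by simp
qed

lemma integrable_unimodular:
  fixes f :: "real^2 \<Rightarrow> real"
  assumes "det A = 1" and "integrable lborel f"
  shows "integrable lborel (\<lambda>v. f (A *v v))"
proof -
  have "integrable (distr lborel borel ((*v) A)) f"
    using distr_lborel_unimodular[OF assms(1)] assms(2) by simp
  then show ?thesis by (rule integrable_distr[rotated]) simp_all
qed

lemma L2_comp:
  assumes "F \<in> L2" "det A = 1"
  shows "(\<lambda>v. F (A *v v)) \<in> L2"
  using assms integrable_unimodular[of A "\<lambda>v. (F v)\<^sup>2"]
  by (auto simp: L2_def intro: measurable_compose[OF measurable_matrix_vector_mult])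

lemma sqn_comp:
  assumes "F \<in> L2" "det A = 1"
  shows "sqn (\<lambda>v. F (A *v v)) = sqn F"
  using assms integral_unimodular[of A "\<lambda>v. (F v)\<^sup>2"] by (auto simp: sqn_def L2_def)

lemma L2_diff:
  assumes "F \<in> L2" "H \<in> L2"
  shows "(\<lambda>v. F v - H v) \<in> L2"
proof -
  have [measurable]: "F \<in> borel_measurable borel" "H \<in> borel_measurable borel"
    using assms by (auto dest: L2_D)
  have "integrable lborel (\<lambda>v. (F v - H v)\<^sup>2)"
  proof (rule Bochner_Integration.integrable_bound)
    show "integrable lborel (\<lambda>v. 2 * (F v)\<^sup>2 + 2 * (H v)\<^sup>2)"
      using assms[THEN L2_D(2)] by simp
    show "AE v in lborel. norm ((F v - H v)\<^sup>2) \<le> norm (2 * (F v)\<^sup>2 + 2 * (H v)\<^sup>2)"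
    proof (rule AE_I2)
      fix v show "norm ((F v - H v)\<^sup>2) \<le> norm (2 * (F v)\<^sup>2 + 2 * (H v)\<^sup>2)"
        using zero_le_power2[of "F v + H v"] unfolding real_norm_def abs_of_nonneg[OF zero_le_power2]
        by (simp add: power2_eq_square algebra_simps)
    qed
  qed simp
  then show ?thesis by (simp add: L2_def)
qed

text \<open>The difference of the two sides is the integral of the square of
  \<open>F - 2 * H + K\<close>. The lossy factor 2 is harmless, as only convergence to zero is
  transported.\<close>

lemma sqn_triangle:
  assumes "F \<in> L2" "H \<in> L2" "K \<in> L2"
  shows "sqn (\<lambda>v. F v - K v) \<le> 2 * sqn (\<lambda>v. F v - H v) + 2 * sqn (\<lambda>v. H v - K v)"
proof -
  note I = L2_diff[OF assms(1,2), THEN L2_D(2)] L2_diff[OF assms(2,3), THEN L2_D(2)] L2_diff[OF assms(1,3), THEN L2_D(2)]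
  have "sqn (\<lambda>v. F v - K v) \<le> (\<integral>v. 2 * (F v - H v)\<^sup>2 + 2 * (H v - K v)\<^sup>2 \<partial>lborel)"
    unfolding sqn_def
  proof (rule integral_mono)
    fix v show "(F v - K v)\<^sup>2 \<le> 2 * (F v - H v)\<^sup>2 + 2 * (H v - K v)\<^sup>2"
      using zero_le_power2[of "F v - 2 * H v + K v"] by (simp add: power2_eq_square algebra_simps)
  qed (use I in auto)
  also have "\<dots> = 2 * sqn (\<lambda>v. F v - H v) + 2 * sqn (\<lambda>v. H v - K v)"
    unfolding sqn_def using I by simp
  finally show ?thesis .
qed

lemma integrable_mass:
  assumes "F \<in> L2" "B \<in> sets borel"
  shows "integrable lborel (\<lambda>v. indicator B v * (F v)\<^sup>2)"
  using integrable_mult_indicator[of B lborel "\<lambda>v. (F v)\<^sup>2"] assms by (auto dest: L2_D)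

lemma mass_comp:
  assumes "F \<in> L2" "det A = 1" "B \<in> sets borel"
  shows "mass (\<lambda>v. F (A *v v)) ((*v) A -` B) = mass F B"
proof -
  have [measurable]: "F \<in> borel_measurable borel" using assms by (auto dest: L2_D)
  note assms(3)[measurable]
  show ?thesis
    using integral_unimodular[of A "\<lambda>v. indicator B v * (F v)\<^sup>2"] assms(2)
    by (simp add: mass_def indicator_def)
qed

text \<open>Pointwise \<open>|x\<^sup>2 - y\<^sup>2| = |x - y| * |x + y|\<close>, and the weighted
  inequality of arithmetic and geometric means splits this product. The free weight \<open>t\<close>
  stands in for the square root of the Cauchy-Schwarz inequality.\<close>

lemma mass_diff_le:
  assumes "F \<in> L2" "H \<in> L2" "B \<in> sets borel" "t > 0"
  shows "\<bar>mass F B - mass H B\<bar> \<le> sqn (\<lambda>v. F v - H v) / t + t * (sqn F + sqn H)"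
proof -
  note I = assms(1,2)[THEN L2_D(2)] L2_diff[OF assms(1,2), THEN L2_D(2)]
    integrable_mass[OF assms(1,3)] integrable_mass[OF assms(2,3)]
  have "\<bar>mass F B - mass H B\<bar> = \<bar>\<integral>v. indicator B v * (F v)\<^sup>2 - indicator B v * (H v)\<^sup>2 \<partial>lborel\<bar>"
    unfolding mass_def using I by simp
  also have "\<dots> \<le> (\<integral>v. \<bar>indicator B v * (F v)\<^sup>2 - indicator B v * (H v)\<^sup>2\<bar> \<partial>lborel)"
    by (rule integral_abs_bound)
  also have "\<dots> \<le> (\<integral>v. (F v - H v)\<^sup>2 / t + t * ((F v)\<^sup>2 + (H v)\<^sup>2) \<partial>lborel)"
  proof (rule integral_mono)
    fix v
    have a: "\<bar>x\<^sup>2 - y\<^sup>2\<bar> \<le> (x - y)\<^sup>2 / t + t * (x\<^sup>2 + y\<^sup>2)" for x y :: real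
    proof -
      have "2 * (\<bar>x - y\<bar> / sqrt t) * (sqrt t * \<bar>x + y\<bar>) \<le> (\<bar>x - y\<bar> / sqrt t)\<^sup>2 + (sqrt t * \<bar>x + y\<bar>)\<^sup>2"
        by (rule sum_squares_bound)
      also have "\<dots> = (x - y)\<^sup>2 / t + t * (x + y)\<^sup>2"
        using assms(4) by (simp add: power_divide power_mult_distrib)
      also have "2 * (\<bar>x - y\<bar> / sqrt t) * (sqrt t * \<bar>x + y\<bar>) = 2 * \<bar>x\<^sup>2 - y\<^sup>2\<bar>"
        using assms(4) by (simp add: power2_eq_square square_diff_square_factored abs_mult)
      also have "(x - y)\<^sup>2 / t + t * (x + y)\<^sup>2 \<le> (x - y)\<^sup>2 / t + t * (2 * (x\<^sup>2 + y\<^sup>2))"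
        using assms(4) zero_le_power2[of "x - y"]
        by (intro add_left_mono mult_left_mono) (simp_all add: power2_eq_square algebra_simps)
      finally have *: "2 * \<bar>x\<^sup>2 - y\<^sup>2\<bar> \<le> (x - y)\<^sup>2 / t + 2 * (t * (x\<^sup>2 + y\<^sup>2))"
        by (simp add: algebra_simps)
      moreover have "(x - y)\<^sup>2 / t \<ge> 0" using assms(4) by simp
      moreover have "a \<le> b + c" if "2 * a \<le> b + 2 * c" "b \<ge> 0" for a b c :: real using that by linarith
      ultimately show ?thesis by blast
    qed
    have "0 \<le> (F v - H v)\<^sup>2 / t + t * ((F v)\<^sup>2 + (H v)\<^sup>2)" using assms(4) by simp
    then show "\<bar>indicator B v * (F v)\<^sup>2 - indicator B v * (H v)\<^sup>2\<bar> \<le> (F v - H v)\<^sup>2 / t + t * ((F v)\<^sup>2 + (H v)\<^sup>2)"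
      using a[of "F v" "H v"] by (simp add: indicator_def)
  qed (use I in \<open>auto intro!: integrable_abs Bochner_Integration.integrable_diff\<close>)
  also have "\<dots> = sqn (\<lambda>v. F v - H v) / t + t * (sqn F + sqn H)"
    unfolding sqn_def using I by (simp add: Bochner_Integration.integral_add)
  finally show ?thesis .
qed

definition asym_eq :: "(nat \<Rightarrow> real^2 \<Rightarrow> real) \<Rightarrow> (nat \<Rightarrow> real^2 \<Rightarrow> real) \<Rightarrow> bool" where
  "asym_eq F H \<longleftrightarrow> range F \<subseteq> L2 \<and> range H \<subseteq> L2 \<and> (\<lambda>n. sqn (\<lambda>v. F n v - H n v)) \<longlonglongrightarrow> 0"

lemma asym_eq_refl: "range F \<subseteq> L2 \<Longrightarrow> asym_eq F F"
  by (simp add: asym_eq_def sqn_def)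

lemma asym_eq_sym: "asym_eq F H \<Longrightarrow> asym_eq H F"
  by (simp add: asym_eq_def sqn_def power2_commute)

lemma asym_eq_trans:
  assumes "asym_eq F H" "asym_eq H K"
  shows "asym_eq F K"
proof -
  have in_L2: "F n \<in> L2" "H n \<in> L2" "K n \<in> L2" for n using assms by (auto simp: asym_eq_def)
  have "(\<lambda>n. 2 * sqn (\<lambda>v. F n v - H n v) + 2 * sqn (\<lambda>v. H n v - K n v)) \<longlonglongrightarrow> 2 * 0 + 2 * 0"
    using assms unfolding asym_eq_def by (intro tendsto_intros) auto
  then have "(\<lambda>n. sqn (\<lambda>v. F n v - K n v)) \<longlonglongrightarrow> 0"
    using tendsto_sandwich[OF always_eventually always_eventually tendsto_const, OF allI allI, OF sqn_nonneg sqn_triangle[OF in_L2]]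
    by simp
  then show ?thesis using in_L2 by (auto simp: asym_eq_def)
qed

lemma asym_eq_comp:
  assumes "asym_eq F H" "det A = 1"
  shows "asym_eq (\<lambda>n v. F n (A *v v)) (\<lambda>n v. H n (A *v v))"
proof -
  have in_L2: "F n \<in> L2" "H n \<in> L2" for n using assms by (auto simp: asym_eq_def)
  have "sqn (\<lambda>v. F n (A *v v) - H n (A *v v)) = sqn (\<lambda>v. F n v - H n v)" for n
    using sqn_comp[OF L2_diff[OF in_L2], of A] assms(2) by simp
  then show ?thesis using assms in_L2 by (auto simp: asym_eq_def intro!: L2_comp)
qed

lemma mass_asym_eq:
  assumes "asym_eq F H" "B \<in> sets borel" "\<And>n. sqn (F n) \<le> 1" "\<And>n. sqn (H n) \<le> 1"
  shows "(\<lambda>n. mass (F n) B - mass (H n) B) \<longlonglongrightarrow> 0"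
proof (rule LIMSEQ_I)
  fix r :: real assume r: "r > 0"
  have in_L2: "F n \<in> L2" "H n \<in> L2" for n using assms by (auto simp: asym_eq_def)
  have "(\<lambda>n. sqn (\<lambda>v. F n v - H n v) / (r/4)) \<longlonglongrightarrow> 0 / (r/4)"
    using assms(1) r unfolding asym_eq_def by (intro tendsto_intros) auto
  then have "eventually (\<lambda>n. sqn (\<lambda>v. F n v - H n v) / (r/4) < r/2) sequentially"
    by (rule order_tendstoD(2)) (use r in auto)
  then obtain N where N: "sqn (\<lambda>v. F n v - H n v) / (r/4) < r/2" if "n \<ge> N" for n
    by (auto simp: eventually_sequentially)
  have "norm (mass (F n) B - mass (H n) B - 0) < r" if "n \<ge> N" for n
  proof -
    have "r/4 * (sqn (F n) + sqn (H n)) \<le> r/4 * 2"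
      using r assms(3,4)[of n] by (intro mult_left_mono) auto
    then show ?thesis
      using mass_diff_le[OF in_L2[of n] assms(2), of "r/4"] N[OF that] r unfolding real_norm_def by linarith
  qed
  then show "\<exists>no. \<forall>n\<ge>no. norm (mass (F n) B - mass (H n) B - 0) < r" by blast
qed

definition asym_stab :: "(nat \<Rightarrow> real^2 \<Rightarrow> real) \<Rightarrow> (real^2^2) set" where
  "asym_stab G = {h. det h = 1 \<and> asym_eq (\<lambda>n v. G n (h *v v)) G}"

lemma asym_stab_mult: "h \<in> asym_stab G \<Longrightarrow> k \<in> asym_stab G \<Longrightarrow> h ** k \<in> asym_stab G"
  using asym_eq_trans[OF asym_eq_comp[of "\<lambda>n v. G n (h *v v)" G k], of G]
  by (auto simp: asym_stab_def det_mul matrix_vector_mul_assoc)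

lemma asym_stab_inv: "h \<in> asym_stab G \<Longrightarrow> inv2 h \<in> asym_stab G"
  using asym_eq_sym[OF asym_eq_comp[of "\<lambda>n v. G n (h *v v)" G "inv2 h"]]
  by (auto simp: asym_stab_def inv2_cancel)

text \<open>Composing the first relation with \<open>inv2 g\<close> shows \<open>F\<close>
  asymptotic to \<open>G\<close> after \<open>inv2 g\<close>; composing with \<open>g'\<close> leads
  back to \<open>G\<close>.\<close>

lemma asym_stab_left:
  assumes "det g = 1" "det g' = 1" "asym_eq (\<lambda>n v. F n (g *v v)) G" "asym_eq (\<lambda>n v. F n (g' *v v)) G"
  shows "inv2 g ** g' \<in> asym_stab G"
proof -
  have "asym_eq (\<lambda>n v. F n v) (\<lambda>n v. G n (inv2 g *v v))"
    using asym_eq_comp[OF assms(3), of "inv2 g"] assms(1) by (simp add: inv2_cancel)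
  then have "asym_eq (\<lambda>n v. F n (g' *v v)) (\<lambda>n v. G n (inv2 g *v (g' *v v)))"
    by (rule asym_eq_comp) fact
  then have "asym_eq (\<lambda>n v. G n (inv2 g *v (g' *v v))) G"
    using assms(4) by (blast intro: asym_eq_sym asym_eq_trans)
  then show ?thesis using assms by (simp add: asym_stab_def det_mul matrix_vector_mul_assoc)
qed

lemma asym_stab_right:
  assumes "det g = 1" "det g' = 1" "asym_eq (\<lambda>n v. G n (g *v v)) H" "asym_eq (\<lambda>n v. G n (g' *v v)) H"
  shows "g ** inv2 g' \<in> asym_stab G"
proof -
  have "asym_eq (\<lambda>n v. G n (g *v v)) (\<lambda>n v. G n (g' *v v))"
    using assms by (blast intro: asym_eq_sym asym_eq_trans)
  then have "asym_eq (\<lambda>n v. G n (g *v (inv2 g' *v v))) (\<lambda>n v. G n (g' *v (inv2 g' *v v)))"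
    by (rule asym_eq_comp) (simp add: assms)
  then have "asym_eq (\<lambda>n v. G n (g *v (inv2 g' *v v))) G"
    by (simp add: inv2_cancel assms)
  then show ?thesis using assms by (simp add: asym_stab_def det_mul matrix_vector_mul_assoc)
qed

section \<open>Hyperbolic elements and cones\<close>

text \<open>Nonzero pairs stand for points of the complex projective line, and
  \<open>cwedge p q = 0\<close> says that two of them coincide.\<close>

definition cact :: "real^2^2 \<Rightarrow> complex \<times> complex \<Rightarrow> complex \<times> complex" where
  "cact A p = (of_real (A$1$1) * fst p + of_real (A$1$2) * snd p, of_real (A$2$1) * fst p + of_real (A$2$2) * snd p)"

definition cwedge :: "complex \<times> complex \<Rightarrow> complex \<times> complex \<Rightarrow> complex" where
  "cwedge p q = fst p * snd q - snd p * fst q"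

lemma cact_mult: "cact (A ** B) p = cact A (cact B p)"
  by (simp add: cact_def matrix2_mult_nth algebra_simps)

lemma cact_1: "cact (mat 1) p = p" "cact (- mat 1) p = - p"
  by (simp_all add: cact_def mat2_1_nth prod_eq_iff)

lemma cwedge_cact: "cwedge (cact A p) (cact A q) = det A * cwedge p q"
  by (simp add: cwedge_def cact_def det_2 algebra_simps)

lemma cact_inv2: "det A = 1 \<Longrightarrow> cact A (cact (inv2 A) p) = p" "det A = 1 \<Longrightarrow> cact (inv2 A) (cact A p) = p"
  by (simp_all add: cact_mult[symmetric] inv2_mult cact_1)

lemma cact_nonzero: "det A = 1 \<Longrightarrow> p \<noteq> 0 \<Longrightarrow> cact A p \<noteq> 0"
  using cact_inv2(2)[of A p] by (auto simp: cact_def zero_prod_def)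

text \<open>Avoiding two prescribed directions at a time is exactly what a greedy choice of three
  pairwise distinct images of \<open>p\<close> requires.\<close>

definition two_direction_free :: "(real^2^2) set \<Rightarrow> complex \<times> complex \<Rightarrow> bool" where
  "two_direction_free \<G> p \<longleftrightarrow> (\<forall>v w. v \<noteq> 0 \<longrightarrow> w \<noteq> 0 \<longrightarrow>
     (\<exists>g\<in>\<G>. cwedge (cact g p) v \<noteq> 0 \<and> cwedge (cact g p) w \<noteq> 0))"

definition nondegenerate :: "(real^2^2) set \<Rightarrow> bool" where
  "nondegenerate \<G> \<longleftrightarrow> (\<forall>p. p \<noteq> 0 \<longrightarrow> two_direction_free \<G> p \<or> two_direction_free (inv2 ` \<G>) p)"

lemma two_direction_free_pair:
  assumes "two_direction_free \<G> p" "p \<noteq> 0" "\<And>g. g \<in> \<G> \<Longrightarrow> det g = 1"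
  obtains g g' where "g \<in> \<G>" "g' \<in> \<G>" "cwedge (cact g p) (cact g' p) \<noteq> 0"
proof -
  obtain g where g: "g \<in> \<G>" using assms(1,2) unfolding two_direction_free_def by blast
  then have "cact g p \<noteq> 0" using assms by (intro cact_nonzero) auto
  then obtain g' where "g' \<in> \<G>" "cwedge (cact g' p) (cact g p) \<noteq> 0"
    using assms(1) unfolding two_direction_free_def by blast
  then show ?thesis using that g by blast
qed

lemma two_direction_free_triple:
  assumes "two_direction_free \<G> p" "p \<noteq> 0" "\<And>g. g \<in> \<G> \<Longrightarrow> det g = 1"
  obtains g :: "nat \<Rightarrow> real^2^2" where "\<And>i. g i \<in> \<G>" "\<And>i j. i < j \<Longrightarrow> j < 3 \<Longrightarrow> cwedge (cact (g i) p) (cact (g j) p) \<noteq> 0"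
proof -
  obtain a b where ab: "a \<in> \<G>" "b \<in> \<G>" "cwedge (cact a p) (cact b p) \<noteq> 0"
    using two_direction_free_pair[OF assms] by blast
  have "cact a p \<noteq> 0" "cact b p \<noteq> 0" 
    using cact_nonzero[OF assms(3)[OF ab(1)] assms(2)] cact_nonzero[OF assms(3)[OF ab(2)] assms(2)] by auto
  then obtain c where c: "c \<in> \<G>" "cwedge (cact c p) (cact a p) \<noteq> 0" "cwedge (cact c p) (cact b p) \<noteq> 0"
    using assms(1) unfolding two_direction_free_def by blast
  \<comment> \<open>Only the indices 0, 1, 2 matter; the rest repeat \<open>b\<close>.\<close>
  define g where "g i = (if i = 0 then c else if i = 1 then a else b)" for i :: nat
  have "cwedge (cact (g i) p) (cact (g j) p) \<noteq> 0" if "i < j" "j < 3" for i j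
  proof -
    have "j = 1 \<and> i = 0 \<or> j = 2 \<and> i = 0 \<or> j = 2 \<and> i = 1" using that by auto
    then show ?thesis using ab c by (auto simp: g_def)
  qed
  then show ?thesis using that[of g] ab c by (auto simp: g_def)
qed

lemma exists_hyperbolic:
  assumes det: "\<And>g. g \<in> \<G> \<Longrightarrow> det g = 1" and nd: "nondegenerate \<G>"
    and \<Gamma>: "\<And>h. h \<in> \<Gamma> \<Longrightarrow> det h = 1" "\<And>h k. h \<in> \<Gamma> \<Longrightarrow> k \<in> \<Gamma> \<Longrightarrow> h ** k \<in> \<Gamma>" "\<And>h. h \<in> \<Gamma> \<Longrightarrow> inv2 h \<in> \<Gamma>"
    and left: "\<And>g g'. g \<in> \<G> \<Longrightarrow> g' \<in> \<G> \<Longrightarrow> inv2 g ** g' \<in> \<Gamma>"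
    and right: "\<And>g g'. g \<in> \<G> \<Longrightarrow> g' \<in> \<G> \<Longrightarrow> g ** inv2 g' \<in> \<Gamma>"
  shows "\<exists>h\<in>\<Gamma>. \<bar>trace h\<bar> > 2"
proof (rule ccontr)
  assume "\<not> (\<exists>h\<in>\<Gamma>. \<bar>trace h\<bar> > 2)"
  then have tr: "\<bar>trace h\<bar> \<le> 2" if "h \<in> \<Gamma>" for h
    using that not_le by blast
  \<comment> \<open>No direction is fixed by all of \<open>\<Gamma>\<close>: as \<open>g\<close> is
    injective, \<open>g p\<close> and \<open>g' p\<close> differ exactly when \<open>p\<close> and
    \<open>inv2 g g' p\<close> do. The images under inverses lead in the same way to
    \<open>g ** inv2 g'\<close>.\<close>
  have moves: "\<exists>B\<in>\<Gamma>. cwedge p (cact B p) \<noteq> 0" if p: "p \<noteq> 0" for p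
  proof -
    from nd p consider "two_direction_free \<G> p" | "two_direction_free (inv2 ` \<G>) p"
      unfolding nondegenerate_def by blast
    then show ?thesis
    proof cases
      case 1
      then obtain g g' where g: "g \<in> \<G>" "g' \<in> \<G>" "cwedge (cact g p) (cact g' p) \<noteq> 0"
        using two_direction_free_pair[OF 1 p det] by blast
      have "cwedge (cact g p) (cact g' p) = cwedge (cact g p) (cact g (cact (inv2 g ** g') p))"
        using det[OF g(1)] by (simp add: cact_mult cact_inv2)
      then have "cwedge p (cact (inv2 g ** g') p) \<noteq> 0"
        using g(3) by (auto simp: cwedge_cact)
      then show ?thesis using left[OF g(1,2)] by blast
    next
      case 2
      have di: "det k = 1" if "k \<in> inv2 ` \<G>" for k using that det by auto
      obtain k k' where k: "k \<in> inv2 ` \<G>" "k' \<in> inv2 ` \<G>" "cwedge (cact k p) (cact k' p) \<noteq> 0"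
        using two_direction_free_pair[OF 2 p di] by blast
      then obtain g g' where g: "g \<in> \<G>" "g' \<in> \<G>" "cwedge (cact (inv2 g) p) (cact (inv2 g') p) \<noteq> 0"
        by blast
      have "cwedge (cact (inv2 g) p) (cact (inv2 g') p) = cwedge (cact (inv2 g) p) (cact (inv2 g) (cact (g ** inv2 g') p))"
        using det[OF g(1)] by (simp add: cact_mult cact_inv2)
      then have "cwedge p (cact (g ** inv2 g') p) \<noteq> 0"
        using g(3) by (auto simp: cwedge_cact)
      then show ?thesis using right[OF g(1,2)] by blast
    qed
  qed
  have form: "cwedge p (cact B p) = B$2$1 * fst p * fst p + (B$2$2 - B$1$1) * fst p * snd p - B$1$2 * snd p * snd p" for B and p :: "complex \<times> complex"
    by (simp add: cwedge_def cact_def algebra_simps)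
  \<comment> \<open>The direction (1, 0) is arbitrary: moving some direction is what excludes plus
    and minus the identity. A \<open>B\<close> that moves a fixed direction of this \<open>A\<close>
    then contradicts the trace bound on their commutator.\<close>
  obtain A where A: "A \<in> \<Gamma>" "cwedge (1, 0) (cact A (1, 0)) \<noteq> 0"
    using moves[of "(1, 0)"] by (auto simp: zero_prod_def)
  have A1: "A \<noteq> mat 1" "A \<noteq> - mat 1"
    using A(2) by (auto simp: cact_1 cwedge_def)
  obtain x y :: complex where xy: "(x, y) \<noteq> (0, 0)" "A$2$1 * x * x + (A$2$2 - A$1$1) * x * y - A$1$2 * y * y = 0"
    by (rule fixed_direction2_exists[of A])
  have "(x, y) \<noteq> 0" using xy(1) by (simp add: zero_prod_def)
  then obtain B where B: "B \<in> \<Gamma>" "cwedge (x, y) (cact B (x, y)) \<noteq> 0" using moves by blast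
  have "trace (A ** B ** inv2 A ** inv2 B) \<le> 2"
    using tr[OF \<Gamma>(2)[OF \<Gamma>(2)[OF \<Gamma>(2)[OF A(1) B(1)] \<Gamma>(3)[OF A(1)]] \<Gamma>(3)[OF B(1)]]] by linarith
  from eigenvector2_of_trace_commutator_le[OF \<Gamma>(1)[OF A(1)] \<Gamma>(1)[OF B(1)] tr[OF A(1)] A1 this xy(2,1)]
  show False using B(2) unfolding form by simp
qed

section \<open>Real cones around eigenlines and the mass in them\<close>

definition wedge :: "real^2 \<Rightarrow> real^2 \<Rightarrow> real" where
  "wedge v w = v$1 * w$2 - v$2 * w$1"

text \<open>Up to the factor \<open>wedge p q\<close>, the numbers \<open>wedge v q\<close> and
  \<open>wedge p v\<close> are the coordinates of \<open>v\<close> in the basis \<open>p\<close>,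
  \<open>q\<close>. The cone surrounds the line of \<open>p\<close> and narrows as \<open>T\<close>
  grows; \<open>cone q p T\<close> surrounds the line of \<open>q\<close>.\<close>

definition cone :: "real^2 \<Rightarrow> real^2 \<Rightarrow> real \<Rightarrow> (real^2) set" where
  "cone p q T = {v. T * \<bar>wedge p v\<bar> \<le> \<bar>wedge v q\<bar>}"

lemma wedge_mult: "wedge (A *v v) (A *v w) = det A * wedge v w"
  by (simp add: wedge_def matrix2_vec_nth det_2 algebra_simps)

lemma wedge_scaleR: "wedge (c *\<^sub>R v) w = c * wedge v w" "wedge v (c *\<^sub>R w) = c * wedge v w"
  by (simp_all add: wedge_def algebra_simps)

lemma wedge_add: "wedge (u + v) w = wedge u w + wedge v w" "wedge w (u + v) = wedge w u + wedge w v"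
  by (simp_all add: wedge_def algebra_simps)

lemma wedge_self: "wedge v v = 0"
  by (simp add: wedge_def)

lemma wedge_decomp: "wedge p q *\<^sub>R v = wedge v q *\<^sub>R p + wedge p v *\<^sub>R q"
  by (simp add: wedge_def vec_eq_iff forall_2 algebra_simps)

lemma continuous_on_wedge [continuous_intros]:
  "continuous_on S f \<Longrightarrow> continuous_on S g \<Longrightarrow> continuous_on S (\<lambda>x. wedge (f x) (g x))"
  unfolding wedge_def by (intro continuous_intros)

lemma cone_borel [measurable]: "cone p q T \<in> sets borel"
  unfolding cone_def
  by (intro borel_closed closed_Collect_le continuous_intros)

text \<open>The preimages of the cone under \<open>k\<close> and \<open>k'\<close> shrink to the
  distinct lines of \<open>inv2 k *v p\<close> and \<open>inv2 k' *v p\<close>. Quantitatively, a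
  common \<open>w\<close> expanded in both bases has zero wedge with itself, and for large
  \<open>T\<close> the leading term \<open>x * x' * W p p\<close> outweighs the others. The origin
  lies in every cone, hence the conclusion \<open>w = 0\<close>.\<close>

lemma cones_disjoint:
  assumes det: "det k = 1" "det k' = 1" and pq: "wedge p q \<noteq> 0"
    and ne: "wedge (inv2 k *v p) (inv2 k' *v p) \<noteq> 0"
  obtains T0 where "T0 \<ge> 1" "\<And>T w. T \<ge> T0 \<Longrightarrow> k *v w \<in> cone p q T \<Longrightarrow> k' *v w \<in> cone p q T \<Longrightarrow> w = 0"
proof -
  define W where "W a b = wedge (inv2 k *v a) (inv2 k' *v b)" for a b
  define C where "C = \<bar>W p q\<bar> + \<bar>W q p\<bar> + \<bar>W q q\<bar>"
  \<comment> \<open>Chosen so that \<open>C / T\<close> stays below the modulus of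
    \<open>W p p\<close> for all \<open>T\<close> from \<open>T0\<close> on.\<close>
  define T0 where "T0 = 1 + C / \<bar>W p p\<bar>"
  have Wpp: "\<bar>W p p\<bar> > 0" using ne by (simp add: W_def)
  have C0: "C \<ge> 0" by (simp add: C_def)
  have T01: "T0 \<ge> 1" using Wpp C0 by (simp add: T0_def)
  have "w = 0" if T: "T \<ge> T0" and w: "k *v w \<in> cone p q T" "k' *v w \<in> cone p q T" for T w
  proof -
    define x y x' y' where "x = wedge (k *v w) q" "y = wedge p (k *v w)" "x' = wedge (k' *v w) q" "y' = wedge p (k' *v w)"
    note d = this
    have T1: "T \<ge> 1" using T T01 by simp
    have xy: "T * \<bar>y\<bar> \<le> \<bar>x\<bar>" "T * \<bar>y'\<bar> \<le> \<bar>x'\<bar>" using w by (simp_all add: d cone_def)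
    have dec: "wedge p q *\<^sub>R (k *v w) = x *\<^sub>R p + y *\<^sub>R q" "wedge p q *\<^sub>R (k' *v w) = x' *\<^sub>R p + y' *\<^sub>R q"
      unfolding d by (rule wedge_decomp)+
    have "wedge p q *\<^sub>R w = x *\<^sub>R (inv2 k *v p) + y *\<^sub>R (inv2 k *v q)"
      using arg_cong[OF dec(1), of "(*v) (inv2 k)"] det
      by (simp add: inv2_cancel matrix_vector_mult_scaleR matrix_vector_right_distrib)
    moreover have "wedge p q *\<^sub>R w = x' *\<^sub>R (inv2 k' *v p) + y' *\<^sub>R (inv2 k' *v q)"
      using arg_cong[OF dec(2), of "(*v) (inv2 k')"] det
      by (simp add: inv2_cancel matrix_vector_mult_scaleR matrix_vector_right_distrib)
    ultimately have "wedge (x *\<^sub>R (inv2 k *v p) + y *\<^sub>R (inv2 k *v q)) (x' *\<^sub>R (inv2 k' *v p) + y' *\<^sub>R (inv2 k' *v q)) = 0"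
      by (metis wedge_self)
    then have "x * x' * W p p = - (x * y' * W p q + y * x' * W q p + y * y' * W q q)"
      by (simp add: wedge_add wedge_scaleR W_def algebra_simps)
    then have "\<bar>x\<bar> * \<bar>x'\<bar> * \<bar>W p p\<bar> = \<bar>x * y' * W p q + y * x' * W q p + y * y' * W q q\<bar>"
      by (simp add: abs_mult[symmetric])
    also have "\<dots> \<le> \<bar>x * y' * W p q\<bar> + \<bar>y * x' * W q p\<bar> + \<bar>y * y' * W q q\<bar>"
      by linarith
    also have "\<dots> = \<bar>x\<bar> * \<bar>y'\<bar> * \<bar>W p q\<bar> + \<bar>y\<bar> * \<bar>x'\<bar> * \<bar>W q p\<bar> + \<bar>y\<bar> * \<bar>y'\<bar> * \<bar>W q q\<bar>"
      by (simp add: abs_mult)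
    finally have le: "\<bar>x\<bar> * \<bar>x'\<bar> * \<bar>W p p\<bar> \<le> \<dots>" .
    have y'x': "\<bar>y'\<bar> \<le> \<bar>x'\<bar> / T" "\<bar>y\<bar> \<le> \<bar>x\<bar> / T" using xy T1 by (simp_all add: field_simps)
    have "\<bar>y\<bar> * \<bar>y'\<bar> \<le> (\<bar>x\<bar> / T) * (\<bar>x'\<bar> / 1)"
    proof (rule mult_mono)
      show "\<bar>y'\<bar> \<le> \<bar>x'\<bar> / 1" using xy(2) T1 mult_right_mono[of 1 T "\<bar>y'\<bar>"] by simp
    qed (use y'x' T1 in auto)
    then have "\<bar>x\<bar> * \<bar>y'\<bar> * \<bar>W p q\<bar> + \<bar>y\<bar> * \<bar>x'\<bar> * \<bar>W q p\<bar> + \<bar>y\<bar> * \<bar>y'\<bar> * \<bar>W q q\<bar>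
       \<le> \<bar>x\<bar> * (\<bar>x'\<bar> / T) * \<bar>W p q\<bar> + (\<bar>x\<bar> / T) * \<bar>x'\<bar> * \<bar>W q p\<bar> + (\<bar>x\<bar> / T) * (\<bar>x'\<bar> / 1) * \<bar>W q q\<bar>"
      using y'x' by (intro add_mono mult_right_mono mult_left_mono) auto
    also have "\<dots> = \<bar>x\<bar> * \<bar>x'\<bar> * (C / T)"
      by (simp add: C_def algebra_simps add_divide_distrib)
    finally have le2: "\<bar>x\<bar> * \<bar>x'\<bar> * \<bar>W p p\<bar> \<le> \<bar>x\<bar> * \<bar>x'\<bar> * (C / T)" using le by linarith
    have "T0 * \<bar>W p p\<bar> = \<bar>W p p\<bar> + C" using Wpp by (simp add: T0_def distrib_right)
    then have "C < T0 * \<bar>W p p\<bar>" using Wpp by simp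
    also have "\<dots> \<le> T * \<bar>W p p\<bar>" using T Wpp by (intro mult_right_mono) auto
    finally have "C / T < \<bar>W p p\<bar>" using T1 by (simp add: field_simps)
    then have "\<bar>x\<bar> * \<bar>x'\<bar> \<le> 0" using le2 mult_strict_left_mono[of "C / T" "\<bar>W p p\<bar>" "\<bar>x\<bar> * \<bar>x'\<bar>"]
      by linarith
    then have "x = 0 \<or> x' = 0" by (auto simp: mult_le_0_iff)
    then show "w = 0"
    proof
      assume "x = 0"
      then have "T * \<bar>y\<bar> \<le> 0" using xy(1) by simp
      then have "y = 0" using T1 by (simp add: mult_le_0_iff)
      then have "k *v w = 0" using dec(1) pq \<open>x = 0\<close> by simp
      then show ?thesis using inv2_cancel(1)[OF det(1), of w] by simp
    next
      assume "x' = 0"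
      then have "T * \<bar>y'\<bar> \<le> 0" using xy(2) by simp
      then have "y' = 0" using T1 by (simp add: mult_le_0_iff)
      then have "k' *v w = 0" using dec(2) pq \<open>x' = 0\<close> by simp
      then show ?thesis using inv2_cancel(1)[OF det(2), of w] by simp
    qed
  qed
  then show ?thesis using that[of T0] T01 by blast
qed

text \<open>Cones always share the origin, which is a null set; disjointness is therefore asked only
  away from it.\<close>

lemma sum_mass_le_sqn:
  assumes "F \<in> L2" "finite I" "\<And>i. i \<in> I \<Longrightarrow> B i \<in> sets borel"
    and disj: "\<And>i j v. i \<in> I \<Longrightarrow> j \<in> I \<Longrightarrow> i \<noteq> j \<Longrightarrow> v \<in> B i \<Longrightarrow> v \<in> B j \<Longrightarrow> v = 0"
  shows "(\<Sum>i\<in>I. mass F (B i)) \<le> sqn F"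
proof -
  note I = integrable_mass[OF assms(1) assms(3)]
  have "(\<Sum>i\<in>I. mass F (B i)) = (\<integral>v. (\<Sum>i\<in>I. indicator (B i) v * (F v)\<^sup>2) \<partial>lborel)"
    unfolding mass_def using I by (simp add: Bochner_Integration.integral_sum)
  also have "\<dots> \<le> sqn F"
    unfolding sqn_def
  proof (rule integral_mono_AE)
    show "integrable lborel (\<lambda>v. \<Sum>i\<in>I. indicator (B i) v * (F v)\<^sup>2)" using I by auto
    show "integrable lborel (\<lambda>v. (F v)\<^sup>2)" using assms(1) by (rule L2_D)
    have "(\<Sum>i\<in>I. indicator (B i) v * (F v)\<^sup>2) \<le> (F v)\<^sup>2" if "v \<noteq> 0" for v
    proof -
      have "card {i\<in>I. v \<in> B i} \<le> Suc 0"
        using disj that assms(2) by (subst card_le_Suc0_iff_eq) auto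
      moreover have "(\<Sum>i\<in>I. indicator (B i) v :: real) = card {i\<in>I. v \<in> B i}"
        using assms(2) by (simp add: indicator_def sum.If_cases Int_def conj_commute)
      ultimately have "(\<Sum>i\<in>I. indicator (B i) v :: real) \<le> 1" by simp
      from mult_right_mono[OF this, of "(F v)\<^sup>2"] show ?thesis
        by (simp add: sum_distrib_right)
    qed
    moreover have "AE v in lborel. v \<noteq> (0 :: real^2)" by (rule AE_lborel_singleton)
    ultimately show "AE v in lborel. (\<Sum>i\<in>I. indicator (B i) v * (F v)\<^sup>2) \<le> (F v)\<^sup>2" by auto
  qed
  finally show ?thesis .
qed

lemma mass_le_add:
  assumes "F \<in> L2" "B \<in> sets borel" "C \<in> sets borel" "D \<in> sets borel" "B \<union> C \<union> D = UNIV"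
  shows "sqn F \<le> mass F B + mass F C + mass F D"
proof -
  note I = integrable_mass[OF assms(1)]
  have "sqn F \<le> (\<integral>v. indicator B v * (F v)\<^sup>2 + indicator C v * (F v)\<^sup>2 + indicator D v * (F v)\<^sup>2 \<partial>lborel)"
    unfolding sqn_def
  proof (rule integral_mono)
    fix v
    have "v \<in> B \<or> v \<in> C \<or> v \<in> D" using assms(5) by auto
    then show "(F v)\<^sup>2 \<le> indicator B v * (F v)\<^sup>2 + indicator C v * (F v)\<^sup>2 + indicator D v * (F v)\<^sup>2"
      by (auto simp: indicator_def)
  qed (use I assms in \<open>auto dest: L2_D\<close>)
  also have "\<dots> = mass F B + mass F C + mass F D"
    unfolding mass_def using I assms by simp
  finally show ?thesis .
qed

lemma mass_asym_stab:
  assumes "h \<in> asym_stab G" "B \<in> sets borel" "\<And>n. sqn (G n) \<le> 1"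
  shows "(\<lambda>n. mass (G n) B - mass (G n) ((*v) h -` B)) \<longlonglongrightarrow> 0"
proof -
  have h: "det h = 1" "asym_eq (\<lambda>n v. G n (h *v v)) G" using assms(1) by (auto simp: asym_stab_def)
  have in_L2: "G n \<in> L2" for n using h(2) by (auto simp: asym_eq_def)
  have "(*v) h -` B \<in> sets borel" using assms(2) measurable_sets[OF measurable_matrix_vector_mult, of B h] by simp
  from mass_asym_eq[OF h(2) this] show ?thesis
    using in_L2 assms(2,3) h(1) by (simp add: sqn_comp mass_comp)
qed

text \<open>\<open>h\<close> multiplies the ratio of \<open>|wedge v q|\<close> to
  \<open>|wedge p v|\<close> by \<open>t\<^sup>2\<close>. The complement of the two cones is the
  window between \<open>1 / T\<close> and \<open>T\<close> for this ratio, so preimages under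
  sufficiently spaced powers of \<open>h\<close> are disjoint, while asymptotic invariance gives
  them all the same mass in the limit.\<close>

lemma mass_concentrates:
  assumes G: "range G \<subseteq> L2" "\<And>n. sqn (G n) \<le> 1" "(\<lambda>n. sqn (G n)) \<longlonglongrightarrow> 1"
    and h: "h \<in> asym_stab G" "\<bar>t\<bar> > 1" "h *v p = t *\<^sub>R p" "h *v q = (1 / t) *\<^sub>R q" and T: "T \<ge> 1"
  shows "eventually (\<lambda>n. mass (G n) (cone p q T) > 7/20 \<or> mass (G n) (cone q p T) > 7/20) sequentially"
proof -
  have in_L2: "G n \<in> L2" for n using G by auto
  have t0: "t \<noteq> 0" using h(2) by auto
  have dh: "det h = 1" using h(1) by (simp add: asym_stab_def)
  have hx: "wedge (h *v v) q = t * wedge v q" for v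
    using wedge_mult[of h v q] t0 by (simp add: dh h(4) wedge_scaleR field_simps)
  have hy: "wedge p (h *v v) = (1/t) * wedge p v" for v
    using wedge_mult[of h p v] t0 by (simp add: dh h(3) wedge_scaleR field_simps)
  have pow: "\<exists>k\<in>asym_stab G. \<forall>v. wedge (k *v v) q = t ^ i * wedge v q \<and> wedge p (k *v v) = (1/t) ^ i * wedge p v" for i
  proof (induction i)
    case 0
    have "mat 1 \<in> asym_stab G" using asym_eq_refl[OF G(1)] by (simp add: asym_stab_def)
    then show ?case by (intro bexI[of _ "mat 1"]) auto
  next
    case (Suc i)
    then obtain k where k: "k \<in> asym_stab G" "\<And>v. wedge (k *v v) q = t ^ i * wedge v q" "\<And>v. wedge p (k *v v) = (1/t) ^ i * wedge p v" by blast
    show ?case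
      by (intro bexI[of _ "h ** k"] asym_stab_mult h k)
         (simp add: matrix_vector_mul_assoc[symmetric] hx hy k)
  qed
  \<comment> \<open>The \<open>m\<close>-th power shifts the ratio by more than
    \<open>T\<^sup>2\<close>, the multiplicative width of the window.\<close>
  obtain m where m: "T < \<bar>t\<bar> ^ m" using real_arch_pow[OF h(2)] by blast
  obtain k where k: "\<And>j. k j \<in> asym_stab G" "\<And>j v. wedge (k j *v v) q = t ^ (m * j) * wedge v q"
     "\<And>j v. wedge p (k j *v v) = (1/t) ^ (m * j) * wedge p v"
    proof -
    have "\<forall>j. \<exists>k. k \<in> asym_stab G \<and> (\<forall>v. wedge (k *v v) q = t ^ (m * j) * wedge v q \<and> wedge p (k *v v) = (1/t) ^ (m * j) * wedge p v)"
      using pow by blast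
    from choice[OF this] show ?thesis using that by blast
  qed
  define W where "W = - (cone p q T \<union> cone q p T)"
  have W: "W \<in> sets borel" unfolding W_def by simp
  define V where "V j = (*v) (k j) -` W" for j :: nat
  have V: "V j \<in> sets borel" for j
    using W measurable_sets[OF measurable_matrix_vector_mult, of W "k j"] by (simp add: V_def)
  have VD: "\<bar>t\<bar> ^ (m * j) * \<bar>wedge v q\<bar> < T * (\<bar>wedge p v\<bar> / \<bar>t\<bar> ^ (m * j))"
    "\<bar>wedge p v\<bar> / \<bar>t\<bar> ^ (m * j) < T * (\<bar>t\<bar> ^ (m * j) * \<bar>wedge v q\<bar>)" if "v \<in> V j" for v j
  proof -
    have sw: "\<bar>wedge a b\<bar> = \<bar>wedge b a\<bar>" for a b by (simp add: wedge_def algebra_simps abs_minus_commute)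
    have "\<bar>wedge (k j *v v) q\<bar> < T * \<bar>wedge p (k j *v v)\<bar>"
      "\<bar>wedge (k j *v v) p\<bar> < T * \<bar>wedge q (k j *v v)\<bar>"
      using that by (simp_all add: V_def W_def cone_def)
    then show "\<bar>t\<bar> ^ (m * j) * \<bar>wedge v q\<bar> < T * (\<bar>wedge p v\<bar> / \<bar>t\<bar> ^ (m * j))"
      "\<bar>wedge p v\<bar> / \<bar>t\<bar> ^ (m * j) < T * (\<bar>t\<bar> ^ (m * j) * \<bar>wedge v q\<bar>)"
      unfolding sw[of "k j *v v" p] sw[of q "k j *v v"]
      by (simp_all add: k abs_mult power_abs power_divide)
  qed
  have disj: "v \<notin> V j" if "v \<in> V i" "i < j" for i j v
  proof
    assume "v \<in> V j"
    define a where "a = \<bar>t\<bar> ^ (m * i)"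
    define b where "b = \<bar>t\<bar> ^ (m * j)"
    define x where "x = \<bar>wedge v q\<bar>"
    define y where "y = \<bar>wedge p v\<bar>"
    have a: "a > 0" "b > 0" using t0 by (auto simp: a_def b_def)
    have "y / a < T * (a * x)" using VD(2)[OF that(1)] by (simp add: a_def x_def y_def)
    then have 1: "y < T * a * a * x" using a by (simp add: field_simps)
    have "b * x < T * (y / b)" using VD(1)[OF \<open>v \<in> V j\<close>] by (simp add: b_def x_def y_def)
    then have 2: "b * b * x < T * y" using a by (simp add: field_simps)
    have "x \<ge> 0" "y \<ge> 0" by (simp_all add: x_def y_def)
    have ba: "b \<ge> T * a"
    proof -
      have "T * a \<le> \<bar>t\<bar> ^ m * \<bar>t\<bar> ^ (m * i)" using m a T by (auto simp: a_def intro!: mult_right_mono)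
      also have "\<dots> = \<bar>t\<bar> ^ (m * Suc i)" by (simp add: power_add)
      also have "\<dots> \<le> b" unfolding b_def using that(2) h(2) by (intro power_increasing mult_le_mono) auto
      finally show ?thesis .
    qed
    have "T * y \<le> T * (T * a * a * x)" using 1 T by (intro mult_left_mono) auto
    also have "\<dots> = (T * a) * (T * a) * x" by simp
    also have "\<dots> \<le> b * b * x" using ba a T \<open>x \<ge> 0\<close> by (intro mult_right_mono mult_mono) auto
    finally show False using 2 by simp
  qed
  have lim: "(\<lambda>n. mass (G n) W - mass (G n) (V j)) \<longlonglongrightarrow> 0" for j
    unfolding V_def by (rule mass_asym_stab[OF k(1) W G(2)])
  have sumV: "(\<Sum>j<4. mass (G n) (V j)) \<le> 1" for n
  proof -
    have "v = 0" if "i \<noteq> j" "v \<in> V i" "v \<in> V j" for i j v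
      using disj[of v i j] disj[of v j i] that by (cases "i < j") auto
    then have "(\<Sum>j<4. mass (G n) (V j)) \<le> sqn (G n)"
      by (intro sum_mass_le_sqn[OF in_L2] V) auto
    then show ?thesis using G(2)[of n] by simp
  qed
  have "(\<lambda>n. \<Sum>j<4. mass (G n) W - mass (G n) (V j)) \<longlonglongrightarrow> (\<Sum>j<(4::nat). 0)"
    by (intro tendsto_sum lim)
  then have "eventually (\<lambda>n. (\<Sum>j<4. mass (G n) W - mass (G n) (V j)) < 1/50) sequentially"
    by (intro order_tendstoD(2)[where y = "0"]) auto
  moreover have "eventually (\<lambda>n. sqn (G n) > 99/100) sequentially"
    using G(3) by (rule order_tendstoD) simp
  ultimately show ?thesis
  proof eventually_elim
    case (elim n)
    \<comment> \<open>So \<open>W\<close> has mass below 0.255, and the cones share more than 0.99 -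
      0.255 = 0.735, which exceeds twice 7/20.\<close>
    have "4 * mass (G n) W < 51/50"
      using elim(1) sumV[of n] by (simp add: sum_subtractf)
    moreover have "sqn (G n) \<le> mass (G n) W + mass (G n) (cone p q T) + mass (G n) (cone q p T)"
      by (rule mass_le_add[OF in_L2 W]) (auto simp: W_def)
    ultimately show ?case using elim(2) by linarith
  qed
qed

text \<open>Three preimages of a thin cone are disjoint and asymptotically carry in \<open>Q\<close>
  the mass that the cone carries in \<open>G\<close>. Hence three times this mass is below 1.02, and
  0.34 < 7/20. The auxiliary sequence \<open>Q\<close> will be \<open>F\<close> or \<open>H\<close>,
  according to which alternative of nondegeneracy holds.\<close>

lemma cone_mass_small:
  assumes G: "range Q \<subseteq> L2" "\<And>n. sqn (Q n) \<le> 1"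
    and k: "\<And>i. i < 3 \<Longrightarrow> det (k i) = 1"
    and lim: "\<And>i B. i < 3 \<Longrightarrow> B \<in> sets borel \<Longrightarrow> (\<lambda>n. mass (G n) B - mass (Q n) ((*v) (k i) -` B)) \<longlonglongrightarrow> 0"
    and ne: "\<And>i j. i < j \<Longrightarrow> j < (3::nat) \<Longrightarrow> wedge (inv2 (k i) *v p) (inv2 (k j) *v p) \<noteq> 0"
    and pq: "wedge p q \<noteq> 0"
  shows "\<exists>T0\<ge>1. \<forall>T\<ge>T0. eventually (\<lambda>n. mass (G n) (cone p q T) < 7/20) sequentially"
proof -
  have "\<exists>T0\<ge>1. i < j \<longrightarrow> j < 3 \<longrightarrow> (\<forall>T w. T \<ge> T0 \<longrightarrow> k i *v w \<in> cone p q T \<longrightarrow> k j *v w \<in> cone p q T \<longrightarrow> w = 0)" for i j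
  proof (cases "i < j \<and> j < 3")
    case True
    then obtain T0 where "T0 \<ge> 1" "\<And>T w. T \<ge> T0 \<Longrightarrow> k i *v w \<in> cone p q T \<Longrightarrow> k j *v w \<in> cone p q T \<Longrightarrow> w = 0"
      using cones_disjoint[OF k k pq ne, of i j] by auto
    then show ?thesis by blast
  qed (auto intro!: exI[of _ 1])
  then obtain T0 where T0: "\<And>i j. T0 i j \<ge> 1"
    "\<And>i j T w. i < j \<Longrightarrow> j < 3 \<Longrightarrow> T \<ge> T0 i j \<Longrightarrow> k i *v w \<in> cone p q T \<Longrightarrow> k j *v w \<in> cone p q T \<Longrightarrow> w = 0"
    by metis
  define T1 where "T1 = max (T0 0 1) (max (T0 0 2) (T0 1 2))"
  have T1: "T0 i j \<le> T1" if "i < j" "j < 3" for i j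
  proof -
    have "j = 1 \<and> i = 0 \<or> j = 2 \<and> i = 0 \<or> j = 2 \<and> i = 1" using that by auto
    then show ?thesis by (auto simp: T1_def)
  qed
  have "eventually (\<lambda>n. mass (G n) (cone p q T) < 7/20) sequentially" if T: "T \<ge> T1" for T
  proof -
    let ?V = "\<lambda>i. (*v) (k i) -` cone p q T"
    have V: "?V j \<in> sets borel" for j
      using measurable_sets[OF measurable_matrix_vector_mult, of "cone p q T" "k j"] by simp
    have *: "v = 0" if "i < 3" "j < 3" "i \<noteq> j" "v \<in> ?V i" "v \<in> ?V j" for i j v
      using T0(2)[of i j T v] T0(2)[of j i T v] T1[of i j] T1[of j i] T that by (auto simp: nat_neq_iff)
    have sumV: "(\<Sum>j<3. mass (Q n) (?V j)) \<le> 1" for n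
    proof -
      have "(\<Sum>j<3. mass (Q n) (?V j)) \<le> sqn (Q n)"
        by (intro sum_mass_le_sqn V) (use G(1) * in \<open>auto simp: subset_iff\<close>)
      then show ?thesis using G(2)[of n] by simp
    qed
    have "(\<lambda>n. \<Sum>j<3. mass (G n) (cone p q T) - mass (Q n) (?V j)) \<longlonglongrightarrow> (\<Sum>j<(3::nat). 0)"
      by (intro tendsto_sum lim) auto
    then have "eventually (\<lambda>n. (\<Sum>j<3. mass (G n) (cone p q T) - mass (Q n) (?V j)) < 1/50) sequentially"
      by (intro order_tendstoD(2)[where y = "0"]) auto
    then show ?thesis
    proof eventually_elim
      case (elim n)
      then show ?case using sumV[of n] by (simp add: sum_subtractf)
    qed
  qed
  moreover have "T1 \<ge> 1" using T0(1)[of 0 1] by (simp add: T1_def)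
  ultimately show ?thesis by blast
qed

lemma no_asymptotic_invariance:
  assumes F: "range F \<subseteq> L2" "\<And>n. sqn (F n) \<le> 1" and H: "range H \<subseteq> L2" "\<And>n. sqn (H n) \<le> 1"
    and G: "range G \<subseteq> L2" "\<And>n. sqn (G n) \<le> 1" "(\<lambda>n. sqn (G n)) \<longlonglongrightarrow> 1"
    and det: "\<And>g. g \<in> \<G> \<Longrightarrow> det g = 1" and nd: "nondegenerate \<G>"
    and FG: "\<And>g. g \<in> \<G> \<Longrightarrow> asym_eq (\<lambda>n v. F n (g *v v)) G"
    and GH: "\<And>g. g \<in> \<G> \<Longrightarrow> asym_eq (\<lambda>n v. G n (g *v v)) H"
  shows False
proof -
  have "\<exists>h\<in>asym_stab G. \<bar>trace h\<bar> > 2"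
  proof (rule exists_hyperbolic[OF det nd, of "asym_stab G"])
    show "det h = 1" if "h \<in> asym_stab G" for h using that by (simp add: asym_stab_def)
    show "inv2 g ** g' \<in> asym_stab G" if "g \<in> \<G>" "g' \<in> \<G>" for g g'
      by (rule asym_stab_left[OF det det FG FG]) (use that in auto)
    show "g ** inv2 g' \<in> asym_stab G" if "g \<in> \<G>" "g' \<in> \<G>" for g g'
      by (rule asym_stab_right[OF det det GH GH]) (use that in auto)
  qed (auto intro: asym_stab_mult asym_stab_inv)
  then obtain h where h: "h \<in> asym_stab G" "\<bar>trace h\<bar> > 2" by blast
  have "det h = 1" using h by (simp add: asym_stab_def)
  then obtain t p q where tpq: "\<bar>t\<bar> > 1" "h *v p = t *\<^sub>R p" "h *v q = (1 / t) *\<^sub>R q" "p$1 * q$2 - p$2 * q$1 \<noteq> 0"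
    using hyperbolic2_eigenvectors h(2) by blast
  have small: "\<exists>T0\<ge>1. \<forall>T\<ge>T0. eventually (\<lambda>n. mass (G n) (cone p q T) < 7/20) sequentially" if pq: "wedge p q \<noteq> 0" for p q
  proof -
    define pc where "pc = (complex_of_real (p$1), complex_of_real (p$2))"
    have real: "cwedge (cact g pc) (cact g' pc) = of_real (wedge (g *v p) (g' *v p))" for g g'
      by (simp add: cwedge_def cact_def pc_def wedge_def matrix2_vec_nth)
    have "pc \<noteq> 0" using pq by (auto simp: pc_def zero_prod_def wedge_def)
    with nd consider "two_direction_free \<G> pc" | "two_direction_free (inv2 ` \<G>) pc"
      unfolding nondegenerate_def by blast
    then show ?thesis
    proof cases
      case 1
      then obtain g :: "nat \<Rightarrow> real^2^2" where g: "\<And>i. g i \<in> \<G>" "\<And>i j. i < j \<Longrightarrow> j < 3 \<Longrightarrow> cwedge (cact (g i) pc) (cact (g j) pc) \<noteq> 0"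
        using two_direction_free_triple[OF 1 \<open>pc \<noteq> 0\<close> det] by blast
      show ?thesis
      \<comment> \<open>The mass of \<open>G\<close> on \<open>B\<close> is asymptotically that of
        \<open>F\<close> on the image of \<open>B\<close> under \<open>g i\<close>, which is the
        preimage under the inverse.\<close>
      proof (rule cone_mass_small[OF F, where k = "\<lambda>i. inv2 (g i)"])
        fix i and B :: "(real^2) set" assume B: "B \<in> sets borel"
        have "mass (\<lambda>v. F n (g i *v v)) B = mass (F n) ((*v) (inv2 (g i)) -` B)" for n
        proof -
          have "(*v) (g i) -` ((*v) (inv2 (g i)) -` B) = B" using inv2_cancel[OF det[OF g(1)]] by auto
          then show ?thesis
            using mass_comp[of "F n" "g i" "(*v) (inv2 (g i)) -` B"] F(1) det[OF g(1)] B
              measurable_sets[OF measurable_matrix_vector_mult, of B "inv2 (g i)"] by (auto simp: subset_iff)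
        qed
        moreover have "(\<lambda>n. mass (\<lambda>v. F n (g i *v v)) B - mass (G n) B) \<longlonglongrightarrow> 0"
          by (rule mass_asym_eq[OF FG[OF g(1)] B]) (use F G sqn_comp det g(1) in \<open>auto simp: subset_iff\<close>)
        ultimately show "(\<lambda>n. mass (G n) B - mass (F n) ((*v) (inv2 (g i)) -` B)) \<longlonglongrightarrow> 0"
          using tendsto_minus[of "\<lambda>n. mass (\<lambda>v. F n (g i *v v)) B - mass (G n) B" 0] by simp
      next
        have ii: "inv2 (inv2 k) = k" for k by (simp add: matrix2_eq_iff)
        show "wedge (inv2 (inv2 (g i)) *v p) (inv2 (inv2 (g j)) *v p) \<noteq> 0" if "i < j" "j < 3" for i j
          using g(2)[OF that] unfolding real ii by simp
      qed (use det g(1) pq in auto)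
    next
      case 2
      have di: "det k = 1" if "k \<in> inv2 ` \<G>" for k using that det by auto
      obtain k :: "nat \<Rightarrow> real^2^2" where k: "\<And>i. k i \<in> inv2 ` \<G>" "\<And>i j. i < j \<Longrightarrow> j < 3 \<Longrightarrow> cwedge (cact (k i) pc) (cact (k j) pc) \<noteq> 0"
        using two_direction_free_triple[OF 2 \<open>pc \<noteq> 0\<close> di] by blast
      have "\<forall>i. \<exists>g. g \<in> \<G> \<and> k i = inv2 g" using k(1) by auto
      then obtain g where g: "\<And>i. g i \<in> \<G>" "\<And>i. k i = inv2 (g i)" by metis
      show ?thesis
      \<comment> \<open>The mass of \<open>G\<close> on \<open>B\<close> is exactly that of
        \<open>G\<close> after \<open>g i\<close> on the preimage of \<open>B\<close>, and so
        asymptotically that of \<open>H\<close> there.\<close>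
      proof (rule cone_mass_small[OF H, where k = g])
        fix i and B :: "(real^2) set" assume B: "B \<in> sets borel"
        have V: "(*v) (g i) -` B \<in> sets borel"
          using B measurable_sets[OF measurable_matrix_vector_mult, of B "g i"] by simp
        have "(\<lambda>n. mass (\<lambda>v. G n (g i *v v)) ((*v) (g i) -` B) - mass (H n) ((*v) (g i) -` B)) \<longlonglongrightarrow> 0"
          by (rule mass_asym_eq[OF GH[OF g(1)] V]) (use H G sqn_comp det g(1) in \<open>auto simp: subset_iff\<close>)
        then show "(\<lambda>n. mass (G n) B - mass (H n) ((*v) (g i) -` B)) \<longlonglongrightarrow> 0"
          using G(1) det[OF g(1)] B by (simp add: mass_comp subset_iff)
      next
        show "wedge (inv2 (g i) *v p) (inv2 (g j) *v p) \<noteq> 0" if "i < j" "j < 3" for i j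
          using k(2)[OF that] unfolding real g(2) by simp
      qed (use det g(1) pq in auto)
    qed
  qed
  have pq: "wedge p q \<noteq> 0" "wedge q p \<noteq> 0" using tpq(4) by (auto simp: wedge_def algebra_simps)
  obtain T1 where T1: "T1 \<ge> 1" "\<And>T. T \<ge> T1 \<Longrightarrow> eventually (\<lambda>n. mass (G n) (cone p q T) < 7/20) sequentially"
    using small[OF pq(1)] by blast
  obtain T2 where T2: "T2 \<ge> 1" "\<And>T. T \<ge> T2 \<Longrightarrow> eventually (\<lambda>n. mass (G n) (cone q p T) < 7/20) sequentially"
    using small[OF pq(2)] by blast
  define T where "T = max T1 T2"
  have "T \<ge> 1" using T1(1) by (simp add: T_def)
  have "eventually (\<lambda>n. mass (G n) (cone p q T) < 7/20) sequentially"
    by (rule T1) (simp add: T_def)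
  moreover have "eventually (\<lambda>n. mass (G n) (cone q p T) < 7/20) sequentially"
    by (rule T2) (simp add: T_def)
  moreover note mass_concentrates[OF G h(1) tpq(1-3) \<open>T \<ge> 1\<close>]
  ultimately have "eventually (\<lambda>n::nat. False) sequentially"
    by eventually_elim auto
  then show False by simp
qed

section \<open>Contraction of the averaging operator\<close>

lemma measurable_matrix_vector_mult_pair [measurable (raw)]:
  fixes f :: "'a \<Rightarrow> real^2^2"
  assumes "f \<in> borel_measurable N" "g \<in> borel_measurable N"
  shows "(\<lambda>x. f x *v g x) \<in> borel_measurable N"
proof (rule borel_measurable_continuous_Pair[OF assms])
  show "continuous_on UNIV (\<lambda>x. fst x *v snd x :: real^2)"
    unfolding matrix_vector_mult_def by (intro continuous_intros continuous_on_vec_lambda)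
qed

locale random_SL2 = prob_space M for M :: "'a measure" +
  fixes X :: "'a \<Rightarrow> real^2^2" and K :: real
  assumes X_measurable [measurable]: "X \<in> borel_measurable M"
    and det_X: "\<And>s. det (X s) = 1"
    and norm_X_le: "\<And>s. norm (X s) \<le> K"
begin

definition avg :: "(real^2 \<Rightarrow> real) \<Rightarrow> real^2 \<Rightarrow> real" where
  "avg F v = (\<integral>s. F (X s *v v) \<partial>M)"

text \<open>Boundedness makes the integral in \<open>avg\<close> converge at every point, so
  functions rather than classes can be averaged. Iterated averages of the indicator of the ball stay
  in this class.\<close>

definition nonneg_bounded :: "(real^2 \<Rightarrow> real) \<Rightarrow> bool" where
  "nonneg_bounded F \<longleftrightarrow> (\<exists>b. \<forall>v. 0 \<le> F v \<and> F v \<le> b)"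

lemma integrable_avg:
  assumes "F \<in> borel_measurable borel" "nonneg_bounded F"
  shows "integrable M (\<lambda>s. F (X s *v v))" "integrable M (\<lambda>s. (F (X s *v v))\<^sup>2)"
proof -
  note assms(1)[measurable]
  obtain b where b: "\<And>v. 0 \<le> F v" "\<And>v. F v \<le> b" using assms(2) by (auto simp: nonneg_bounded_def)
  show "integrable M (\<lambda>s. F (X s *v v))"
    by (rule integrable_const_bound[of _ b]) (use b in auto)
  show "integrable M (\<lambda>s. (F (X s *v v))\<^sup>2)"
    by (rule integrable_const_bound[of _ "b\<^sup>2"]) (use b in \<open>auto intro!: power_mono\<close>)
qed

lemma nonneg_bounded_avg:
  assumes "F \<in> borel_measurable borel" "nonneg_bounded F"
  shows "nonneg_bounded (avg F)"
proof -
  obtain b where b: "\<And>v. 0 \<le> F v" "\<And>v. F v \<le> b" using assms(2) by (auto simp: nonneg_bounded_def)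
  have "0 \<le> avg F v" "avg F v \<le> b" for v
    unfolding avg_def using b integrable_avg[OF assms, of v]
    by (auto intro!: integral_nonneg_AE integral_le_const)
  then show ?thesis by (auto simp: nonneg_bounded_def)
qed

text \<open>This is the variance formula at each \<open>v\<close>, integrated over the plane; the
  second moment becomes \<open>sqn F\<close> because every \<open>X s\<close> preserves area. It
  turns a small loss of norm under averaging into closeness of \<open>F\<close> after
  \<open>X s\<close> to \<open>avg F\<close>. Nonnegative integrals allow the order of integration
  to be exchanged before integrability is known.\<close>

lemma avg_identity:
  assumes F: "F \<in> L2" "nonneg_bounded F"
  shows "(\<integral>\<^sup>+s. ennreal (sqn (\<lambda>v. F (X s *v v) - avg F v)) \<partial>M) + ennreal (sqn (avg F)) = ennreal (sqn F)"
    and "avg F \<in> L2"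
proof -
  interpret P: pair_sigma_finite M "lborel :: (real^2) measure" ..
  have Fm [measurable]: "F \<in> borel_measurable borel" using F by (auto dest: L2_D)
  have am [measurable]: "avg F \<in> borel_measurable borel"
  proof -
    have "(\<lambda>v. \<integral>s. F (X s *v v) \<partial>M) \<in> borel_measurable lborel"
      by (rule borel_measurable_lebesgue_integral) measurable
    then show ?thesis unfolding avg_def[abs_def] by simp
  qed
  have var: "(\<integral>\<^sup>+s. ennreal ((F (X s *v v) - avg F v)\<^sup>2) \<partial>M) + ennreal ((avg F v)\<^sup>2)
      = (\<integral>\<^sup>+s. ennreal ((F (X s *v v))\<^sup>2) \<partial>M)" for v
  proof -
    note I = integrable_avg[OF Fm F(2), of v]
    have eq: "(F (X s *v v) - avg F v)\<^sup>2 = (F (X s *v v))\<^sup>2 - 2 * avg F v * F (X s *v v) + (avg F v)\<^sup>2" for s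
      by (simp add: power2_eq_square algebra_simps)
    have I2: "integrable M (\<lambda>s. (F (X s *v v) - avg F v)\<^sup>2)"
      unfolding eq using I by auto
    have "(\<integral>s. (F (X s *v v) - avg F v)\<^sup>2 \<partial>M) = (\<integral>s. (F (X s *v v))\<^sup>2 \<partial>M) - 2 * avg F v * avg F v + (avg F v)\<^sup>2"
      unfolding eq using I by (simp add: avg_def prob_space)
    also have "\<dots> = (\<integral>s. (F (X s *v v))\<^sup>2 \<partial>M) - (avg F v)\<^sup>2"
      by (simp add: power2_eq_square)
    finally have *: "(\<integral>s. (F (X s *v v) - avg F v)\<^sup>2 \<partial>M) + (avg F v)\<^sup>2 = (\<integral>s. (F (X s *v v))\<^sup>2 \<partial>M)" by simp
    show ?thesis
      using I I2 by (simp add: nn_integral_eq_integral *[symmetric])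
  qed
  have "(\<integral>\<^sup>+v. (\<integral>\<^sup>+s. ennreal ((F (X s *v v) - avg F v)\<^sup>2) \<partial>M) \<partial>lborel) + (\<integral>\<^sup>+v. ennreal ((avg F v)\<^sup>2) \<partial>lborel)
     = (\<integral>\<^sup>+v. (\<integral>\<^sup>+s. ennreal ((F (X s *v v) - avg F v)\<^sup>2) \<partial>M) + ennreal ((avg F v)\<^sup>2) \<partial>lborel)"
    by (rule nn_integral_add[symmetric]) measurable
  also have "\<dots> = (\<integral>\<^sup>+v. (\<integral>\<^sup>+s. ennreal ((F (X s *v v))\<^sup>2) \<partial>M) \<partial>lborel)"
    unfolding var ..
  also have "\<dots> = (\<integral>\<^sup>+s. (\<integral>\<^sup>+v. ennreal ((F (X s *v v))\<^sup>2) \<partial>lborel) \<partial>M)"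
    by (rule P.Fubini') measurable
  also have "\<dots> = (\<integral>\<^sup>+s. (\<integral>\<^sup>+v. ennreal ((F v)\<^sup>2) \<partial>lborel) \<partial>M)"
    by (intro nn_integral_cong nn_integral_unimodular[where f="\<lambda>v. ennreal ((F v)\<^sup>2)"] det_X) measurable
  also have "\<dots> = ennreal (sqn F)"
    using F(1) by (simp add: nn_integral_eq_integral L2_D sqn_def emeasure_space_1)
  finally have main: "(\<integral>\<^sup>+v. (\<integral>\<^sup>+s. ennreal ((F (X s *v v) - avg F v)\<^sup>2) \<partial>M) \<partial>lborel) + (\<integral>\<^sup>+v. ennreal ((avg F v)\<^sup>2) \<partial>lborel) = ennreal (sqn F)" .
  have "(\<integral>\<^sup>+v. ennreal ((avg F v)\<^sup>2) \<partial>lborel) \<le> ennreal (sqn F)"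
    unfolding main[symmetric] by simp
  then have "(\<integral>\<^sup>+v. ennreal ((avg F v)\<^sup>2) \<partial>lborel) < \<infinity>"
    by (rule le_less_trans) simp
  then have "integrable lborel (\<lambda>v. (avg F v)\<^sup>2)"
    by (intro integrableI_nonneg) auto
  then show aL: "avg F \<in> L2" by (simp add: L2_def)
  have "(\<integral>\<^sup>+v. (\<integral>\<^sup>+s. ennreal ((F (X s *v v) - avg F v)\<^sup>2) \<partial>M) \<partial>lborel)
      = (\<integral>\<^sup>+s. (\<integral>\<^sup>+v. ennreal ((F (X s *v v) - avg F v)\<^sup>2) \<partial>lborel) \<partial>M)"
    by (rule P.Fubini') measurable
  also have "\<dots> = (\<integral>\<^sup>+s. ennreal (sqn (\<lambda>v. F (X s *v v) - avg F v)) \<partial>M)"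
    using L2_diff[OF L2_comp[OF F(1) det_X] aL]
    by (intro nn_integral_cong) (simp add: nn_integral_eq_integral L2_D sqn_def)
  finally show "(\<integral>\<^sup>+s. ennreal (sqn (\<lambda>v. F (X s *v v) - avg F v)) \<partial>M) + ennreal (sqn (avg F)) = ennreal (sqn F)"
    using main \<open>integrable lborel (\<lambda>v. (avg F v)\<^sup>2)\<close> by (simp add: nn_integral_eq_integral sqn_def)
qed

lemma sqn_avg_le:
  assumes "F \<in> L2" "nonneg_bounded F"
  shows "sqn (avg F) \<le> sqn F"
proof -
  have "ennreal (sqn (avg F)) \<le> ennreal (sqn F)"
    unfolding avg_identity(1)[OF assms, symmetric] by simp
  then show ?thesis using sqn_nonneg[of F] by simp
qed

lemma sqn_avg_measurable:
  assumes F: "F \<in> L2" "nonneg_bounded F"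
  shows "(\<lambda>s. sqn (\<lambda>v. F (X s *v v) - avg F v)) \<in> borel_measurable M"
proof -
  have [measurable]: "F \<in> borel_measurable borel" "avg F \<in> borel_measurable borel"
    using F avg_identity(2)[OF F] by (auto dest: L2_D)
  show ?thesis unfolding sqn_def
    by (rule lborel.borel_measurable_lebesgue_integral) measurable
qed

end

text \<open>The asymptotic relations hold off a null set that depends on the sequence of functions,
  so nondegeneracy is demanded of every subfamily of full measure.\<close>

locale nondegenerate_random_SL2 = random_SL2 +
  assumes nondeg: "\<And>Q. (AE s in M. Q s) \<Longrightarrow> nondegenerate (X ` {s\<in>space M. Q s})"
begin

lemma no_almost_invariant_vectors:
  assumes F: "\<And>n. F n \<in> L2" "\<And>n. nonneg_bounded (F n)" "\<And>n. sqn (F n) = 1"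
  shows "\<exists>n. sqn (avg (avg (F n))) \<le> 1 - (1/2) ^ n"
proof (rule ccontr)
  assume "\<not> ?thesis"
  then have ge: "sqn (avg (avg (F n))) > 1 - (1/2) ^ n" for n by (meson not_le)
  define G where "G n = avg (F n)" for n
  define H where "H n = avg (G n)" for n
  have G: "G n \<in> L2" "nonneg_bounded (G n)" for n
    using avg_identity(2)[OF F(1,2)] nonneg_bounded_avg[OF L2_D(1)[OF F(1)] F(2)] by (auto simp: G_def)
  have H: "H n \<in> L2" for n using avg_identity(2)[OF G] by (auto simp: H_def)
  have G1: "sqn (G n) \<le> 1" for n using sqn_avg_le[OF F(1,2), of n] by (simp add: G_def F)
  have HG: "sqn (H n) \<le> sqn (G n)" for n using sqn_avg_le[OF G, of n] by (simp add: H_def)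
  have Hge: "sqn (H n) > 1 - (1/2) ^ n" for n using ge[of n] by (simp add: G_def H_def)
  \<comment> \<open>The mean of \<open>d n\<close> telescopes to \<open>1 - sqn (H n)\<close>, which
    is below \<open>(1/2) ^ n\<close>; summability of the means gives almost sure convergence to
    zero.\<close>
  define d where "d n s = sqn (\<lambda>v. F n (X s *v v) - G n v) + sqn (\<lambda>v. G n (X s *v v) - H n v)" for n s
  have d0: "d n s \<ge> 0" for n s by (simp add: d_def sqn_nonneg)
  have m [measurable]: "(\<lambda>s. sqn (\<lambda>v. F n (X s *v v) - G n v)) \<in> borel_measurable M"
    "(\<lambda>s. sqn (\<lambda>v. G n (X s *v v) - H n v)) \<in> borel_measurable M" for n
    using sqn_avg_measurable[OF F(1,2)] sqn_avg_measurable[OF G] by (simp_all add: G_def H_def)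
  have [measurable]: "d n \<in> borel_measurable M" for n
    unfolding d_def[abs_def] by measurable
  have dint: "(\<integral>\<^sup>+s. ennreal (d n s) \<partial>M) \<le> ennreal ((1/2) ^ n)" for n
  proof -
    let ?a = "\<integral>\<^sup>+s. ennreal (sqn (\<lambda>v. F n (X s *v v) - G n v)) \<partial>M"
    let ?b = "\<integral>\<^sup>+s. ennreal (sqn (\<lambda>v. G n (X s *v v) - H n v)) \<partial>M"
    have 1: "?a + ennreal (sqn (G n)) = ennreal 1" "?b + ennreal (sqn (H n)) = ennreal (sqn (G n))"
      using avg_identity(1)[OF F(1,2), of n] avg_identity(1)[OF G, of n] F(3)[of n] by (simp_all add: G_def H_def)
    have "(\<integral>\<^sup>+s. ennreal (d n s) \<partial>M) = ?a + ?b"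
      unfolding d_def by (subst nn_integral_add[symmetric]) (auto simp: sqn_nonneg)
    moreover have "?a + ?b + ennreal (sqn (H n)) = ennreal 1"
      using 1 by (simp add: add.assoc)
    ultimately have "(\<integral>\<^sup>+s. ennreal (d n s) \<partial>M) + ennreal (sqn (H n)) = ennreal 1" by simp
    then have "(\<integral>\<^sup>+s. ennreal (d n s) \<partial>M) = ennreal 1 - ennreal (sqn (H n))"
      using ennreal_add_diff_cancel_right[of "ennreal (sqn (H n))" "\<integral>\<^sup>+s. ennreal (d n s) \<partial>M"] by simp
    also have "\<dots> = ennreal (1 - sqn (H n))"
      by (subst ennreal_minus) (auto simp: sqn_nonneg)
    also have "\<dots> \<le> ennreal ((1/2) ^ n)" using Hge[of n] by (intro ennreal_leI) simp
    finally show ?thesis .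
  qed
  have "(\<integral>\<^sup>+s. (\<Sum>n. ennreal (d n s)) \<partial>M) = (\<Sum>n. \<integral>\<^sup>+s. ennreal (d n s) \<partial>M)"
    by (rule nn_integral_suminf) simp
  also have "\<dots> \<le> (\<Sum>n. ennreal ((1/2) ^ n))"
    by (intro suminf_le dint) auto
  also have "\<dots> = ennreal (\<Sum>n. (1/2) ^ n)"
    by (rule suminf_ennreal2) auto
  also have "\<dots> < \<infinity>" by simp
  finally have "AE s in M. (\<Sum>n. ennreal (d n s)) \<noteq> \<infinity>"
    by (intro nn_integral_noteq_infinite) auto
  then have AE: "AE s in M. (\<lambda>n. d n s) \<longlonglongrightarrow> 0"
  proof eventually_elim
    case (elim s)
    then have "summable (\<lambda>n. d n s)" by (intro summable_suminf_not_top d0) auto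
    then show ?case by (rule summable_LIMSEQ_zero)
  qed
  define \<G> where "\<G> = X ` {s\<in>space M. (\<lambda>n. d n s) \<longlonglongrightarrow> 0}"
  have asy: "asym_eq (\<lambda>n v. F n (g *v v)) G \<and> asym_eq (\<lambda>n v. G n (g *v v)) H" if g: "g \<in> \<G>" for g
  proof -
    from g obtain s where s: "g = X s" "(\<lambda>n. d n s) \<longlonglongrightarrow> 0" by (auto simp: \<G>_def)
    have "(\<lambda>n. sqn (\<lambda>v. F n (X s *v v) - G n v)) \<longlonglongrightarrow> 0"
      using tendsto_sandwich[OF always_eventually always_eventually tendsto_const s(2),
          of "\<lambda>n. sqn (\<lambda>v. F n (X s *v v) - G n v)"] by (simp add: d_def sqn_nonneg)
    moreover have "(\<lambda>n. sqn (\<lambda>v. G n (X s *v v) - H n v)) \<longlonglongrightarrow> 0"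
      using tendsto_sandwich[OF always_eventually always_eventually tendsto_const s(2),
          of "\<lambda>n. sqn (\<lambda>v. G n (X s *v v) - H n v)"] by (simp add: d_def sqn_nonneg)
    ultimately show ?thesis
      using F G H det_X by (auto simp: asym_eq_def s(1) intro!: L2_comp)
  qed
  have "(\<lambda>n. sqn (G n)) \<longlonglongrightarrow> 1"
  proof (rule tendsto_sandwich)
    show "eventually (\<lambda>n. 1 - (1/2) ^ n \<le> sqn (G n)) sequentially"
    proof (intro always_eventually allI)
      fix n show "1 - (1/2) ^ n \<le> sqn (G n)" using Hge[of n] HG[of n] by linarith
    qed
    show "(\<lambda>n. 1 - (1/2) ^ n :: real) \<longlonglongrightarrow> 1" using tendsto_diff[OF tendsto_const[of 1] LIMSEQ_power_zero[of "1/2::real"]] by simp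
  qed (use G1 in auto)
  moreover have "sqn (H n) \<le> 1" for n using G1[of n] HG[of n] by simp
  moreover have "nondegenerate \<G>" unfolding \<G>_def by (rule nondeg[OF AE])
  moreover have "det g = 1" if "g \<in> \<G>" for g using that det_X by (auto simp: \<G>_def)
  ultimately show False
    using asy F G1 by (intro no_asymptotic_invariance[of F H G \<G>]) (auto simp: G(1) H)
qed

definition ball_avg :: "nat \<Rightarrow> real^2 \<Rightarrow> real" where
  "ball_avg k = (avg ^^ k) (indicator (cball 0 1))"

lemma ball_avg: "ball_avg k \<in> L2" "nonneg_bounded (ball_avg k)"
proof (induction k)
  case 0
  show "ball_avg 0 \<in> L2"
    by (auto simp: ball_avg_def L2_def power2_eq_square indicator_inter_arith[symmetric]
        intro!: integrable_real_indicator borel_measurable_indicator emeasure_bounded_finite[unfolded infinity_ennreal_def])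
  show "nonneg_bounded (ball_avg 0)"
    by (auto simp: ball_avg_def nonneg_bounded_def indicator_def intro!: exI[of _ 1])
next
  case (Suc k)
  show "ball_avg (Suc k) \<in> L2"
    using avg_identity(2)[OF Suc] by (simp add: ball_avg_def)
  show "nonneg_bounded (ball_avg (Suc k))"
    using nonneg_bounded_avg[OF L2_D(1)[OF Suc(1)] Suc(2)] by (simp add: ball_avg_def)
qed

lemma ball_avg_Suc: "ball_avg (Suc k) = avg (ball_avg k)"
  by (simp add: ball_avg_def)

text \<open>If no uniform factor existed, then for each \<open>n\<close> some iterate would lose at
  most the fraction \<open>(1/2) ^ n\<close>; normalized, these iterates would be almost invariant
  vectors.\<close>

lemma sqn_ball_avg_contraction:
  "\<exists>\<rho>. 0 \<le> \<rho> \<and> \<rho> < 1 \<and> (\<forall>k. sqn (ball_avg (Suc (Suc k))) \<le> \<rho> * sqn (ball_avg k))"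
proof (rule ccontr)
  assume no: "\<not> ?thesis"
  have "\<exists>k. sqn (ball_avg (Suc (Suc k))) > (1 - (1/2) ^ n) * sqn (ball_avg k)" for n :: nat
  proof (rule ccontr)
    assume "\<not> ?thesis"
    then have "sqn (ball_avg (Suc (Suc k))) \<le> (1 - (1/2) ^ n) * sqn (ball_avg k)" for k
      by (simp add: not_less)
    then have "0 \<le> 1 - (1/2::real) ^ n \<and> 1 - (1/2::real) ^ n < 1 \<and>
        (\<forall>k. sqn (ball_avg (Suc (Suc k))) \<le> (1 - (1/2) ^ n) * sqn (ball_avg k))"
      by (simp add: power_le_one)
    with no show False by blast
  qed
  then have "\<forall>n. \<exists>k. sqn (ball_avg (Suc (Suc k))) > (1 - (1/2) ^ n) * sqn (ball_avg k)" by blast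
  from choice[OF this] obtain k where k: "\<And>n. sqn (ball_avg (Suc (Suc (k n)))) > (1 - (1/2) ^ n) * sqn (ball_avg (k n))"
    by blast
  have dec: "sqn (ball_avg (Suc j)) \<le> sqn (ball_avg j)" for j
    unfolding ball_avg_Suc by (rule sqn_avg_le[OF ball_avg])
  have pos: "sqn (ball_avg (k n)) > 0" for n
  proof (rule ccontr)
    assume "\<not> ?thesis"
    then have "sqn (ball_avg (k n)) = 0" using sqn_nonneg[of "ball_avg (k n)"] by simp
    then show False using k[of n] dec[of "k n"] dec[of "Suc (k n)"] by simp
  qed
  define c where "c n = 1 / sqrt (sqn (ball_avg (k n)))" for n
  define F where "F n v = c n * ball_avg (k n) v" for n v
  have c: "c n > 0" "(c n)\<^sup>2 = 1 / sqn (ball_avg (k n))" for n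
    using pos[of n] by (auto simp: c_def power_divide)
  have avg_c: "avg (\<lambda>v. a * B v) = (\<lambda>v. a * avg B v)" for a B
    by (auto simp: avg_def)
  have sqn_c: "sqn (\<lambda>v. a * B v) = a\<^sup>2 * sqn B" for a B
    by (simp add: sqn_def power_mult_distrib)
  have "F n \<in> L2" for n
    using ball_avg(1)[of "k n"] by (auto simp: L2_def F_def[abs_def] power_mult_distrib)
  moreover have "nonneg_bounded (F n)" for n
  proof -
    obtain b where b: "\<And>v. 0 \<le> ball_avg (k n) v \<and> ball_avg (k n) v \<le> b"
      using ball_avg(2)[of "k n"] by (auto simp: nonneg_bounded_def)
    then have "0 \<le> F n v \<and> F n v \<le> c n * b" for v
      using c(1)[of n] b[of v] by (auto simp: F_def intro!: mult_left_mono)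
    then show ?thesis unfolding nonneg_bounded_def by blast
  qed
  moreover have "sqn (F n) = 1" for n
    using pos[of n] c[of n] by (simp add: F_def[abs_def] sqn_c)
  ultimately obtain n where "sqn (avg (avg (F n))) \<le> 1 - (1/2) ^ n"
    using no_almost_invariant_vectors by blast
  then have "sqn (ball_avg (Suc (Suc (k n)))) / sqn (ball_avg (k n)) \<le> 1 - (1/2) ^ n"
    by (simp add: F_def[abs_def] avg_c sqn_c c ball_avg_Suc)
  then show False using k[of n] pos[of n] by (simp add: field_simps)
qed

end

section \<open>Almost sure growth rate of random products\<close>

lemma measurable_matrix_matrix_mult_pair [measurable (raw)]:
  fixes f :: "'a \<Rightarrow> real^2^2"
  assumes "f \<in> borel_measurable N" "g \<in> borel_measurable N"
  shows "(\<lambda>x. f x ** g x :: real^2^2) \<in> borel_measurable N"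
proof (rule borel_measurable_continuous_Pair[OF assms])
  show "continuous_on UNIV (\<lambda>x. fst x ** snd x :: real^2^2)"
    unfolding matrix_matrix_mult_def by (intro continuous_intros continuous_on_vec_lambda)
qed

lemma comb_seq_shift: "(\<lambda>i. comb_seq m \<omega> \<omega>' (i + m)) = \<omega>'"
  by (simp add: comb_seq_add)

section \<open>Independence and stationarity of the sequence of parameters\<close>

context prob_space
begin

abbreviation "\<Omega> \<equiv> (\<Pi>\<^sub>M i\<in>(UNIV::nat set). M)"

lemma sequence_space: "sequence_space M" ..

lemma prob_space_\<Omega>: "prob_space \<Omega>"
  by (intro prob_space_PiM prob_space_axioms)

lemma measurable_shift [measurable]: "(\<lambda>\<omega> i. \<omega> (i + m)) \<in> \<Omega> \<rightarrow>\<^sub>M \<Omega>"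
  by (rule measurable_PiM_single') (auto simp: space_PiM PiE_iff)

text \<open>Gluing independent sequences at time \<open>m\<close> by \<open>comb_seq\<close>
  preserves the product measure. The hypothesis \<open>dep\<close> says that \<open>\<phi>\<close>
  reads only the first \<open>m\<close> coordinates.\<close>

lemma nn_integral_shift_product:
  assumes [measurable]: "\<phi> \<in> borel_measurable \<Omega>" "\<psi> \<in> borel_measurable \<Omega>"
    and dep: "\<And>\<omega> \<omega>'. \<phi> (comb_seq m \<omega> \<omega>') = \<phi> \<omega>"
  shows "(\<integral>\<^sup>+\<omega>. \<phi> \<omega> * \<psi> (\<lambda>i. \<omega> (i + m)) \<partial>\<Omega>) = (\<integral>\<^sup>+\<omega>. \<phi> \<omega> \<partial>\<Omega>) * (\<integral>\<^sup>+\<omega>. \<psi> \<omega> \<partial>\<Omega>)"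
proof -
  interpret S: sequence_space M by (rule sequence_space)
  interpret \<Omega>: prob_space \<Omega> by (rule prob_space_\<Omega>)
  have "(\<integral>\<^sup>+\<omega>. \<phi> \<omega> * \<psi> (\<lambda>i. \<omega> (i + m)) \<partial>\<Omega>)
     = (\<integral>\<^sup>+\<omega>. \<phi> \<omega> * \<psi> (\<lambda>i. \<omega> (i + m)) \<partial>distr (\<Omega> \<Otimes>\<^sub>M \<Omega>) \<Omega> (\<lambda>(\<omega>, \<omega>'). comb_seq m \<omega> \<omega>'))"
    by (subst S.PiM_comb_seq) simp
  also have "\<dots> = (\<integral>\<^sup>+x. \<phi> (fst x) * \<psi> (snd x) \<partial>(\<Omega> \<Otimes>\<^sub>M \<Omega>))"
    by (subst nn_integral_distr) (auto simp: split_beta' comb_seq_shift dep intro!: nn_integral_cong)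
  also have "\<dots> = (\<integral>\<^sup>+\<omega>. \<integral>\<^sup>+\<omega>'. \<phi> \<omega> * \<psi> \<omega>' \<partial>\<Omega> \<partial>\<Omega>)"
    by (subst S.P.nn_integral_fst[symmetric]) auto
  also have "\<dots> = (\<integral>\<^sup>+\<omega>. \<phi> \<omega> \<partial>\<Omega>) * (\<integral>\<^sup>+\<omega>. \<psi> \<omega> \<partial>\<Omega>)"
    by (simp add: nn_integral_cmult nn_integral_multc)
  finally show ?thesis .
qed

lemma distr_shift: "distr \<Omega> \<Omega> (\<lambda>\<omega> i. \<omega> (i + m)) = \<Omega>"
proof (rule measure_eqI)
  interpret \<Omega>: prob_space \<Omega> by (rule prob_space_\<Omega>)
  fix B assume "B \<in> sets (distr \<Omega> \<Omega> (\<lambda>\<omega> i. \<omega> (i + m)))"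
  then have B [measurable]: "B \<in> sets \<Omega>" by simp
  have "emeasure (distr \<Omega> \<Omega> (\<lambda>\<omega> i. \<omega> (i + m))) B = (\<integral>\<^sup>+\<omega>. indicator B \<omega> \<partial>distr \<Omega> \<Omega> (\<lambda>\<omega> i. \<omega> (i + m)))"
    by (simp add: B)
  also have "\<dots> = (\<integral>\<^sup>+\<omega>. indicator B (\<lambda>i. \<omega> (i + m)) \<partial>\<Omega>)"
    by (subst nn_integral_distr) auto
  also have "\<dots> = (\<integral>\<^sup>+\<omega>. indicator B \<omega> \<partial>\<Omega>)"
    using nn_integral_shift_product[of "\<lambda>_. 1" "indicator B" m] by (simp add: \<Omega>.emeasure_space_1)
  finally show "emeasure (distr \<Omega> \<Omega> (\<lambda>\<omega> i. \<omega> (i + m))) B = emeasure \<Omega> B" by simp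
qed simp

lemma integral_shift:
  fixes \<psi> :: "(nat \<Rightarrow> 'a) \<Rightarrow> real"
  assumes [measurable]: "\<psi> \<in> borel_measurable \<Omega>"
  shows "(\<integral>\<omega>. \<psi> (\<lambda>i. \<omega> (i + m)) \<partial>\<Omega>) = (\<integral>\<omega>. \<psi> \<omega> \<partial>\<Omega>)"
  using integral_distr[of "\<lambda>\<omega> i. \<omega> (i + m)" \<Omega> \<Omega> \<psi>] by (simp add: distr_shift)

end

section \<open>Subadditivity and the upper bound for the growth rate\<close>

context random_SL2
begin

fun prodX :: "(nat \<Rightarrow> 'a) \<Rightarrow> nat \<Rightarrow> real^2^2" where
  "prodX \<omega> 0 = mat 1"
| "prodX \<omega> (Suc n) = X (\<omega> n) ** prodX \<omega> n"

definition log_norm :: "nat \<Rightarrow> (nat \<Rightarrow> 'a) \<Rightarrow> real" where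
  "log_norm n \<omega> = ln (norm (prodX \<omega> n))"

abbreviation \<kappa> :: real where "\<kappa> \<equiv> ln K"

definition mean_log_norm :: "nat \<Rightarrow> real" where "mean_log_norm n = (\<integral>\<omega>. log_norm n \<omega> \<partial>\<Omega>)"

lemma det_prodX: "det (prodX \<omega> n) = 1"
  by (induction n) (simp_all add: det_mul det_X)

lemma prodX_add: "prodX \<omega> (n + m) = prodX (\<lambda>i. \<omega> (i + n)) m ** prodX \<omega> n"
  by (induction m) (simp_all add: matrix_mul_assoc add.commute)

lemma prodX_comb_seq: "n \<le> m \<Longrightarrow> prodX (comb_seq m \<omega> \<omega>') n = prodX \<omega> n"
  by (induction n) (simp_all add: comb_seq_less)

text \<open>A letter put in front acts first, hence on the right; this matches the recursion of
  \<open>avg\<close>.\<close>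

lemma prodX_case_nat: "prodX (case_nat s \<omega>) (Suc n) = prodX \<omega> n ** X s"
  by (induction n) (simp_all add: matrix_mul_assoc[symmetric])

lemma measurable_prodX [measurable]: "(\<lambda>\<omega>. prodX \<omega> n) \<in> borel_measurable \<Omega>"
  by (induction n) simp_all

lemma measurable_log_norm [measurable]: "log_norm n \<in> borel_measurable \<Omega>"
  unfolding log_norm_def[abs_def] by measurable

lemma norm_prodX_ge: "norm (prodX \<omega> n) \<ge> 1"
  by (rule norm_matrix2_ge_1[OF det_prodX])

lemma K_ge_1: "K \<ge> 1"
  using norm_matrix2_ge_1[OF det_X] norm_X_le order_trans by blast

lemma \<kappa>_nonneg: "\<kappa> \<ge> 0" using K_ge_1 by simp

lemma log_norm_nonneg: "log_norm n \<omega> \<ge> 0"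
  using norm_prodX_ge[of \<omega> n] by (simp add: log_norm_def)

lemma log_norm_add_le: "log_norm (n + m) \<omega> \<le> log_norm n \<omega> + log_norm m (\<lambda>i. \<omega> (i + n))"
proof -
  have p: "norm (prodX \<omega> n) > 0" "norm (prodX (\<lambda>i. \<omega> (i + n)) m) > 0" "norm (prodX \<omega> (n + m)) > 0"
    using norm_prodX_ge less_le_trans zero_less_one by metis+
  have "norm (prodX \<omega> (n + m)) \<le> norm (prodX (\<lambda>i. \<omega> (i + n)) m) * norm (prodX \<omega> n)"
    unfolding prodX_add by (rule norm_matrix2_mult_le)
  then have "log_norm (n + m) \<omega> \<le> ln (norm (prodX (\<lambda>i. \<omega> (i + n)) m) * norm (prodX \<omega> n))"
    unfolding log_norm_def using p by (subst ln_le_cancel_iff) auto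
  also have "\<dots> = log_norm n \<omega> + log_norm m (\<lambda>i. \<omega> (i + n))"
    unfolding log_norm_def using p by (simp add: ln_mult)
  finally show ?thesis .
qed

text \<open>A matrix of determinant one and its inverse have the same norm, so dropping the first
  \<open>n\<close> factors costs no more than their own logarithmic norm.\<close>

lemma log_norm_shift_le: "log_norm m (\<lambda>i. \<omega> (i + n)) \<le> log_norm (n + m) \<omega> + log_norm n \<omega>"
proof -
  have p: "norm (prodX \<omega> n) > 0" "norm (prodX (\<lambda>i. \<omega> (i + n)) m) > 0" "norm (prodX \<omega> (n + m)) > 0"
    using norm_prodX_ge less_le_trans zero_less_one by metis+
  have "prodX (\<lambda>i. \<omega> (i + n)) m = prodX \<omega> (n + m) ** inv2 (prodX \<omega> n)"
    unfolding prodX_add matrix_mul_assoc[symmetric] inv2_mult(2)[OF det_prodX] by simp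
  then have "norm (prodX (\<lambda>i. \<omega> (i + n)) m) \<le> norm (prodX \<omega> (n + m)) * norm (prodX \<omega> n)"
    using norm_matrix2_mult_le[of "prodX \<omega> (n + m)" "inv2 (prodX \<omega> n)"] by simp
  then have "log_norm m (\<lambda>i. \<omega> (i + n)) \<le> ln (norm (prodX \<omega> (n + m)) * norm (prodX \<omega> n))"
    unfolding log_norm_def using p by (subst ln_le_cancel_iff) auto
  also have "\<dots> = log_norm (n + m) \<omega> + log_norm n \<omega>"
    unfolding log_norm_def using p by (simp add: ln_mult)
  finally show ?thesis .
qed

lemma log_norm_1_le: "log_norm 1 \<omega> \<le> \<kappa>"
proof -
  have "0 < norm (X (\<omega> 0))" using norm_matrix2_ge_1[OF det_X[of "\<omega> 0"]] by linarith
  then show ?thesis using norm_X_le[of "\<omega> 0"] K_ge_1 by (simp add: log_norm_def)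
qed

text \<open>At time zero the value is \<open>ln (sqrt 2)\<close> and not zero. This is the source of
  the summand \<open>ln 2\<close> in the bounds below and of the restriction to positive numbers of
  blocks.\<close>

lemma log_norm_0_le: "log_norm 0 \<omega> \<le> ln 2"
  using real_sqrt_le_mono[of 2 4] by (simp add: log_norm_def norm_matrix2 mat2_1_nth ln_mono)

lemma log_norm_le_pos: "n \<ge> 1 \<Longrightarrow> log_norm n \<omega> \<le> real n * \<kappa>"
proof (induction n arbitrary: \<omega> rule: nat_induct_at_least)
  case base
  then show ?case using log_norm_1_le by simp
next
  case (Suc n)
  have "log_norm (n + 1) \<omega> \<le> log_norm n \<omega> + log_norm 1 (\<lambda>i. \<omega> (i + n))" by (rule log_norm_add_le)
  then show ?case using Suc.IH[of \<omega>] log_norm_1_le[of "\<lambda>i. \<omega> (i + n)"] by (simp add: algebra_simps)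
qed

lemma log_norm_le: "log_norm n \<omega> \<le> real n * \<kappa> + ln 2"
  using log_norm_le_pos[of n \<omega>] log_norm_0_le[of \<omega>] by (cases "n = 0") (auto simp: add_increasing2)

lemma integrable_log_norm: "integrable \<Omega> (log_norm n)"
proof -
  interpret \<Omega>: prob_space \<Omega> by (rule prob_space_\<Omega>)
  show ?thesis
    by (rule \<Omega>.integrable_const_bound[of _ "real n * \<kappa> + ln 2"]) (use log_norm_le log_norm_nonneg in auto)
qed

lemma mean_log_norm_add_le: "mean_log_norm (n + m) \<le> mean_log_norm n + mean_log_norm m"
proof -
  have I: "integrable \<Omega> (\<lambda>\<omega>. log_norm m (\<lambda>i. \<omega> (i + n)))"
    using integrable_distr[of "\<lambda>\<omega> i. \<omega> (i + n)" \<Omega> \<Omega> "log_norm m"] integrable_log_norm[of m] by (simp add: distr_shift)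
  have "mean_log_norm (n + m) \<le> (\<integral>\<omega>. log_norm n \<omega> + log_norm m (\<lambda>i. \<omega> (i + n)) \<partial>\<Omega>)"
    unfolding mean_log_norm_def using I integrable_log_norm log_norm_add_le by (intro integral_mono) auto
  also have "\<dots> = mean_log_norm n + mean_log_norm m"
    using I integrable_log_norm by (simp add: mean_log_norm_def integral_shift)
  finally show ?thesis .
qed

lemma mean_log_norm_nonneg: "mean_log_norm n \<ge> 0"
  unfolding mean_log_norm_def by (intro integral_nonneg_AE) (auto simp: log_norm_nonneg)

lemma mean_log_norm_mult_le: "j \<ge> 1 \<Longrightarrow> mean_log_norm (j * m) \<le> real j * mean_log_norm m"
proof (induction j rule: nat_induct_at_least)
  case (Suc j)
  have "mean_log_norm (Suc j * m) \<le> mean_log_norm m + mean_log_norm (j * m)" using mean_log_norm_add_le[of m "j * m"] by simp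
  then show ?case using Suc by (simp add: algebra_simps)
qed simp

text \<open>The infimum from Fekete's lemma, used as the candidate for the limit. The index 0 is
  left out because of the division.\<close>

definition lyapunov :: real where "lyapunov = (INF n\<in>{1..}. mean_log_norm n / real n)"

lemma lyapunov_le: "n \<ge> 1 \<Longrightarrow> lyapunov \<le> mean_log_norm n / real n"
  unfolding lyapunov_def by (intro cINF_lower bdd_belowI2[of _ 0]) (auto simp: mean_log_norm_nonneg)

lemma lyapunov_nonneg: "lyapunov \<ge> 0"
  unfolding lyapunov_def by (intro cINF_greatest) (auto simp: mean_log_norm_nonneg)

lemma nn_integral_exp_log_norm_le:
  assumes t: "t \<ge> 0" and j: "j \<ge> 1"
  shows "(\<integral>\<^sup>+\<omega>. ennreal (exp (t * log_norm (j * m) \<omega>)) \<partial>\<Omega>) \<le> (\<integral>\<^sup>+\<omega>. ennreal (exp (t * log_norm m \<omega>)) \<partial>\<Omega>) ^ j"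
  using j
proof (induction j rule: nat_induct_at_least)
  case (Suc j)
  have "(\<integral>\<^sup>+\<omega>. ennreal (exp (t * log_norm (Suc j * m) \<omega>)) \<partial>\<Omega>)
    \<le> (\<integral>\<^sup>+\<omega>. ennreal (exp (t * log_norm m \<omega>)) * ennreal (exp (t * log_norm (j * m) (\<lambda>i. \<omega> (i + m)))) \<partial>\<Omega>)"
  proof (rule nn_integral_mono)
    fix \<omega>
    have "t * log_norm (Suc j * m) \<omega> \<le> t * (log_norm m \<omega> + log_norm (j * m) (\<lambda>i. \<omega> (i + m)))"
      using log_norm_add_le[of m "j * m" \<omega>] t by (intro mult_left_mono) simp_all
    then show "ennreal (exp (t * log_norm (Suc j * m) \<omega>)) \<le> ennreal (exp (t * log_norm m \<omega>)) * ennreal (exp (t * log_norm (j * m) (\<lambda>i. \<omega> (i + m))))"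
      by (simp add: ennreal_mult[symmetric] exp_add[symmetric] algebra_simps)
  qed
  also have "\<dots> = (\<integral>\<^sup>+\<omega>. ennreal (exp (t * log_norm m \<omega>)) \<partial>\<Omega>) * (\<integral>\<^sup>+\<omega>. ennreal (exp (t * log_norm (j * m) \<omega>)) \<partial>\<Omega>)"
    by (rule nn_integral_shift_product) (simp_all add: log_norm_def prodX_comb_seq)
  also have "\<dots> \<le> (\<integral>\<^sup>+\<omega>. ennreal (exp (t * log_norm m \<omega>)) \<partial>\<Omega>) * (\<integral>\<^sup>+\<omega>. ennreal (exp (t * log_norm m \<omega>)) \<partial>\<Omega>) ^ j"
    by (intro mult_left_mono Suc) simp
  finally show ?case by simp
qed simp

text \<open>A Chernoff bound: to first order in \<open>t\<close> the exponential moment is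
  \<open>1 + t * mean_log_norm m\<close>, which lies below \<open>exp (t * b)\<close> for small
  \<open>t\<close>.\<close>

lemma exp_log_norm_bound:
  assumes b: "b > mean_log_norm m"
  shows "\<exists>t>0. \<exists>\<theta>. 0 < \<theta> \<and> \<theta> < exp (t * b) \<and> (\<integral>\<^sup>+\<omega>. ennreal (exp (t * log_norm m \<omega>)) \<partial>\<Omega>) \<le> ennreal \<theta>"
proof -
  interpret \<Omega>: prob_space \<Omega> by (rule prob_space_\<Omega>)
  define B where "B = real m * \<kappa> + 1"
  have B1: "B \<ge> 1" using \<kappa>_nonneg by (simp add: B_def)
  have fB: "log_norm m \<omega> \<le> B" for \<omega> using log_norm_le[of m \<omega>] ln_2_less_1 by (simp add: B_def)
  \<comment> \<open>The first bound keeps the exponent in the range of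
    \<open>exp x <= 1 + x + x\<^sup>2\<close>; the second lets the quadratic term use at most half
    of the gap between mean and \<open>b\<close>.\<close>
  define t where "t = min (1 / B) ((b - mean_log_norm m) / (2 * B\<^sup>2))"
  have t0: "t > 0" using B1 b by (simp add: t_def)
  have tB: "t * B \<le> 1" using B1 by (simp add: t_def min_def field_simps)
  have "t * B\<^sup>2 \<le> (b - mean_log_norm m) / 2"
  proof -
    have "t * B\<^sup>2 \<le> (b - mean_log_norm m) / (2 * B\<^sup>2) * B\<^sup>2" by (intro mult_right_mono) (auto simp: t_def)
    then show ?thesis using B1 by simp
  qed
  then have tB2: "mean_log_norm m + t * B\<^sup>2 < b" using b by simp
  define \<theta> where "\<theta> = 1 + t * mean_log_norm m + t * t * B\<^sup>2"
  have "(\<integral>\<^sup>+\<omega>. ennreal (exp (t * log_norm m \<omega>)) \<partial>\<Omega>) \<le> (\<integral>\<^sup>+\<omega>. ennreal (1 + t * log_norm m \<omega> + t * t * B\<^sup>2) \<partial>\<Omega>)"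
  proof (rule nn_integral_mono, rule ennreal_leI)
    fix \<omega>
    have tf: "0 \<le> t * log_norm m \<omega>" "t * log_norm m \<omega> \<le> t * B"
      using t0 log_norm_nonneg[of m \<omega>] fB[of \<omega>] by (auto intro!: mult_left_mono)
    have "exp (t * log_norm m \<omega>) \<le> 1 + t * log_norm m \<omega> + (t * log_norm m \<omega>)\<^sup>2"
      using tf tB by (intro exp_bound) auto
    also have "(t * log_norm m \<omega>)\<^sup>2 \<le> (t * B)\<^sup>2" using tf by (intro power_mono)
    finally show "exp (t * log_norm m \<omega>) \<le> 1 + t * log_norm m \<omega> + t * t * B\<^sup>2" by (simp add: power2_eq_square ac_simps)
  qed
  also have "\<dots> = ennreal (\<integral>\<omega>. 1 + t * log_norm m \<omega> + t * t * B\<^sup>2 \<partial>\<Omega>)"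
    using integrable_log_norm t0 log_norm_nonneg by (intro nn_integral_eq_integral) auto
  also have "(\<integral>\<omega>. 1 + t * log_norm m \<omega> + t * t * B\<^sup>2 \<partial>\<Omega>) = \<theta>"
    using integrable_log_norm by (simp add: \<theta>_def mean_log_norm_def \<Omega>.prob_space)
  finally have le: "(\<integral>\<^sup>+\<omega>. ennreal (exp (t * log_norm m \<omega>)) \<partial>\<Omega>) \<le> ennreal \<theta>" .
  have "\<theta> > 0" using t0 mean_log_norm_nonneg[of m] by (simp add: \<theta>_def add_pos_nonneg)
  moreover have "\<theta> < exp (t * b)"
  proof -
    have "\<theta> = 1 + t * (mean_log_norm m + t * B\<^sup>2)" by (simp add: \<theta>_def algebra_simps)
    also have "\<dots> \<le> exp (t * (mean_log_norm m + t * B\<^sup>2))" by (rule exp_ge_add_one_self)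
    also have "\<dots> < exp (t * b)" using tB2 t0 by simp
    finally show ?thesis .
  qed
  ultimately show ?thesis using t0 le by blast
qed

lemma AE_block_upper:
  assumes b: "b > mean_log_norm m"
  shows "AE \<omega> in \<Omega>. eventually (\<lambda>j. log_norm (j * m) \<omega> < real j * b) sequentially"
proof -
  interpret \<Omega>: prob_space \<Omega> by (rule prob_space_\<Omega>)
  obtain t \<theta> where t: "t > 0" "0 < \<theta>" "\<theta> < exp (t * b)" "(\<integral>\<^sup>+\<omega>. ennreal (exp (t * log_norm m \<omega>)) \<partial>\<Omega>) \<le> ennreal \<theta>"
    using exp_log_norm_bound[OF b] by blast
  define r where "r = \<theta> / exp (t * b)"
  have r: "0 < r" "r < 1" using t by (auto simp: r_def)
  \<comment> \<open>\<open>d j \<omega> < 1\<close> is the desired inequality for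
    \<open>Suc j\<close> blocks, and the means of \<open>d j\<close> are dominated by a geometric
    series. The index starts at one block because the moment bound does.\<close>
  define d where "d j \<omega> = exp (t * (log_norm (Suc j * m) \<omega> - real (Suc j) * b))" for j \<omega>
  have [measurable]: "d j \<in> borel_measurable \<Omega>" for j unfolding d_def[abs_def] by measurable
  have dint: "(\<integral>\<^sup>+\<omega>. ennreal (d j \<omega>) \<partial>\<Omega>) \<le> ennreal (r ^ Suc j)" for j
  proof -
    have eq: "ennreal (d j \<omega>) = ennreal (exp (- t * real (Suc j) * b)) * ennreal (exp (t * log_norm (Suc j * m) \<omega>))" for \<omega>
      unfolding d_def by (simp add: ennreal_mult[symmetric] exp_add[symmetric] algebra_simps)
    have "(\<integral>\<^sup>+\<omega>. ennreal (d j \<omega>) \<partial>\<Omega>) = ennreal (exp (- t * real (Suc j) * b)) * (\<integral>\<^sup>+\<omega>. ennreal (exp (t * log_norm (Suc j * m) \<omega>)) \<partial>\<Omega>)"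
      unfolding eq by (rule nn_integral_cmult) measurable
    also have "\<dots> \<le> ennreal (exp (- t * real (Suc j) * b)) * ennreal \<theta> ^ Suc j"
    proof (intro mult_left_mono)
      show "(\<integral>\<^sup>+\<omega>. ennreal (exp (t * log_norm (Suc j * m) \<omega>)) \<partial>\<Omega>) \<le> ennreal \<theta> ^ Suc j"
        using t by (intro order_trans[OF nn_integral_exp_log_norm_le power_mono]) auto
    qed simp
    also have "\<dots> = ennreal (exp (- t * real (Suc j) * b) * \<theta> ^ Suc j)"
      using t by (simp add: ennreal_power ennreal_mult[symmetric] del: power_Suc)
    also have "exp (- t * real (Suc j) * b) * \<theta> ^ Suc j = r ^ Suc j"
    proof -
      have "exp (- t * real (Suc j) * b) = exp (real (Suc j) * (- (t * b)))" by (simp only: algebra_simps mult_minus_left mult_minus_right)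
      also have "\<dots> = exp (- (t * b)) ^ Suc j" by (rule exp_of_nat_mult)
      finally show ?thesis by (simp add: r_def power_divide exp_minus field_simps power_mult_distrib[symmetric] del: power_Suc)
    qed
    finally show ?thesis .
  qed
  have "(\<integral>\<^sup>+\<omega>. (\<Sum>j. ennreal (d j \<omega>)) \<partial>\<Omega>) = (\<Sum>j. \<integral>\<^sup>+\<omega>. ennreal (d j \<omega>) \<partial>\<Omega>)"
    by (rule nn_integral_suminf) simp
  also have "\<dots> \<le> (\<Sum>j. ennreal (r ^ Suc j))"
    by (intro suminf_le dint) auto
  also have "\<dots> = ennreal (\<Sum>j. r ^ Suc j)"
    by (rule suminf_ennreal2) (use r in \<open>auto intro!: summable_mult summable_geometric\<close>)
  also have "\<dots> < \<infinity>" by simp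
  finally have "AE \<omega> in \<Omega>. (\<Sum>j. ennreal (d j \<omega>)) \<noteq> \<infinity>"
    by (intro nn_integral_noteq_infinite) auto
  then show ?thesis
  proof eventually_elim
    case (elim \<omega>)
    then have "summable (\<lambda>j. d j \<omega>)" by (intro summable_suminf_not_top) (auto simp: d_def)
    then have "(\<lambda>j. d j \<omega>) \<longlonglongrightarrow> 0" by (rule summable_LIMSEQ_zero)
    then have "eventually (\<lambda>j. d j \<omega> < 1) sequentially" by (rule order_tendstoD) simp
    then have "eventually (\<lambda>j. log_norm (Suc j * m) \<omega> < real (Suc j) * b) sequentially"
    proof eventually_elim
      case (elim j)
      then have "t * (log_norm (Suc j * m) \<omega> - real (Suc j) * b) < 0" unfolding d_def exp_less_one_iff .
      then show ?case using t(1) by (simp add: mult_less_0_iff)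
    qed
    then show ?case using eventually_sequentially_Suc[of "\<lambda>j. log_norm (j * m) \<omega> < real j * b"] by blast
  qed
qed

lemma AE_upper:
  assumes c: "c > lyapunov"
  shows "AE \<omega> in \<Omega>. eventually (\<lambda>n. log_norm n \<omega> / real n < c) sequentially"
proof -
  have "\<exists>m\<ge>1. mean_log_norm m / real m < c"
  proof (rule ccontr)
    assume "\<not> ?thesis"
    then have "c \<le> lyapunov" unfolding lyapunov_def by (intro cINF_greatest) (auto simp: not_less)
    then show False using c by simp
  qed
  then obtain m where m: "m \<ge> 1" "mean_log_norm m / real m < c" by blast
  then have um: "mean_log_norm m < real m * c" by (simp add: field_simps)
  \<comment> \<open>The midpoint leaves a linear margin that absorbs the incomplete last
    block.\<close>
  define b where "b = (mean_log_norm m + real m * c) / 2"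
  have b: "mean_log_norm m < b" "b < real m * c" using um by (simp_all add: b_def field_simps)
  have b0: "b > 0" using b(1) mean_log_norm_nonneg[of m] by simp
  from AE_block_upper[OF b(1)] show ?thesis
  proof eventually_elim
    case (elim \<omega>)
    then obtain J where J: "log_norm (j * m) \<omega> < real j * b" if "j \<ge> J" for j by (auto simp: eventually_sequentially)
    have "filterlim (\<lambda>n. (c - b / real m) * real n) at_top sequentially"
      using b(2) m(1) by (intro filterlim_tendsto_pos_mult_at_top[OF tendsto_const] filterlim_real_sequentially) (simp add: field_simps)
    then have "eventually (\<lambda>n. (c - b / real m) * real n > real m * \<kappa> + ln 2) sequentially"
      by (simp add: filterlim_at_top_dense)
    moreover have "eventually (\<lambda>n. n \<ge> J * m \<and> n \<ge> 1) sequentially"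
      by (intro eventually_conj eventually_ge_at_top)
    ultimately show ?case
    proof eventually_elim
      case (elim n)
      define j where "j = n div m"
      have jJ: "j \<ge> J" using elim m(1) by (simp add: j_def less_eq_div_iff_mult_less_eq)
      have n: "n = j * m + n mod m" by (simp add: j_def)
      have "log_norm n \<omega> \<le> log_norm (j * m) \<omega> + log_norm (n mod m) (\<lambda>i. \<omega> (i + j * m))"
        using log_norm_add_le[of "j * m" "n mod m" \<omega>] n by simp
      also have "\<dots> \<le> real j * b + (real m * \<kappa> + ln 2)"
      proof (intro add_mono)
        show "log_norm (j * m) \<omega> \<le> real j * b" using J[OF jJ] by simp
        have "real (n mod m) * \<kappa> \<le> real m * \<kappa>" using m(1) \<kappa>_nonneg by (intro mult_right_mono) simp_all
        then show "log_norm (n mod m) (\<lambda>i. \<omega> (i + j * m)) \<le> real m * \<kappa> + ln 2"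
          using log_norm_le[of "n mod m" "\<lambda>i. \<omega> (i + j * m)"] by simp
      qed
      also have "real j * b \<le> real n * (b / real m)"
      proof -
        have "real j * real m \<le> real n" by (simp add: j_def flip: of_nat_mult)
        from mult_right_mono[OF this, of "b / real m"] show ?thesis using b0 m(1) by simp
      qed
      finally have "log_norm n \<omega> < real n * (b / real m) + (c - b / real m) * real n" using elim(1) by simp
      also have "\<dots> = c * real n" by (simp add: algebra_simps)
      finally show ?case using elim(2) by (simp add: field_simps)
    qed
  qed
qed

end

section \<open>The lower bound for the growth rate and the almost sure limit\<close>

context random_SL2
begin

text \<open>Starting at \<open>i\<close>, a good position allows a jump over a block of growth at
  most \<open>q\<close> per step, a bad one is passed by a single step of cost
  \<open>\<kappa>\<close>, and a remainder of length at most \<open>B\<close> is estimated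
  trivially.\<close>

lemma log_norm_greedy_bound:
  assumes q: "q \<ge> 0" and good: "\<And>i. \<not> bad i \<Longrightarrow> \<exists>l\<in>{1..B}. log_norm l (\<lambda>k. \<omega> (k + i)) \<le> q * real l"
  shows "log_norm n (\<lambda>k. \<omega> (k + i)) \<le> q * real n + \<kappa> * real (card {j\<in>{i..<i+n}. bad j}) + (\<kappa> * real B + ln 2)"
proof (induction n arbitrary: i rule: less_induct)
  case (less n)
  show ?case
  proof (cases "n \<le> B")
    case True
    have "log_norm n (\<lambda>k. \<omega> (k + i)) \<le> real n * \<kappa> + ln 2" by (rule log_norm_le)
    also have "real n * \<kappa> \<le> \<kappa> * real B" using True mult_right_mono[of "real n" "real B", OF _ \<kappa>_nonneg] by (simp add: mult.commute)
    finally show ?thesis using q \<kappa>_nonneg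
      by (smt (verit) mult_nonneg_nonneg of_nat_0_le_iff)
  next
    case nB: False
    have step: "log_norm n (\<lambda>k. \<omega> (k + i)) \<le> log_norm l (\<lambda>k. \<omega> (k + i)) + (q * real (n - l) + \<kappa> * real (card {j\<in>{i+l..<i+n}. bad j}) + (\<kappa> * real B + ln 2))"
      if l: "1 \<le> l" "l \<le> n" for l
    proof -
      have "log_norm (l + (n - l)) (\<lambda>k. \<omega> (k + i)) \<le> log_norm l (\<lambda>k. \<omega> (k + i)) + log_norm (n - l) (\<lambda>k. \<omega> (k + l + i))"
        by (rule log_norm_add_le)
      moreover have "log_norm (n - l) (\<lambda>k. \<omega> (k + (i + l))) \<le> q * real (n - l) + \<kappa> * real (card {j\<in>{i+l..<i+l+(n-l)}. bad j}) + (\<kappa> * real B + ln 2)"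
        using l by (intro less) auto
      ultimately show ?thesis using l by (simp add: ac_simps)
    qed
    show ?thesis
    proof (cases "bad i")
      case True
      have "{j\<in>{i..<i+n}. bad j} = insert i {j\<in>{i+1..<i+n}. bad j}"
        using True nB by (auto simp: less_eq_Suc_le le_Suc_eq)
      then have "card {j\<in>{i..<i+n}. bad j} = Suc (card {j\<in>{i+1..<i+n}. bad j})" by simp
      moreover have "q * real (n - 1) \<le> q * real n" using q by (intro mult_left_mono) auto
      ultimately show ?thesis using step[of 1] log_norm_1_le[of "\<lambda>k. \<omega> (k + i)"] nB by (simp add: algebra_simps)
    next
      case False
      then obtain l where l: "1 \<le> l" "l \<le> B" "log_norm l (\<lambda>k. \<omega> (k + i)) \<le> q * real l"
        using good[OF False] by auto
      have "card {j\<in>{i+l..<i+n}. bad j} \<le> card {j\<in>{i..<i+n}. bad j}" by (intro card_mono) auto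
      then have "\<kappa> * real (card {j\<in>{i+l..<i+n}. bad j}) \<le> \<kappa> * real (card {j\<in>{i..<i+n}. bad j})"
        using \<kappa>_nonneg by (intro mult_left_mono) auto
      moreover have "q * real l + q * real (n - l) = q * real n"
        using l nB by (simp add: distrib_left[symmetric] of_nat_diff)
      ultimately show ?thesis using step[of l] l nB by simp
    qed
  qed
qed

text \<open>The event that the lower limit of \<open>log_norm n / n\<close> is below \<open>q\<close>, phrased without lower limits.\<close>
definition low :: "real \<Rightarrow> (nat \<Rightarrow> 'a) set" where
  "low q = {\<omega>\<in>space \<Omega>. \<exists>k::nat. \<forall>m. \<exists>n\<ge>m. log_norm n \<omega> \<le> (q - 1 / real (Suc k)) * real n}"

text \<open>No block of slow growth and length at most \<open>B\<close> begins at time zero.\<close>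

definition late :: "real \<Rightarrow> nat \<Rightarrow> (nat \<Rightarrow> 'a) set" where
  "late q B = {\<omega>\<in>space \<Omega>. \<forall>l\<in>{1..B}. log_norm l \<omega> > q * real l}"

lemma low_measurable [measurable]: "low q \<in> sets \<Omega>"
  unfolding low_def by measurable

lemma late_measurable [measurable]: "late q B \<in> sets \<Omega>"
  unfolding late_def by measurable

lemma shift_space: "\<omega> \<in> space \<Omega> \<Longrightarrow> (\<lambda>i. \<omega> (i + m)) \<in> space \<Omega>"
  using measurable_space[OF measurable_shift] by blast

text \<open>Dropping \<open>m\<close> factors changes the logarithmic norm by a bounded amount. The
  slack \<open>1 / real (Suc k)\<close> in \<open>low\<close> is there to pay for it: passing to the
  next \<open>k\<close> gains a positive multiple of the length.\<close>

lemma low_shift: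
  assumes "\<omega> \<in> low q"
  shows "(\<lambda>i. \<omega> (i + m)) \<in> low q"
proof -
  obtain k where sp: "\<omega> \<in> space \<Omega>" and k: "\<And>m. \<exists>n\<ge>m. log_norm n \<omega> \<le> (q - 1 / real (Suc k)) * real n"
    using assms by (auto simp: low_def)
  define c where "c = q - 1 / real (Suc k)"
  define c' where "c' = q - 1 / real (Suc (Suc k))"
  have cc: "c < c'" by (simp add: c_def c'_def field_simps)
  have "\<exists>n\<ge>N. log_norm n (\<lambda>i. \<omega> (i + m)) \<le> c' * real n" for N
  proof -
    obtain L where L: "real L * (c' - c) > \<bar>c\<bar> * real m + log_norm m \<omega>"
      using reals_Archimedean3[of "c' - c"] cc by auto
    obtain n where n: "n \<ge> m + N + L" "log_norm n \<omega> \<le> c * real n" using k[of "m + N + L"] by (auto simp: c_def)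
    define n' where "n' = n - m"
    have n': "n = m + n'" "n' \<ge> N" "n' \<ge> L" using n by (auto simp: n'_def)
    have "log_norm n' (\<lambda>i. \<omega> (i + m)) \<le> log_norm n \<omega> + log_norm m \<omega>" using log_norm_shift_le[of n' \<omega> m] n' by simp
    also have "\<dots> \<le> c * real m + c * real n' + log_norm m \<omega>" using n(2) n'(1) by (simp add: algebra_simps)
    also have "\<dots> \<le> c * real n' + real L * (c' - c)"
      using L mult_right_mono[OF abs_ge_self[of c], of "real m"] by simp
    also have "\<dots> \<le> c * real n' + real n' * (c' - c)"
      using n'(3) cc by (intro add_left_mono mult_right_mono) auto
    also have "\<dots> = c' * real n'" by (simp add: algebra_simps)
    finally show ?thesis using n'(2) by blast
  qed
  then show ?thesis unfolding low_def c'_def using shift_space[OF sp] by blast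
qed

text \<open>On \<open>low q\<close> some block of slow growth starts at time zero, so a large
  \<open>B\<close> removes the point from \<open>late q B\<close>.\<close>

lemma low_late: "(\<Inter>B. low q \<inter> late q B) = {}"
proof -
  have "\<exists>B. \<omega> \<notin> late q B" if low: "\<omega> \<in> low q" for \<omega>
  proof -
    obtain k where k: "\<And>m. \<exists>n\<ge>m. log_norm n \<omega> \<le> (q - 1 / real (Suc k)) * real n"
      using low unfolding low_def by blast
    obtain n where n: "n \<ge> 1" "log_norm n \<omega> \<le> (q - 1 / real (Suc k)) * real n"
      using k[of 1] by blast
    have "(q - 1 / real (Suc k)) * real n \<le> q * real n" by (intro mult_right_mono) auto
    then have "log_norm n \<omega> \<le> q * real n" using n(2) by (rule order_trans[rotated])
    then have "\<omega> \<notin> late q n" using n(1) by (auto simp: late_def not_less intro!: bexI[of _ n])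
    then show ?thesis by blast
  qed
  then show ?thesis by blast
qed

text \<open>Shifts of a point of \<open>low q\<close> stay there, so the greedy bound applies with
  \<open>low q \<inter> late q B\<close> as the set of bad positions. By stationarity each position
  is bad with the same probability.\<close>

lemma integral_low_le:
  assumes q: "q \<ge> 0"
  shows "(\<integral>\<omega>. indicator (low q) \<omega> * log_norm n \<omega> \<partial>\<Omega>) \<le>
     q * real n * measure \<Omega> (low q) + \<kappa> * real n * measure \<Omega> (low q \<inter> late q B) + (\<kappa> * real B + ln 2)"
proof -
  interpret \<Omega>: prob_space \<Omega> by (rule prob_space_\<Omega>)
  let ?b = "\<lambda>i \<omega>. indicator (low q \<inter> late q B) (\<lambda>k. \<omega> (k + i)) :: real"
  have [measurable]: "(\<lambda>\<omega>. ?b i \<omega>) \<in> borel_measurable \<Omega>" for i by measurable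
  have I: "integrable \<Omega> (\<lambda>\<omega>. ?b i \<omega>)" for i
    by (rule \<Omega>.integrable_const_bound[of _ 1]) auto
  have "(\<integral>\<omega>. indicator (low q) \<omega> * log_norm n \<omega> \<partial>\<Omega>) \<le>
    (\<integral>\<omega>. q * real n * indicator (low q) \<omega> + \<kappa> * (\<Sum>i<n. ?b i \<omega>) + (\<kappa> * real B + ln 2) \<partial>\<Omega>)"
  proof (rule integral_mono)
    show "integrable \<Omega> (\<lambda>\<omega>. indicator (low q) \<omega> * log_norm n \<omega>)"
      using integrable_mult_indicator[OF low_measurable integrable_log_norm, of q n] by simp
    show "integrable \<Omega> (\<lambda>\<omega>. q * real n * indicator (low q) \<omega> + \<kappa> * (\<Sum>i<n. ?b i \<omega>) + (\<kappa> * real B + ln 2))"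
      using I by (intro Bochner_Integration.integrable_add integrable_mult_right Bochner_Integration.integrable_sum integrable_real_indicator) (auto simp: \<Omega>.emeasure_finite less_top[symmetric])
    fix \<omega>
    have nn: "0 \<le> \<kappa> * (\<Sum>i<n. ?b i \<omega>)" "0 \<le> \<kappa> * real B + ln 2"
      using \<kappa>_nonneg by (auto intro!: mult_nonneg_nonneg sum_nonneg add_nonneg_nonneg)
    show "indicator (low q) \<omega> * log_norm n \<omega> \<le> q * real n * indicator (low q) \<omega> + \<kappa> * (\<Sum>i<n. ?b i \<omega>) + (\<kappa> * real B + ln 2)"
    proof (cases "\<omega> \<in> low q")
      case True
      define bad where "bad i \<longleftrightarrow> (\<lambda>k. \<omega> (k + i)) \<in> low q \<inter> late q B" for i
      have "\<exists>l\<in>{1..B}. log_norm l (\<lambda>k. \<omega> (k + i)) \<le> q * real l" if "\<not> bad i" for i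
      proof -
        have "(\<lambda>k. \<omega> (k + i)) \<in> low q" by (rule low_shift[OF True])
        moreover then have "(\<lambda>k. \<omega> (k + i)) \<in> space \<Omega>" by (simp add: low_def)
        ultimately show ?thesis using that by (auto simp: bad_def late_def not_less)
      qed
      from log_norm_greedy_bound[OF q, of bad B \<omega> n 0, OF this]
      have "log_norm n \<omega> \<le> q * real n + \<kappa> * real (card {j\<in>{..<n}. bad j}) + (\<kappa> * real B + ln 2)"
        by (simp add: atLeast0LessThan)
      also have "real (card {j\<in>{..<n}. bad j}) = (\<Sum>i<n. ?b i \<omega>)"
        by (simp add: indicator_def sum.If_cases bad_def Int_def)
      finally show ?thesis using True by simp
    next
      case False
      then show ?thesis using nn by simp
    qed
  qed
  also have "\<dots> = q * real n * measure \<Omega> (low q) + \<kappa> * (\<Sum>i<n. \<integral>\<omega>. ?b i \<omega> \<partial>\<Omega>) + (\<kappa> * real B + ln 2)"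
    using I by (simp add: \<Omega>.prob_space integral_sum \<Omega>.emeasure_finite less_top[symmetric])
  also have "(\<Sum>i<n. \<integral>\<omega>. ?b i \<omega> \<partial>\<Omega>) = real n * measure \<Omega> (low q \<inter> late q B)"
    by (subst integral_shift) (auto simp: \<Omega>.emeasure_finite)
  finally show ?thesis by (simp add: mult.assoc)
qed

lemma AE_log_norm_upper_all: "AE \<omega> in \<Omega>. \<forall>k::nat. eventually (\<lambda>n. log_norm n \<omega> / real n < lyapunov + 1 / real (Suc k)) sequentially"
  unfolding AE_all_countable by (intro allI AE_upper) simp

text \<open>The mean excess over \<open>lyapunov\<close> tends to zero by the upper bound and
  dominated convergence. Deficit minus excess has mean
  \<open>lyapunov - mean_log_norm n / real n\<close>, which is nonpositive because
  \<open>lyapunov\<close> is an infimum, so the deficit follows.\<close>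

lemma deficit_tendsto_0: "(\<lambda>n. \<integral>\<omega>. max 0 (lyapunov - log_norm n \<omega> / real n) \<partial>\<Omega>) \<longlonglongrightarrow> 0"
proof -
  interpret \<Omega>: prob_space \<Omega> by (rule prob_space_\<Omega>)
  define h where "h n \<omega> = max 0 (log_norm n \<omega> / real n - lyapunov)" for n \<omega>
  have [measurable]: "h n \<in> borel_measurable \<Omega>" for n unfolding h_def[abs_def] by measurable
  have fn: "log_norm n \<omega> / real n \<le> \<kappa>" for n \<omega>
    using log_norm_le_pos[of n \<omega>] \<kappa>_nonneg by (cases "n = 0") (auto simp: field_simps)
  have hb: "norm (h n \<omega>) \<le> \<kappa>" for n \<omega>
    using fn[of n \<omega>] lyapunov_nonneg \<kappa>_nonneg by (auto simp: h_def)
  have "(\<lambda>n. \<integral>\<omega>. h n \<omega> \<partial>\<Omega>) \<longlonglongrightarrow> (\<integral>\<omega>. 0 \<partial>\<Omega>)"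
  proof (rule integral_dominated_convergence[where w = "\<lambda>_. \<kappa>"])
    show "AE \<omega> in \<Omega>. (\<lambda>n. h n \<omega>) \<longlonglongrightarrow> 0"
      using AE_log_norm_upper_all
    proof eventually_elim
      case (elim \<omega>)
      show ?case
      proof (rule LIMSEQ_I)
        fix r :: real assume "r > 0"
        then obtain k where k: "1 / real (Suc k) < r" using nat_approx_posE by metis
        from elim have "eventually (\<lambda>n. log_norm n \<omega> / real n < lyapunov + 1 / real (Suc k)) sequentially" by blast
        then have "eventually (\<lambda>n. norm (h n \<omega> - 0) < r) sequentially"
          by eventually_elim (use k \<open>r > 0\<close> in \<open>auto simp: h_def\<close>)
        then show "\<exists>no. \<forall>n\<ge>no. norm (h n \<omega> - 0) < r" by (simp add: eventually_sequentially)
      qed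
    qed
  qed (use hb in auto)
  then have lim: "(\<lambda>n. \<integral>\<omega>. h n \<omega> \<partial>\<Omega>) \<longlonglongrightarrow> 0" by simp
  show ?thesis
  proof (rule tendsto_sandwich[OF _ _ tendsto_const lim])
    show "eventually (\<lambda>n. 0 \<le> (\<integral>\<omega>. max 0 (lyapunov - log_norm n \<omega> / real n) \<partial>\<Omega>)) sequentially"
      by (intro always_eventually allI integral_nonneg_AE) auto
    show "eventually (\<lambda>n. (\<integral>\<omega>. max 0 (lyapunov - log_norm n \<omega> / real n) \<partial>\<Omega>) \<le> (\<integral>\<omega>. h n \<omega> \<partial>\<Omega>)) sequentially"
      using eventually_ge_at_top[of 1]
    proof eventually_elim
      case (elim n)
      have I: "integrable \<Omega> (h n)" "integrable \<Omega> (\<lambda>\<omega>. log_norm n \<omega> / real n)"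
        using hb integrable_log_norm by (auto intro!: \<Omega>.integrable_const_bound[of "h n" \<kappa>])
      have "max 0 (lyapunov - log_norm n \<omega> / real n) = h n \<omega> - (log_norm n \<omega> / real n - lyapunov)" for \<omega>
        by (simp add: h_def max_def)
      then have "(\<integral>\<omega>. max 0 (lyapunov - log_norm n \<omega> / real n) \<partial>\<Omega>) = (\<integral>\<omega>. h n \<omega> \<partial>\<Omega>) - (mean_log_norm n / real n - lyapunov)"
        using I by (simp add: mean_log_norm_def \<Omega>.prob_space)
      then show ?case using lyapunov_le[of n] elim by simp
    qed
  qed
qed

text \<open>On \<open>low q\<close> the mean growth rate is asymptotically at least
  \<open>lyapunov\<close> by the vanishing deficit and at most \<open>q\<close>, up to bad
  positions, by the greedy bound. Letting \<open>n\<close> and then \<open>B\<close> grow gives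
  \<open>(lyapunov - q) * measure \<Omega> (low q) <= 0\<close>.\<close>

lemma low_null:
  assumes q: "0 \<le> q" "q < lyapunov"
  shows "measure \<Omega> (low q) = 0"
proof -
  interpret \<Omega>: prob_space \<Omega> by (rule prob_space_\<Omega>)
  have bound: "lyapunov * measure \<Omega> (low q) \<le> q * measure \<Omega> (low q) + \<kappa> * measure \<Omega> (low q \<inter> late q B)" for B
  proof (rule LIMSEQ_le[OF tendsto_const])
    let ?R = "\<lambda>n. q * measure \<Omega> (low q) + \<kappa> * measure \<Omega> (low q \<inter> late q B) + (\<kappa> * real B + ln 2) / real n
        + (\<integral>\<omega>. max 0 (lyapunov - log_norm n \<omega> / real n) \<partial>\<Omega>)"
    have "?R \<longlonglongrightarrow> q * measure \<Omega> (low q) + \<kappa> * measure \<Omega> (low q \<inter> late q B) + 0 + 0"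
      by (intro tendsto_add deficit_tendsto_0 tendsto_const lim_const_over_n)
    then show "?R \<longlonglongrightarrow> q * measure \<Omega> (low q) + \<kappa> * measure \<Omega> (low q \<inter> late q B)" by simp
    have "lyapunov * measure \<Omega> (low q) \<le> ?R n" if n: "n \<ge> 1" for n
    proof -
      have I1: "integrable \<Omega> (\<lambda>\<omega>. indicator (low q) \<omega> * log_norm n \<omega>)"
        using integrable_mult_indicator[OF low_measurable integrable_log_norm, of q n] by simp
      have I2: "integrable \<Omega> (\<lambda>\<omega>. max 0 (lyapunov - log_norm n \<omega> / real n))"
        using integrable_log_norm by (intro integrable_max) auto
      have I3: "integrable \<Omega> (\<lambda>\<omega>. lyapunov * indicator (low q) \<omega>)"
        by (intro integrable_mult_right integrable_real_indicator) (auto simp: \<Omega>.emeasure_finite less_top[symmetric])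
      have "lyapunov * measure \<Omega> (low q) = (\<integral>\<omega>. lyapunov * indicator (low q) \<omega> \<partial>\<Omega>)"
        by simp
      also have "\<dots> \<le> (\<integral>\<omega>. (indicator (low q) \<omega> * log_norm n \<omega>) / real n + max 0 (lyapunov - log_norm n \<omega> / real n) \<partial>\<Omega>)"
        using I1 I2 I3 by (intro integral_mono) (auto simp: indicator_def log_norm_nonneg)
      also have "\<dots> = (\<integral>\<omega>. indicator (low q) \<omega> * log_norm n \<omega> \<partial>\<Omega>) / real n + (\<integral>\<omega>. max 0 (lyapunov - log_norm n \<omega> / real n) \<partial>\<Omega>)"
        using I1 I2 by simp
      also have "(\<integral>\<omega>. indicator (low q) \<omega> * log_norm n \<omega> \<partial>\<Omega>) / real n \<le>
         (q * real n * measure \<Omega> (low q) + \<kappa> * real n * measure \<Omega> (low q \<inter> late q B) + (\<kappa> * real B + ln 2)) / real n"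
        by (intro divide_right_mono integral_low_le q) simp
      also have "\<dots> = q * measure \<Omega> (low q) + \<kappa> * measure \<Omega> (low q \<inter> late q B) + (\<kappa> * real B + ln 2) / real n"
        using n by (simp add: add_divide_distrib)
      finally show ?thesis by simp
    qed
    then show "\<exists>N. \<forall>n\<ge>N. lyapunov * measure \<Omega> (low q) \<le> ?R n" by blast
  qed
  have "(\<lambda>B. measure \<Omega> (low q \<inter> late q B)) \<longlonglongrightarrow> measure \<Omega> (\<Inter>B. low q \<inter> late q B)"
    by (intro \<Omega>.finite_Lim_measure_decseq) (auto simp: decseq_def late_def)
  then have "(\<lambda>B. measure \<Omega> (low q \<inter> late q B)) \<longlonglongrightarrow> 0" unfolding low_late by simp
  then have "(\<lambda>B. q * measure \<Omega> (low q) + \<kappa> * measure \<Omega> (low q \<inter> late q B)) \<longlonglongrightarrow> q * measure \<Omega> (low q) + \<kappa> * 0"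
    by (intro tendsto_intros)
  then have "lyapunov * measure \<Omega> (low q) \<le> q * measure \<Omega> (low q) + \<kappa> * 0"
    by (rule LIMSEQ_le_const) (use bound in auto)
  then have "(lyapunov - q) * measure \<Omega> (low q) \<le> 0" by (simp add: algebra_simps)
  then show ?thesis using q by (simp add: mult_le_0_iff measure_le_0_iff)
qed

theorem lyapunov_limit: "AE \<omega> in \<Omega>. (\<lambda>n. log_norm n \<omega> / real n) \<longlonglongrightarrow> lyapunov"
proof -
  interpret \<Omega>: prob_space \<Omega> by (rule prob_space_\<Omega>)
  have "AE \<omega> in \<Omega>. \<forall>k::nat. 0 \<le> lyapunov - 1 / real (Suc k) \<longrightarrow> \<omega> \<notin> low (lyapunov - 1 / real (Suc k))"
    unfolding AE_all_countable
  proof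
    fix k :: nat
    show "AE \<omega> in \<Omega>. 0 \<le> lyapunov - 1 / real (Suc k) \<longrightarrow> \<omega> \<notin> low (lyapunov - 1 / real (Suc k))"
    proof (cases "0 \<le> lyapunov - 1 / real (Suc k)")
      case True
      then have "low (lyapunov - 1 / real (Suc k)) \<in> null_sets \<Omega>"
        using low_null[OF True] by (auto simp: null_sets_def \<Omega>.emeasure_eq_measure)
      then show ?thesis using AE_not_in by auto
    qed simp
  qed
  moreover note AE_log_norm_upper_all
  moreover note AE_space[of \<Omega>]
  ultimately show ?thesis
  proof eventually_elim
    case (elim \<omega>)
    show ?case
    proof (rule order_tendstoI)
      fix c assume "lyapunov < c"
      then obtain k where k: "1 / real (Suc k) < c - lyapunov" using nat_approx_posE[of "c - lyapunov"] by auto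
      from elim(2) have "eventually (\<lambda>n. log_norm n \<omega> / real n < lyapunov + 1 / real (Suc k)) sequentially" by blast
      then show "eventually (\<lambda>n. log_norm n \<omega> / real n < c) sequentially"
        by eventually_elim (use k in auto)
    next
      fix c assume c: "c < lyapunov"
      show "eventually (\<lambda>n. c < log_norm n \<omega> / real n) sequentially"
      proof (cases "c < 0")
        case True
        then show ?thesis by (intro always_eventually allI) (use log_norm_nonneg in \<open>auto intro: less_le_trans\<close>)
      next
        case False
        \<comment> \<open>Half of the gap, because \<open>1 / real (Suc k)\<close> is subtracted
          twice: once in the level and once as the slack inside \<open>low\<close>.\<close>
        obtain k where k: "1 / real (Suc k) < (lyapunov - c) / 2" using nat_approx_posE[of "(lyapunov - c) / 2"] c by auto
        have "0 \<le> lyapunov - e" if "e < (lyapunov - c) / 2" for e using that False c by simp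
        then have "0 \<le> lyapunov - 1 / real (Suc k)" using k by blast
        then have "\<omega> \<notin> low (lyapunov - 1 / real (Suc k))" using elim(1) by blast
        then have "\<not> (\<forall>m. \<exists>n\<ge>m. log_norm n \<omega> \<le> (lyapunov - 1 / real (Suc k) - 1 / real (Suc k)) * real n)"
          using elim(3) unfolding low_def by blast
        then obtain m where m: "\<And>n. n \<ge> m \<Longrightarrow> log_norm n \<omega> > (lyapunov - 1 / real (Suc k) - 1 / real (Suc k)) * real n"
          by (meson not_le)
        have "c < log_norm n \<omega> / real n" if "n \<ge> max m 1" for n
        proof -
          have "c * real n \<le> (lyapunov - 1 / real (Suc k) - 1 / real (Suc k)) * real n"
            using k by (intro mult_right_mono) auto
          also have "\<dots> < log_norm n \<omega>" using m that by simp
          finally show ?thesis using that by (simp add: field_simps)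
        qed
        then show ?thesis unfolding eventually_sequentially by blast
      qed
    qed
  qed
qed

end

section \<open>Positivity of the exponent\<close>

context nondegenerate_random_SL2
begin

text \<open>The \<open>k\<close>-th average at \<open>v\<close> is the probability that the product
  of \<open>k\<close> factors keeps \<open>v\<close> in the unit ball. The induction splits off the
  factor applied first.\<close>

lemma ball_avg_eq: "ball_avg k v = (\<integral>\<omega>. indicator (cball 0 1) (prodX \<omega> k *v v) \<partial>\<Omega>)"
proof (induction k arbitrary: v)
  case 0
  interpret \<Omega>: prob_space \<Omega> by (rule prob_space_\<Omega>)
  show ?case by (simp add: ball_avg_def \<Omega>.prob_space)
next
  case (Suc k)
  interpret S: sequence_space M by (rule sequence_space)
  interpret \<Omega>: prob_space \<Omega> by (rule prob_space_\<Omega>)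
  interpret P: pair_prob_space M \<Omega> ..
  have cb [measurable]: "cball (0::real^2) 1 \<in> sets borel" by simp
  have "(\<integral>\<omega>. indicat_real (cball 0 1) (prodX \<omega> (Suc k) *v v) \<partial>\<Omega>) =
     (\<integral>\<omega>. indicator (cball 0 1) (prodX \<omega> (Suc k) *v v) \<partial>distr (M \<Otimes>\<^sub>M \<Omega>) \<Omega> (\<lambda>(s, \<omega>). case_nat s \<omega>)) "
    by (subst S.PiM_iter) simp
  also have "\<dots> = (\<integral>x. indicator (cball 0 1) (prodX (case_nat (fst x) (snd x)) (Suc k) *v v) \<partial>(M \<Otimes>\<^sub>M \<Omega>)) "
    unfolding split_beta' by (subst integral_distr) (auto simp del: prodX.simps)
  also have "\<dots> = (\<integral>x. (case x of (s, \<omega>) \<Rightarrow> indicator (cball 0 1) (prodX \<omega> k *v (X s *v v))) \<partial>(M \<Otimes>\<^sub>M \<Omega>))"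
    by (simp add: prodX_case_nat split_beta' matrix_vector_mul_assoc del: prodX.simps)
  also have "\<dots> = (\<integral>s. (\<integral>\<omega>. indicator (cball 0 1) (prodX \<omega> k *v (X s *v v)) \<partial>\<Omega>) \<partial>M)"
  proof -
    have "integrable (M \<Otimes>\<^sub>M \<Omega>) (\<lambda>x. indicat_real (cball 0 1) (prodX (snd x) k *v (X (fst x) *v v)))"
      by (rule P.integrable_const_bound[of _ 1]) auto
    from P.integral_fst'[OF this] show ?thesis by (simp add: split_beta')
  qed
  also have "\<dots> = avg (ball_avg k) v" unfolding avg_def Suc.IH ..
  finally show ?case by (simp add: ball_avg_Suc)
qed

text \<open>A product of norm at most \<open>R\<close> maps the ball of radius \<open>1 / R\<close>
  into the unit ball, so \<open>ball_avg k\<close> is at least the probability in question on a set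
  of area proportional to \<open>1 / R\<^sup>2\<close>.\<close>

lemma measure_norm_prodX_le:
  assumes R: "R > 0"
  shows "(measure \<Omega> {\<omega>\<in>space \<Omega>. norm (prodX \<omega> k) \<le> R})\<^sup>2 * measure lborel (cball (0::real^2) 1) \<le> R\<^sup>2 * sqn (ball_avg k)"
proof -
  interpret \<Omega>: prob_space \<Omega> by (rule prob_space_\<Omega>)
  define p where "p = measure \<Omega> {\<omega>\<in>space \<Omega>. norm (prodX \<omega> k) \<le> R}"
  define r where "r = 1 / R"
  have r: "r > 0" using R by (simp add: r_def)
  have cb [measurable]: "cball (0::real^2) 1 \<in> sets borel" by simp
  have ge: "p \<le> ball_avg k v" if "v \<in> cball 0 r" for v
  proof -
    have "p = (\<integral>\<omega>. indicator {\<omega>\<in>space \<Omega>. norm (prodX \<omega> k) \<le> R} \<omega> \<partial>\<Omega>)" by (simp add: p_def)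
    also have "\<dots> \<le> (\<integral>\<omega>. indicator (cball 0 1) (prodX \<omega> k *v v) \<partial>\<Omega>)"
    proof (rule integral_mono)
      fix \<omega>
      have "norm (prodX \<omega> k *v v) \<le> 1" if "norm (prodX \<omega> k) \<le> R"
      proof -
        have "norm (prodX \<omega> k *v v) \<le> norm (prodX \<omega> k) * norm v" by (rule norm_matrix2_vec_le)
        also have "\<dots> \<le> R * r" using that \<open>v \<in> cball 0 r\<close> R by (intro mult_mono) auto
        finally show ?thesis using R by (simp add: r_def)
      qed
      then show "indicator {\<omega>\<in>space \<Omega>. norm (prodX \<omega> k) \<le> R} \<omega> \<le> (indicator (cball 0 1) (prodX \<omega> k *v v) :: real)"
        by (auto simp: indicator_def)
    qed (auto intro!: \<Omega>.integrable_const_bound[of _ 1])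
    finally show ?thesis by (simp add: ball_avg_eq)
  qed
  have p0: "p \<ge> 0" by (simp add: p_def)
  have fin: "emeasure lborel (cball (0::real^2) r) < \<infinity>" by (rule emeasure_bounded_finite) simp
  have "p\<^sup>2 * measure lborel (cball (0::real^2) r) = (\<integral>v. p\<^sup>2 * indicator (cball (0::real^2) r) v \<partial>lborel)"
    by simp
  also have "\<dots> \<le> sqn (ball_avg k)"
    unfolding sqn_def
  proof (rule integral_mono)
    show "integrable lborel (\<lambda>v. p\<^sup>2 * indicator (cball (0::real^2) r) v)"
      using fin by (intro integrable_mult_right integrable_real_indicator) auto
    show "integrable lborel (\<lambda>v. (ball_avg k v)\<^sup>2)" by (rule L2_D(2)[OF ball_avg(1)])
    fix v :: "real^2" show "p\<^sup>2 * indicator (cball 0 r) v \<le> (ball_avg k v)\<^sup>2"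
      using ge[of v] p0 by (auto simp: indicator_def intro!: power_mono)
  qed
  also have "measure lborel (cball (0::real^2) r) = r\<^sup>2 * measure lborel (cball (0::real^2) 1)"
    using r by (simp add: content_cball)
  finally show ?thesis using R by (simp add: p_def[symmetric] r_def field_simps)
qed

lemma lyapunov_pos: "lyapunov > 0"
proof -
  interpret \<Omega>: prob_space \<Omega> by (rule prob_space_\<Omega>)
  obtain \<rho>0 where \<rho>0: "0 \<le> \<rho>0" "\<rho>0 < 1" "\<And>k. sqn (ball_avg (Suc (Suc k))) \<le> \<rho>0 * sqn (ball_avg k)"
    using sqn_ball_avg_contraction by blast
  \<comment> \<open>Raised to at least 1/2 so that its fourth root is positive and can be
    inverted.\<close>
  define \<rho> where "\<rho> = max \<rho>0 (1/2)"
  have \<rho>: "0 < \<rho>" "\<rho> < 1" using \<rho>0 by (auto simp: \<rho>_def)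
  have step: "sqn (ball_avg (Suc (Suc k))) \<le> \<rho> * sqn (ball_avg k)" for k
    using \<rho>0(3)[of k] mult_right_mono[of \<rho>0 \<rho> "sqn (ball_avg k)"] sqn_nonneg[of "ball_avg k"] by (simp add: \<rho>_def)
  define c0 where "c0 = measure lborel (cball (0::real^2) 1)"
  have c0: "c0 > 0" by (simp add: c0_def content_cball_pos)
  have "sqn (ball_avg 0) = c0"
    by (simp add: sqn_def ball_avg_def power2_eq_square indicator_inter_arith[symmetric] c0_def)
  then have pow: "sqn (ball_avg (2 * j)) \<le> \<rho> ^ j * c0" for j
  proof (induction j)
    case (Suc j)
    have "sqn (ball_avg (2 * Suc j)) \<le> \<rho> * sqn (ball_avg (2 * j))" using step[of "2 * j"] by simp
    also have "\<dots> \<le> \<rho> * (\<rho> ^ j * c0)" using Suc \<rho> by (intro mult_left_mono) auto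
    finally show ?case by simp
  qed simp
  \<comment> \<open>The fourth root balances the estimate: with threshold
    \<open>(1 / \<sigma>) ^ j\<close>, the squared probability is at most
    \<open>(\<rho> / \<sigma>\<^sup>2) ^ j = (\<sigma> ^ j)\<^sup>2\<close>.\<close>
  define \<sigma> where "\<sigma> = sqrt (sqrt \<rho>)"
  have \<sigma>: "0 < \<sigma>" "\<sigma> < 1" "\<sigma> ^ 4 = \<rho>"
  proof -
    have "\<sigma>\<^sup>2 = sqrt \<rho>" "(sqrt \<rho>)\<^sup>2 = \<rho>" using \<rho> by (simp_all add: \<sigma>_def)
    then show "\<sigma> ^ 4 = \<rho>" by (metis mult_2 numeral_Bit0 power_add power2_eq_square)
  qed (use \<rho> in \<open>simp_all add: \<sigma>_def\<close>)
  have P: "measure \<Omega> {\<omega>\<in>space \<Omega>. norm (prodX \<omega> (2 * j)) \<le> (1 / \<sigma>) ^ j} \<le> \<sigma> ^ j" for j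
  proof -
    let ?p = "measure \<Omega> {\<omega>\<in>space \<Omega>. norm (prodX \<omega> (2 * j)) \<le> (1 / \<sigma>) ^ j}"
    have "?p\<^sup>2 * c0 \<le> ((1 / \<sigma>) ^ j)\<^sup>2 * sqn (ball_avg (2 * j))"
      unfolding c0_def using \<sigma> by (intro measure_norm_prodX_le) simp
    also have "\<dots> \<le> ((1 / \<sigma>) ^ j)\<^sup>2 * (\<rho> ^ j * c0)" by (intro mult_left_mono pow) simp
    also have "\<dots> = ((1 / \<sigma>)\<^sup>2 * \<rho>) ^ j * c0"
      unfolding power_mult_distrib power_mult[symmetric] mult.commute[of 2 j] by (simp add: mult.assoc)
    also have "(1 / \<sigma>)\<^sup>2 * \<rho> = \<sigma>\<^sup>2" using \<sigma>(1) by (simp add: \<sigma>(3)[symmetric] power2_eq_square power4_eq_xxxx)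
    finally have "?p\<^sup>2 \<le> (\<sigma>\<^sup>2) ^ j" using c0 by simp
    also have "\<dots> = (\<sigma> ^ j)\<^sup>2" unfolding power_mult[symmetric] mult.commute[of 2 j] ..
    finally show ?thesis by (rule power2_le_imp_le) (use \<sigma> in simp)
  qed
  define c where "c = ln (1 / \<sigma>)"
  have c: "c > 0" using \<sigma> by (simp add: c_def)
  have ul: "mean_log_norm (2 * j) \<ge> real j * c * (1 - \<sigma> ^ j)" for j
  proof -
    let ?E = "{\<omega>\<in>space \<Omega>. norm (prodX \<omega> (2 * j)) \<le> (1 / \<sigma>) ^ j}"
    have "real j * c * (1 - \<sigma> ^ j) \<le> real j * c * (1 - measure \<Omega> ?E)"
      using P[of j] c by (intro mult_left_mono) auto
    also have "\<dots> = (\<integral>\<omega>. real j * c * (1 - indicator ?E \<omega>) \<partial>\<Omega>)"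
      by (simp add: \<Omega>.prob_space \<Omega>.emeasure_finite less_top[symmetric])
    also have "\<dots> \<le> mean_log_norm (2 * j)"
      unfolding mean_log_norm_def
    proof (rule integral_mono)
      show "integrable \<Omega> (\<lambda>\<omega>. real j * c * (1 - indicator ?E \<omega>))"
        by (intro integrable_mult_right Bochner_Integration.integrable_diff integrable_real_indicator) (auto simp: \<Omega>.emeasure_finite less_top[symmetric])
      show "integrable \<Omega> (log_norm (2 * j))" by (rule integrable_log_norm)
      fix \<omega> assume sp: "\<omega> \<in> space \<Omega>"
      show "real j * c * (1 - indicator ?E \<omega>) \<le> log_norm (2 * j) \<omega>"
      proof (cases "\<omega> \<in> ?E")
        case True then show ?thesis using log_norm_nonneg by simp
      next
        case False
        then have gt: "norm (prodX \<omega> (2 * j)) > (1 / \<sigma>) ^ j" using sp by auto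
        have pos: "(1 / \<sigma>) ^ j > 0" using \<sigma> by simp
        have "real j * c = ln ((1 / \<sigma>) ^ j)" using \<sigma> by (simp add: c_def ln_realpow)
        also have "\<dots> \<le> log_norm (2 * j) \<omega>" unfolding log_norm_def by (subst ln_le_cancel_iff) (use gt pos in \<open>linarith+\<close>)
        finally show ?thesis using False by simp
      qed
    qed
    finally show ?thesis .
  qed
  have "(\<lambda>j. \<sigma> ^ j) \<longlonglongrightarrow> 0" using \<sigma> by (intro LIMSEQ_power_zero) auto
  then have "eventually (\<lambda>j. \<sigma> ^ j < 1/2) sequentially" by (rule order_tendstoD) simp
  then obtain J where J: "\<And>j. j \<ge> J \<Longrightarrow> \<sigma> ^ j < 1/2" by (auto simp: eventually_sequentially)
  \<comment> \<open>The infimum needs a bound for every \<open>n\<close>, but the estimate is good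
    only at large times. Subadditivity transports it from the long time \<open>2 * j * n\<close> to
    \<open>n\<close>.\<close>
  have "c / 4 \<le> mean_log_norm n / real n" if n: "n \<ge> 1" for n
  proof -
    define j where "j = Suc J"
    have "j * 1 \<le> j * n" using n by (intro mult_le_mono2)
    then have "\<sigma> ^ (j * n) < 1/2" by (intro J) (simp add: j_def)
    then have "real (j * n) * c * (1/2) \<le> real (j * n) * c * (1 - \<sigma> ^ (j * n))"
      using c by (intro mult_left_mono) auto
    also have "\<dots> \<le> mean_log_norm (2 * (j * n))" by (rule ul)
    also have "\<dots> = mean_log_norm ((2 * j) * n)" by (simp add: mult.assoc)
    also have "\<dots> \<le> real (2 * j) * mean_log_norm n" by (rule mean_log_norm_mult_le) (simp add: j_def)
    finally have "real j * (real n * c / 2) \<le> real j * (2 * mean_log_norm n)" by (simp add: algebra_simps)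
    then have "real n * c / 2 \<le> 2 * mean_log_norm n" by (simp add: j_def)
    then show ?thesis using n by (simp add: field_simps)
  qed
  then have "c / 4 \<le> lyapunov" unfolding lyapunov_def by (intro cINF_greatest) auto
  then show ?thesis using c by simp
qed

end

section \<open>Transfer matrices\<close>

text \<open>The four entries of \<open>transfer_prod\<close>, row by row, as polynomials in the
  coupling. The coefficients are complex because they will be combined with complex
  directions.\<close>

fun transfer_poly :: "(nat \<Rightarrow> real) \<Rightarrow> real \<Rightarrow> nat \<Rightarrow> complex poly \<times> complex poly \<times> complex poly \<times> complex poly" where
  "transfer_poly f E 0 = (1, 0, 0, 1)"
| "transfer_poly f E (Suc k) = (case transfer_poly f E k of (a, b, c, d) \<Rightarrow>
     ([:of_real E, - of_real (f k):] * a - c, [:of_real E, - of_real (f k):] * b - d, a, b))"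

lemma transfer_nth: "transfer f i l E $1$1 = E - f i * l" "transfer f i l E $1$2 = -1"
  "transfer f i l E $2$1 = 1" "transfer f i l E $2$2 = 0"
  by (simp_all add: transfer_def)

lemma poly_transfer_poly:
  assumes "transfer_poly f E k = (a, b, c, d)"
  shows "poly a (of_real l) = of_real (transfer_prod f l E k $1$1)" "poly b (of_real l) = of_real (transfer_prod f l E k $1$2)"
    "poly c (of_real l) = of_real (transfer_prod f l E k $2$1)" "poly d (of_real l) = of_real (transfer_prod f l E k $2$2)"
  using assms
proof (atomize (full), induction k arbitrary: a b c d)
  case 0
  then show ?case by (auto simp: mat2_1_nth)
next
  case (Suc k)
  obtain a' b' c' d' where e: "transfer_poly f E k = (a', b', c', d')" by (metis prod_cases4)
  have eq: "a = [:of_real E, - of_real (f k):] * a' - c'" "b = [:of_real E, - of_real (f k):] * b' - d'" "c = a'" "d = b'"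
    using Suc.prems unfolding transfer_poly.simps(2) e by auto
  show ?case using Suc.IH[OF e]
    by (simp add: eq matrix2_mult_nth transfer_nth algebra_simps)
qed

text \<open>Each step multiplies the first row by a factor of degree one with leading coefficient
  \<open>- f k\<close>. The upper left entry therefore dominates, the off-diagonal entries are one
  degree lower, and the lower right entry lower still, possibly zero.\<close>

lemma transfer_poly_degree:
  assumes "transfer_poly f E (Suc k) = (a, b, c, d)" "\<And>i. i < Suc k \<Longrightarrow> f i > 0"
  shows "degree a \<le> Suc k \<and> degree b \<le> k \<and> degree c \<le> k \<and> degree d \<le> k \<and>
     coeff a (Suc k) \<noteq> 0 \<and> coeff b k \<noteq> 0 \<and> coeff c k \<noteq> 0 \<and> coeff d k = 0"
  using assms
proof (induction k arbitrary: a b c d)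
  case 0
  then show ?case by (auto simp: degree_pCons_eq_if)
next
  case (Suc k)
  obtain a' b' c' d' where e: "transfer_poly f E (Suc k) = (a', b', c', d')" by (metis prod_cases4)
  have IH: "degree a' \<le> Suc k" "degree b' \<le> k" "degree c' \<le> k" "degree d' \<le> k"
     "coeff a' (Suc k) \<noteq> 0" "coeff b' k \<noteq> 0" "coeff c' k \<noteq> 0" "coeff d' k = 0"
    using Suc.IH[OF e] Suc.prems(2) by auto
  have eq: "a = [:of_real E, - of_real (f (Suc k)):] * a' - c'" "b = [:of_real E, - of_real (f (Suc k)):] * b' - d'" "c = a'" "d = b'"
    using Suc.prems(1) unfolding transfer_poly.simps(2)[of f E "Suc k"] e by auto
  have fk: "f (Suc k) > 0" using Suc.prems(2) by simp
  have dl: "degree [:complex_of_real E, - of_real (f (Suc k)):] \<le> 1" by simp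
  have "degree a \<le> Suc (Suc k)"
    unfolding eq using IH dl degree_mult_le[of "[:complex_of_real E, - of_real (f (Suc k)):]" a']
    by (intro degree_diff_le) linarith+
  moreover have "degree b \<le> Suc k"
    unfolding eq using IH dl degree_mult_le[of "[:complex_of_real E, - of_real (f (Suc k)):]" b']
    by (intro degree_diff_le) linarith+
  moreover have "coeff a (Suc (Suc k)) = - of_real (f (Suc k)) * coeff a' (Suc k)"
    unfolding eq using IH by (simp add: coeff_eq_0)
  moreover have "coeff b (Suc k) = - of_real (f (Suc k)) * coeff b' k"
    unfolding eq using IH by (simp add: coeff_eq_0)
  moreover have "coeff d (Suc k) = 0" unfolding eq using IH by (simp add: coeff_eq_0)
  ultimately show ?case using IH fk by (auto simp: eq(3,4))
qed

lemma card_real_roots: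
  fixes Q :: "complex poly"
  assumes "Q \<noteq> 0" "degree Q \<le> n"
  shows "finite {l::real. poly Q (of_real l) = 0}" "card {l::real. poly Q (of_real l) = 0} \<le> n"
proof -
  have sub: "complex_of_real ` {l. poly Q (of_real l) = 0} \<subseteq> {z. poly Q z = 0}" by auto
  have inj: "inj_on complex_of_real A" for A by (simp add: inj_on_def)
  have fin: "finite {z. poly Q z = 0}" using assms by (simp add: poly_roots_finite)
  show "finite {l::real. poly Q (of_real l) = 0}"
    using finite_imageD[OF finite_subset[OF sub fin] inj] .
  have "card {l::real. poly Q (of_real l) = 0} = card (complex_of_real ` {l. poly Q (of_real l) = 0})"
    by (simp add: card_image[OF inj])
  also have "\<dots> \<le> card {z. poly Q z = 0}" by (rule card_mono[OF fin sub])
  also have "\<dots> \<le> degree Q" using assms by (intro card_poly_roots_bound)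
  finally show "card {l::real. poly Q (of_real l) = 0} \<le> n" using assms by simp
qed

text \<open>Each of the two forbidden directions excludes at most \<open>n\<close> parameters as
  real roots of a nonzero polynomial, so more than \<open>2 * n\<close> parameters leave one
  over.\<close>

lemma two_direction_free_family:
  assumes T: "finite T" "card T > 2 * n"
    and Q: "\<And>w. w \<noteq> 0 \<Longrightarrow> \<exists>Q. Q \<noteq> 0 \<and> degree Q \<le> n \<and> (\<forall>l. cwedge (cact (g l) p) w = poly Q (of_real l))"
  shows "two_direction_free (g ` T) p"
  unfolding two_direction_free_def
proof (intro allI impI)
  fix v w :: "complex \<times> complex" assume "v \<noteq> 0" "w \<noteq> 0"
  obtain Q1 where Q1: "Q1 \<noteq> 0" "degree Q1 \<le> n" "\<And>l. cwedge (cact (g l) p) v = poly Q1 (of_real l)"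
    using Q[OF \<open>v \<noteq> 0\<close>] by blast
  obtain Q2 where Q2: "Q2 \<noteq> 0" "degree Q2 \<le> n" "\<And>l. cwedge (cact (g l) p) w = poly Q2 (of_real l)"
    using Q[OF \<open>w \<noteq> 0\<close>] by blast
  let ?R = "{l::real. poly Q1 (of_real l) = 0} \<union> {l::real. poly Q2 (of_real l) = 0}"
  have "card ?R \<le> n + n"
    using card_real_roots[OF Q1(1,2)] card_real_roots[OF Q2(1,2)] by (intro order_trans[OF card_Un_le]) simp
  then have "\<not> T \<subseteq> ?R"
    using card_mono[of ?R T] card_real_roots(1)[OF Q1(1,2)] card_real_roots(1)[OF Q2(1,2)] T(2) by auto
  then obtain l where "l \<in> T" "l \<notin> ?R" by blast
  then show "\<exists>h\<in>g ` T. cwedge (cact h p) v \<noteq> 0 \<and> cwedge (cact h p) w \<noteq> 0"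
    using Q1(3) Q2(3) by auto
qed

lemma two_direction_free_mono: "two_direction_free \<G> p \<Longrightarrow> \<G> \<subseteq> \<H> \<Longrightarrow> two_direction_free \<H> p"
  unfolding two_direction_free_def by blast

lemma nondegenerate_mono: "nondegenerate \<G> \<Longrightarrow> \<G> \<subseteq> \<H> \<Longrightarrow> nondegenerate \<H>"
  unfolding nondegenerate_def by (blast intro: two_direction_free_mono image_mono)

lemma nondegenerate_block_transfer:
  assumes \<alpha>: "\<alpha> \<ge> 1" "\<And>i. i < \<alpha> \<Longrightarrow> f i > 0" and T: "finite T" "card T > 2 * \<alpha>"
  shows "nondegenerate ((\<lambda>l. block_transfer \<alpha> f l E) ` T)"
  unfolding nondegenerate_def
proof (intro allI impI)
  fix p :: "complex \<times> complex" assume p: "p \<noteq> 0"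
  obtain x y where xy: "p = (x, y)" by (cases p)
  obtain k where k: "\<alpha> = Suc k" using \<alpha> by (cases \<alpha>) auto
  obtain a b c d where e: "transfer_poly f E \<alpha> = (a, b, c, d)" by (metis prod_cases4)
  have D: "degree a \<le> Suc k" "degree b \<le> k" "degree c \<le> k" "degree d \<le> k"
     "coeff a (Suc k) \<noteq> 0" "coeff b k \<noteq> 0" "coeff c k \<noteq> 0" "coeff d k = 0"
    using transfer_poly_degree[of f E k a b c d] e \<alpha> by (auto simp: k)
  have z: "coeff b (Suc k) = 0" "coeff c (Suc k) = 0" "coeff d (Suc k) = 0" using D by (auto intro: coeff_eq_0)
  note ev = poly_transfer_poly[OF e, symmetric]
  show "two_direction_free ((\<lambda>l. block_transfer \<alpha> f l E) ` T) p \<or> two_direction_free (inv2 ` (\<lambda>l. block_transfer \<alpha> f l E) ` T) p"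
  proof (cases "x = 0")
    case False
    \<comment> \<open>Nonvanishing is read off one coefficient: \<open>v * x\<close> times the
      leading coefficient of \<open>a\<close> if \<open>v\<close> is nonzero, otherwise
      \<open>- u * x\<close> times that of \<open>c\<close>.\<close>
    have "two_direction_free ((\<lambda>l. block_transfer \<alpha> f l E) ` T) p"
    proof (rule two_direction_free_family[OF T])
      fix w :: "complex \<times> complex" assume w: "w \<noteq> 0"
      obtain u v where uv: "w = (u, v)" by (cases w)
      define Q where "Q = smult v (smult x a + smult y b) - smult u (smult x c + smult y d)"
      have "degree Q \<le> \<alpha>" unfolding Q_def k
        using D by (intro degree_diff_le order_trans[OF degree_smult_le] degree_add_le) auto
      moreover have "Q \<noteq> 0"
      proof (cases "v = 0")
        case True
        then have "u \<noteq> 0" using w uv by (auto simp: zero_prod_def)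
        then have "coeff Q k \<noteq> 0" using True D \<open>x \<noteq> 0\<close> by (simp add: Q_def)
        then show ?thesis by auto
      next
        case v: False
        then have "coeff Q (Suc k) \<noteq> 0" using z D \<open>x \<noteq> 0\<close> by (simp add: Q_def)
        then show ?thesis by auto
      qed
      moreover have "\<forall>l. cwedge (cact (block_transfer \<alpha> f l E) p) w = poly Q (of_real l)"
        by (simp add: Q_def block_transfer_def cwedge_def cact_def ev xy uv algebra_simps)
      ultimately show "\<exists>Q. Q \<noteq> 0 \<and> degree Q \<le> \<alpha> \<and> (\<forall>l. cwedge (cact (block_transfer \<alpha> f l E) p) w = poly Q (of_real l))" by blast
    qed
    then show ?thesis ..
  next
    case True
    then have y: "y \<noteq> 0" using p xy by (auto simp: zero_prod_def)
    \<comment> \<open>Here \<open>M p\<close> is a multiple of \<open>(b, d)\<close> and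
      \<open>d\<close> may be zero, so its direction need not vary. The inverse takes
      \<open>p\<close> to a multiple of \<open>(- b, a)\<close>, where the leading coefficients of
      \<open>a\<close> and \<open>b\<close> decide.\<close>
    have "two_direction_free ((\<lambda>l. inv2 (block_transfer \<alpha> f l E)) ` T) p"
    proof (rule two_direction_free_family[OF T])
      fix w :: "complex \<times> complex" assume w: "w \<noteq> 0"
      obtain u v where uv: "w = (u, v)" by (cases w)
      define Q where "Q = smult v (smult x d - smult y b) - smult u (smult y a - smult x c)"
      have "degree Q \<le> \<alpha>" unfolding Q_def k
        using D by (intro degree_diff_le order_trans[OF degree_smult_le] degree_add_le) auto
      moreover have "Q \<noteq> 0"
      proof (cases "u = 0")
        case True
        then have "v \<noteq> 0" using w uv by (auto simp: zero_prod_def)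
        then have "coeff Q k \<noteq> 0" using True D y by (simp add: Q_def)
        then show ?thesis by auto
      next
        case v: False
        then have "coeff Q (Suc k) \<noteq> 0" using z D y by (simp add: Q_def)
        then show ?thesis by auto
      qed
      moreover have "\<forall>l. cwedge (cact (inv2 (block_transfer \<alpha> f l E)) p) w = poly Q (of_real l)"
        by (simp add: Q_def block_transfer_def cwedge_def cact_def ev xy uv algebra_simps)
      ultimately show "\<exists>Q. Q \<noteq> 0 \<and> degree Q \<le> \<alpha> \<and> (\<forall>l. cwedge (cact (inv2 (block_transfer \<alpha> f l E)) p) w = poly Q (of_real l))" by blast
    qed
    then show ?thesis by (simp add: image_image)
  qed
qed

text \<open>The complement of the support is a union of null open sets, and by the Lindelof property
  countably many of them suffice.\<close>

lemma AE_in_msupp: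
  assumes "sets \<nu> = sets borel"
  shows "AE x in \<nu>. x \<in> msupp \<nu>"
proof -
  define \<F> where "\<F> = {U :: real set. open U \<and> emeasure \<nu> U = 0}"
  obtain \<F>' where F': "\<F>' \<subseteq> \<F>" "countable \<F>'" "\<Union>\<F>' = \<Union>\<F>"
    using Lindelof[of \<F>] by (auto simp: \<F>_def)
  have "(\<Union>U\<in>\<F>'. U) \<in> null_sets \<nu>"
    using F' by (intro null_sets_UN') (auto simp: \<F>_def null_sets_def assms)
  moreover have "- msupp \<nu> \<subseteq> \<Union>\<F>"
    by (auto simp: msupp_def \<F>_def not_less)
  ultimately show ?thesis
    using F'(3) by (intro AE_I'[of "\<Union>\<F>"]) auto
qed

text \<open>A property of full measure may fail at the points of the support, but it holds somewhere
  in every neighbourhood of them. Neighbourhoods of radius half the minimal distance keep the chosen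
  points distinct.\<close>

lemma full_measure_many_points:
  assumes "sets \<nu> = sets borel" and Q: "AE x in \<nu>. Q x" and inf: "infinite (msupp \<nu>) \<or> card (msupp \<nu>) \<ge> n"
  obtains T where "finite T" "card T = n" "\<And>x. x \<in> T \<Longrightarrow> Q x"
proof -
  obtain S where S: "S \<subseteq> msupp \<nu>" "finite S" "card S = n"
  proof (cases "infinite (msupp \<nu>)")
    case True
    then show ?thesis using infinite_arbitrarily_large[OF True, of n] that by blast
  next
    case False
    then have "n \<le> card (msupp \<nu>)" using inf by blast
    then show ?thesis using that by (rule obtain_subset_with_card_n)
  qed
  obtain d where d: "d > 0" "\<And>x y. x \<in> S \<Longrightarrow> y \<in> S \<Longrightarrow> x \<noteq> y \<Longrightarrow> d \<le> dist x y"
  proof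
    \<comment> \<open>The inserted 1 keeps the minimum defined when \<open>S\<close> has fewer than
      two points.\<close>
    define D where "D = insert 1 ((\<lambda>(x, y). dist x y) ` {(x, y). x \<in> S \<and> y \<in> S \<and> x \<noteq> y})"
    have "finite {(x, y). x \<in> S \<and> y \<in> S \<and> x \<noteq> y}"
      by (rule finite_subset[of _ "S \<times> S"]) (use S(2) in auto)
    then have D: "finite D" "D \<noteq> {}" by (auto simp: D_def)
    show "Min D > 0" using D by (subst Min_gr_iff) (auto simp: D_def)
    fix x y assume "x \<in> S" "y \<in> S" "x \<noteq> y"
    then have "dist x y \<in> D" by (force simp: D_def)
    then show "Min D \<le> dist x y" using D by simp
  qed
  have "\<exists>z. z \<in> ball x (d/2) \<and> Q z" if "x \<in> S" for x
  proof (rule ccontr)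
    assume "\<not> ?thesis"
    then have "AE z in \<nu>. z \<notin> ball x (d/2)" using Q by (auto elim!: eventually_mono)
    then have "ball x (d/2) \<in> null_sets \<nu>"
      using assms(1) by (subst AE_iff_null_sets) auto
    then have "emeasure \<nu> (ball x (d/2)) = 0" by (simp add: null_sets_def)
    moreover have "x \<in> msupp \<nu>" using S(1) that by blast
    then have "emeasure \<nu> (ball x (d/2)) > 0" unfolding msupp_def using d(1) by auto
    ultimately show False by simp
  qed
  then have "\<forall>x\<in>S. \<exists>z. z \<in> ball x (d/2) \<and> Q z" by blast
  from bchoice[OF this] obtain g where g: "\<And>x. x \<in> S \<Longrightarrow> dist x (g x) < d/2 \<and> Q (g x)" by auto
  have "inj_on g S"
  proof (rule inj_onI, rule ccontr)
    fix x y assume xy: "x \<in> S" "y \<in> S" "g x = g y" "x \<noteq> y"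
    have "dist x y \<le> dist x (g x) + dist y (g x)" by (rule dist_triangle2)
    then show False using g[OF xy(1)] g[OF xy(2)] d(2)[OF xy(1,2,4)] xy(3) by simp
  qed
  then show ?thesis using that[of "g ` S"] S g by (auto simp: card_image)
qed

lemma continuous_on_transfer_prod: "continuous_on UNIV (\<lambda>l. transfer_prod f l E k)"
proof (induction k)
  case (Suc k)
  have "(\<lambda>l. transfer f k l E) = (\<lambda>l. transfer f k 0 E + l *\<^sub>R vector [vector [- f k, 0], vector [0, 0]])"
    by (simp add: fun_eq_iff matrix2_eq_iff transfer_nth)
  moreover have "continuous_on UNIV (\<lambda>l. transfer f k 0 E + l *\<^sub>R vector [vector [- f k, 0], vector [0, 0]])"
    by (intro continuous_intros)
  ultimately have c: "continuous_on UNIV (\<lambda>l. transfer f k l E)" by (simp only:)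
  have "continuous_on UNIV (\<lambda>l. transfer f k l E ** transfer_prod f l E k)"
    unfolding matrix_matrix_mult_def using c Suc
    by (intro continuous_intros continuous_on_vec_lambda) auto
  then show ?case by simp
qed simp

lemma det_transfer_prod: "det (transfer_prod f l E k) = 1"
proof (induction k)
  case (Suc k)
  have "det (transfer f k l E) = 1" by (simp add: det_2 transfer_nth)
  then show ?case using Suc by (simp add: det_mul)
qed simp

theorem mainTheorem13:
  fixes \<alpha> :: nat and f :: "nat \<Rightarrow> real" and \<nu> :: "real measure"
  assumes "\<alpha> \<ge> 1"
    and "\<And>i. i < \<alpha> \<Longrightarrow> f i > 0"
    and "prob_space \<nu>"
    and "sets \<nu> = sets borel"
    and "compact (msupp \<nu>)"
    and "infinite (msupp \<nu>) \<or> card (msupp \<nu>) \<ge> 35 * \<alpha>"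
  shows "\<forall>E::real. \<exists>L>0. AE \<omega> in (\<Pi>\<^sub>M i\<in>(UNIV::nat set). \<nu>).
           (\<lambda>n. ln (norm (cocycle \<alpha> f E \<omega> n)) / real n) \<longlonglongrightarrow> L"
proof
  fix E :: real
  interpret prob_space \<nu> by fact
  let ?S = "msupp \<nu>"
  have "?S \<noteq> {}" using assms(1,6) by (auto simp: card_gt_0_iff)
  then obtain s0 where s0: "s0 \<in> ?S" by blast
  \<comment> \<open>Redefined off the support, so that the norm bound holds everywhere.\<close>
  define X where "X s = block_transfer \<alpha> f (if s \<in> ?S then s else s0) E" for s
  have S_borel [measurable]: "?S \<in> sets borel" using assms(5) by (intro borel_compact)
  have cont: "continuous_on A (\<lambda>l. block_transfer \<alpha> f l E)" for A
    unfolding block_transfer_def by (rule continuous_on_subset[OF continuous_on_transfer_prod]) simp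
  have "bounded ((\<lambda>l. block_transfer \<alpha> f l E) ` ?S)"
    by (intro compact_imp_bounded compact_continuous_image cont assms)
  then obtain K where K: "\<And>l. l \<in> ?S \<Longrightarrow> norm (block_transfer \<alpha> f l E) \<le> K" by (auto simp: bounded_iff)
  interpret nondegenerate_random_SL2 \<nu> X K
  proof
    have "(\<lambda>l. block_transfer \<alpha> f l E) \<in> borel_measurable borel"
      by (rule borel_measurable_continuous_onI[OF cont])
    moreover have "(\<lambda>s. if s \<in> ?S then s else s0) \<in> \<nu> \<rightarrow>\<^sub>M borel"
      using assms(4) by (intro measurable_If) (auto simp: measurable_ident_sets sets_eq_imp_space_eq)
    ultimately show "X \<in> borel_measurable \<nu>"
      unfolding X_def[abs_def] by (rule measurable_compose[rotated])
    show "det (X s) = 1" for s by (simp add: X_def block_transfer_def det_transfer_prod)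
    show "norm (X s) \<le> K" for s using K s0 by (simp add: X_def)
    fix Q assume Q: "AE s in \<nu>. Q s"
    have "AE s in \<nu>. Q s \<and> s \<in> ?S" using Q AE_in_msupp[OF assms(4)] by auto
    then obtain T where T: "finite T" "card T = 35 * \<alpha>" "\<And>x. x \<in> T \<Longrightarrow> Q x \<and> x \<in> ?S"
      using full_measure_many_points[OF assms(4) _ assms(6)] by blast
    have "nondegenerate ((\<lambda>l. block_transfer \<alpha> f l E) ` T)"
      using assms(1,2) T by (intro nondegenerate_block_transfer) auto
    moreover have "(\<lambda>l. block_transfer \<alpha> f l E) ` T \<subseteq> X ` {s\<in>space \<nu>. Q s}"
      using T(3) assms(4)[THEN sets_eq_imp_space_eq] by (force simp: X_def)
    ultimately show "nondegenerate (X ` {s\<in>space \<nu>. Q s})" by (rule nondegenerate_mono)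
  qed
  \<comment> \<open>Almost surely all parameters lie in the support, where \<open>X\<close> agrees
    with the block transfer matrix, so the abstract product is the cocycle.\<close>
  have "AE \<omega> in \<Omega>. \<forall>i. \<omega> i \<in> ?S"
    unfolding AE_all_countable
    by (intro allI AE_PiM_component[of UNIV "\<lambda>_. \<nu>"] AE_in_msupp assms) auto
  with lyapunov_limit have "AE \<omega> in \<Omega>. (\<lambda>n. ln (norm (cocycle \<alpha> f E \<omega> n)) / real n) \<longlonglongrightarrow> lyapunov"
  proof eventually_elim
    case (elim \<omega>)
    have "prodX \<omega> n = cocycle \<alpha> f E \<omega> n" for n
      using elim(2) by (induction n) (simp_all add: X_def)
    with elim(1) show ?case by (simp add: log_norm_def)
  qed
  then show "\<exists>L>0. AE \<omega> in \<Omega>. (\<lambda>n. ln (norm (cocycle \<alpha> f E \<omega> n)) / real n) \<longlonglongrightarrow> L"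
    using lyapunov_pos by blast
qed

end
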